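(* Let $A \subset \mathbb{R}$ be a finite set with $|A| \ge 2$. Then $$\max\{|A+A|,\ |AA|\} \gtrsim |A|^{\frac{4}{3}+c}, \qquad c=\frac{5}{9813}.$$ The same is true if one replaces $AA$ by $A/A$, i.e. $\max\{|A+A|, |A/A|\} \gtrsim |A|^{\frac43 + c}$.
   Context: For finite $A,B\subset\mathbb{R}$: $A+B=\{a+b: a\in A, b\in B\}$, $AB=\{ab : a\in A, b\in B\}$, $A/B=\{a/b: a\in A, b\in B, b\neq 0\}$. Notation: $X \lesssim Y$ (equivalently $Y \gtrsim X$) means $X = O(Y\cdot \log^{C}|A|)$ for some absolute constant $C>0$, with an absolute implied constant. *)

theory Defs
  imports Complex_Main "HOL-Library.Set_Algebras"
begin

text \<open>
  Sumsets and product sets are the library's \<open>A + B\<close> and \<open>A * B\<close> on sets.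
  The quotient set must exclude zero denominators explicitly, since \<open>a / 0 = 0\<close> in HOL.
\<close>

definition quotient_set :: "real set \<Rightarrow> real set \<Rightarrow> real set" where
  "quotient_set A B = {a / b | a b. a \<in> A \<and> b \<in> B \<and> b \<noteq> 0}"

text \<open>
  \<open>polylog_le X Y\<close> renders $X \lesssim Y$ for quantities \<open>X A\<close>, \<open>Y A\<close> depending on a finite
  set \<open>A\<close> of reals with at least two elements. The exponent \<open>C\<close> and the implied constant \<open>K\<close>
  are absolute, hence chosen before \<open>A\<close>; \<open>ln (card A) > 0\<close> on this range.
\<close>

definition polylog_le :: "(real set \<Rightarrow> real) \<Rightarrow> (real set \<Rightarrow> real) \<Rightarrow> bool" where
  "polylog_le X Y \<longleftrightarrow>
    (\<exists>C>0. \<exists>K>0. \<forall>A. finite A \<and> card A \<ge> 2 \<longrightarrow>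
      \<bar>X A\<bar> \<le> K * \<bar>Y A * ln (real (card A)) powr C\<bar>)"

end

theory Submission
  imports Defs "HOL-Analysis.Convex" "HOL-Analysis.Harmonic_Numbers"
begin

text \<open>
  Let \<open>A\<close> consist of positive reals, and suppose that \<open>A + A\<close> and the product (or quotient) set
  \<open>R\<close> both have about \<open>|A|\<^bsup>4/3\<^esup>\<close> elements. Solymosi places the points of \<open>A \<times> A\<close> on rays through
  the origin; the vector sums of points on neighbouring rays lie in disjoint sectors. Following
  Konyagin and Shkredov, one also adds points on different rays of a block of nearby rays. This wins
  a power of \<open>|A|\<close> unless many of these vector sums coincide. Coincidences amount to a dense linear
  relation between the sets \<open>A\<^sub>\<mu> = A \<inter> \<mu>\<^sup>-\<^sup>1 A\<close>, so that \<open>A\<^sub>\<mu>\<close> is additively structured. Applied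
  to \<open>A\<^sub>\<mu>\<close>, Solymosi's argument shows that the product set of \<open>A\<^sub>\<mu>\<close> and \<open>A\<close>, which is contained in
  \<open>R \<inter> \<mu>\<^sup>-\<^sup>1 R\<close>, is nearly as large as \<open>R\<close>.
  Hence most ratios of elements of \<open>A\<close> have about \<open>|R|\<close> representations as ratios of elements of
  \<open>R\<close>, and the Szemeredi--Trotter bound, needed only for Cartesian products, where it is
  elementary, controls the popular differences of a large subset of \<open>A\<close> so well that its sumset
  has more than \<open>|A|\<^bsup>4/3\<^esup>\<close> elements.
\<close>

section \<open>Counting collisions and popular levels\<close>

text \<open>Solymosi's bound |A|^4 <~ |R| |A + A|^2 stops exactly at 4/3. So does the plain third
  moment method: with a Szemeredi--Trotter constant of about |A|^(4/3), the additive energy of A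
  alone again gives |A + A| >~ |A|^(4/3). Each half therefore needs its own gain: blocks of many
  rays in the first, and in the second the representations of popular differences in A + A, which
  raise 4/3 to 37/27 for a subset of size comparable to |A|. The two halves are joined by the slack
  M of Solymosi's inequality, about |R| |A + A|^2 / |A|^4 up to logarithms. Blocks of M rays would
  produce too many vector sums unless some of these coincide often, so the structure that is found
  costs only powers of M: M^12 if the two pairs of rays are disjoint, M^10 if they share a ray.
  Replacing M by its value dilutes the gain to the exponents 799/599 = 4/3 + 1/1797 and 855/641 =
  4/3 + 1/1923; if there are too few rays to fill blocks, the exponent is 3/2. All three exceed 4/3
  + 5/9813, since 9813/5 = 1962.6.\<close>

definition collisions :: "('a \<Rightarrow> 'b) \<Rightarrow> 'a set \<Rightarrow> ('a \<times> 'a) set" where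
  "collisions f S = {(x, y). x \<in> S \<and> y \<in> S \<and> f x = f y}"

lemma finite_collisions [simp]: "finite S \<Longrightarrow> finite (collisions f S)"
  by (rule finite_subset[of _ "S \<times> S"]) (auto simp: collisions_def)

lemma card_collisions_eq_sum:
  assumes "finite S"
  shows "card (collisions f S) = (\<Sum>y\<in>f ` S. (card {x \<in> S. f x = y})\<^sup>2)"
proof -
  have "collisions f S = (SIGMA x:S. {x' \<in> S. f x' = f x})"
    by (auto simp: collisions_def)
  then have "card (collisions f S) = (\<Sum>x\<in>S. card {x' \<in> S. f x' = f x})"
    using assms by (simp add: card_SigmaI)
  also have "\<dots> = (\<Sum>y\<in>f ` S. \<Sum>x\<in>{x. x \<in> S \<and> f x = y}. card {x' \<in> S. f x' = f x})"
    by (rule sum.image_gen[OF assms])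
  also have "\<dots> = (\<Sum>y\<in>f ` S. (card {x \<in> S. f x = y})\<^sup>2)"
    by (intro sum.cong refl) (simp add: power2_eq_square)
  finally show ?thesis .
qed

lemma card_eq_sum_fibres:
  assumes "finite S"
  shows "card S = (\<Sum>y\<in>f ` S. card {x \<in> S. f x = y})"
  using sum.image_gen[OF assms, of "\<lambda>_. 1::nat" f] by simp

text \<open>Cauchy--Schwarz over the fibres of \<open>f\<close>: few values force many collisions.
  Read backwards, few collisions force a large image.\<close>

lemma card_square_le_image_collisions:
  assumes "finite S" "f ` S \<subseteq> T" "finite T"
  shows "(real (card S))\<^sup>2 \<le> real (card T) * real (card (collisions f S))"
proof -
  have "(real (card S))\<^sup>2 = (\<Sum>y\<in>f ` S. real (card {x \<in> S. f x = y}))\<^sup>2"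
    by (subst card_eq_sum_fibres[OF assms(1), of f]) simp
  also have "\<dots> \<le> (\<Sum>y\<in>f ` S. (real (card {x \<in> S. f x = y}))\<^sup>2) * real (card (f ` S))"
    by (rule sum_squared_le_sum_of_squares)
  also have "\<dots> = real (card (f ` S)) * real (card (collisions f S))"
    by (simp add: card_collisions_eq_sum[OF assms(1)])
  also have "\<dots> \<le> real (card T) * real (card (collisions f S))"
    by (intro mult_right_mono) (use assms card_mono in auto)
  finally show ?thesis .
qed

text \<open>The increments satisfy x^k - (x - 1)^k \<le> k x^(k-1) by convexity. Only the first
  three moments occur later, so the cases are expanded.\<close>

lemma power_le_sum_layers:
  assumes "k \<in> {1, 2, 3::nat}"
  shows "real x ^ k \<le> (\<Sum>t=1..x. real k * real t ^ (k - 1))"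
proof (induction x)
  case (Suc x)
  have "real (Suc x) ^ k \<le> real x ^ k + real k * real (Suc x) ^ (k - 1)"
    using assms by (auto simp: power2_eq_square power3_eq_cube algebra_simps)
  with Suc show ?case by simp
qed (use assms in auto)

text \<open>Summation by layers: a bound Q / t^k for the number of \<open>y\<close> with
  \<open>g y\<close> at least \<open>t\<close> bounds the k-th moment by the sum of k t^(k-1) Q /
  t^k over \<open>t\<close>. The harmonic number is the source of every logarithm in the
  proof.\<close>

lemma sum_power_le_harm:
  fixes g :: "'a \<Rightarrow> nat" and Q :: real
  assumes "finite Y" "\<And>y. y \<in> Y \<Longrightarrow> g y \<le> n" "k \<in> {1, 2, 3::nat}"
    and Q: "\<And>t. 1 \<le> t \<Longrightarrow> t \<le> n \<Longrightarrow> real t ^ k * real (card {y \<in> Y. t \<le> g y}) \<le> Q"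
  shows "(\<Sum>y\<in>Y. real (g y) ^ k) \<le> real k * harm n * Q"
proof -
  have "(\<Sum>y\<in>Y. real (g y) ^ k) \<le> (\<Sum>y\<in>Y. \<Sum>t=1..g y. real k * real t ^ (k - 1))"
    by (intro sum_mono power_le_sum_layers assms)
  also have "\<dots> = (\<Sum>y\<in>Y. \<Sum>t=1..n. if t \<le> g y then real k * real t ^ (k - 1) else 0)"
  proof (rule sum.cong[OF refl])
    fix y assume "y \<in> Y"
    then have "{1..g y} = {t \<in> {1..n}. t \<le> g y}" using assms(2)[of y] by auto
    then show "(\<Sum>t=1..g y. real k * real t ^ (k - 1)) =
        (\<Sum>t=1..n. if t \<le> g y then real k * real t ^ (k - 1) else 0)"
      by (simp only: sum.inter_filter finite_atLeastAtMost)
  qed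
  also have "\<dots> = (\<Sum>t=1..n. \<Sum>y\<in>Y. if t \<le> g y then real k * real t ^ (k - 1) else 0)"
    by (rule sum.swap)
  also have "\<dots> = (\<Sum>t=1..n. real k * real t ^ (k - 1) * real (card {y \<in> Y. t \<le> g y}))"
    using assms(1) by (intro sum.cong refl) (simp flip: sum.inter_filter)
  also have "\<dots> \<le> (\<Sum>t=1..n. real k * Q * inverse (real t))"
  proof (intro sum_mono)
    fix t assume t: "t \<in> {1..n}"
    have "real t ^ k = real t ^ (k - 1) * real t" using assms(3) by (auto simp: power_eq_if)
    then have "real t ^ (k - 1) * real (card {y \<in> Y. t \<le> g y}) * real t \<le> Q"
      using Q[of t] t by (simp add: mult_ac)
    then have "real t ^ (k - 1) * real (card {y \<in> Y. t \<le> g y}) \<le> Q * inverse (real t)"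
      using t by (simp add: field_simps)
    then show "real k * real t ^ (k - 1) * real (card {y \<in> Y. t \<le> g y}) \<le> real k * Q * inverse (real t)"
      by (metis mult.assoc mult_left_mono of_nat_0_le_iff)
  qed
  also have "\<dots> = real k * harm n * Q"
    by (simp add: harm_def sum_distrib_left mult_ac)
  finally show ?thesis .
qed

text \<open>Replaces dyadic pigeonholing: the \<open>t\<close> that maximizes t^k times the size of
  its superlevel set captures the whole moment up to k \<open>harm n\<close>.\<close>

lemma popular_level:
  fixes g :: "'a \<Rightarrow> nat"
  assumes "finite Y" "\<And>y. y \<in> Y \<Longrightarrow> g y \<le> n" "k \<in> {1, 2, 3::nat}" "1 \<le> n"
  obtains t where "1 \<le> t" "t \<le> n"
    "(\<Sum>y\<in>Y. real (g y) ^ k) \<le> real k * harm n * (real t ^ k * real (card {y \<in> Y. t \<le> g y}))"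
proof -
  define F where "F t = real t ^ k * real (card {y \<in> Y. t \<le> g y})" for t
  have ne: "F ` {1..n} \<noteq> {}" using assms(4) by auto
  have "Max (F ` {1..n}) \<in> F ` {1..n}" by (rule Max_in) (use ne in auto)
  then obtain t where t: "t \<in> {1..n}" "F t = Max (F ` {1..n})" by auto
  have "(\<Sum>y\<in>Y. real (g y) ^ k) \<le> real k * harm n * F t"
  proof (rule sum_power_le_harm[OF assms(1,2,3)])
    fix u assume "1 \<le> u" "u \<le> n"
    then have "F u \<le> F t" unfolding t(2) by (intro Max_ge) auto
    then show "real u ^ k * real (card {y \<in> Y. u \<le> g y}) \<le> F t" by (simp add: F_def)
  qed
  then show thesis using that[of t] t by (auto simp: F_def)
qed

section \<open>Blocks of slopes and the sectors they span\<close>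

definition separated :: "real set \<Rightarrow> real set \<Rightarrow> bool" where
  "separated I J \<longleftrightarrow> (\<forall>x\<in>I. \<forall>y\<in>J. x < y) \<or> (\<forall>x\<in>I. \<forall>y\<in>J. y < x)"

lemma initial_segment_exists:
  fixes \<Lambda> :: "real set"
  assumes "finite \<Lambda>" "m \<le> card \<Lambda>"
  shows "\<exists>I\<subseteq>\<Lambda>. card I = m \<and> (\<forall>x\<in>I. \<forall>y\<in>\<Lambda> - I. x < y)"
  using assms(2)
proof (induction m)
  case (Suc m)
  then obtain I where I: "I \<subseteq> \<Lambda>" "card I = m" "\<forall>x\<in>I. \<forall>y\<in>\<Lambda> - I. x < y" by auto
  have fin: "finite (\<Lambda> - I)" "finite I" using assms(1) I(1) finite_subset by auto
  have "\<Lambda> - I \<noteq> {}"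
    using Suc.prems I(1,2) assms(1) by (metis Diff_eq_empty_iff Suc_n_not_le_n subset_antisym)
  then have min: "Min (\<Lambda> - I) \<in> \<Lambda> - I" using fin by (intro Min_in)
  let ?I = "insert (Min (\<Lambda> - I)) I"
  have "card ?I = Suc m" using min fin I(2) by simp
  moreover have "\<forall>x\<in>?I. \<forall>y\<in>\<Lambda> - ?I. x < y"
    using I(3) fin by (auto simp: order.not_eq_order_implies_strict)
  ultimately show ?case using I(1) min by (intro exI[of _ ?I]) auto
qed (auto intro: exI[of _ "{}"])

text \<open>The \<open>m\<close> smallest elements are cut off repeatedly; fewer than
  \<open>m\<close> remain at the end, hence the rounded quotient.\<close>

lemma separated_blocks_exist:
  fixes \<Lambda> :: "real set"
  assumes "finite \<Lambda>" "0 < m"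
  shows "\<exists>\<C>. finite \<C> \<and> card \<C> = card \<Lambda> div m \<and> (\<forall>I\<in>\<C>. I \<subseteq> \<Lambda> \<and> card I = m) \<and>
    (\<forall>I\<in>\<C>. \<forall>J\<in>\<C>. I \<noteq> J \<longrightarrow> separated I J)"
  using assms(1)
proof (induction "card \<Lambda>" arbitrary: \<Lambda> rule: less_induct)
  case less
  show ?case
  proof (cases "card \<Lambda> < m")
    case True
    then show ?thesis by (intro exI[of _ "{}"]) auto
  next
    case False
    then obtain I where I: "I \<subseteq> \<Lambda>" "card I = m" "\<forall>x\<in>I. \<forall>y\<in>\<Lambda> - I. x < y"
      using initial_segment_exists[OF less.prems, of m] by auto
    have finI: "finite I" using I(1) less.prems finite_subset by auto
    have c: "card (\<Lambda> - I) = card \<Lambda> - m" using I finI by (simp add: card_Diff_subset)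
    then have "card (\<Lambda> - I) < card \<Lambda>" using False assms(2) by simp
    then obtain \<C> where C: "finite \<C>" "card \<C> = card (\<Lambda> - I) div m"
      "\<forall>J\<in>\<C>. J \<subseteq> \<Lambda> - I \<and> card J = m" "\<forall>J\<in>\<C>. \<forall>K\<in>\<C>. J \<noteq> K \<longrightarrow> separated J K"
      using less.hyps[of "\<Lambda> - I"] less.prems by auto
    have "I \<notin> \<C>"
    proof
      assume "I \<in> \<C>"
      then have "I \<subseteq> \<Lambda> - I" using C(3) by auto
      then have "I = {}" by auto
      then show False using I(2) assms(2) by simp
    qed
    then have "card (insert I \<C>) = Suc ((card \<Lambda> - m) div m)" using C(1,2) c by simp
    also have "\<dots> = card \<Lambda> div m" using False assms(2) by (simp add: le_div_geq)
    finally have "card (insert I \<C>) = card \<Lambda> div m" .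
    moreover have "separated I J" "separated J I" if "J \<in> \<C>" for J
      using I(3) C(3) that unfolding separated_def by blast+
    ultimately show ?thesis using C I
      by (intro exI[of _ "insert I \<C>"]) auto
  qed
qed

text \<open>Separated blocks span disjoint intervals. With \<sigma> the slope of a vector sum, this
  says that the sum reveals the block from which it was formed.\<close>

lemma separated_sectors_disjoint:
  assumes "\<forall>I\<in>\<C>. \<forall>J\<in>\<C>. I \<noteq> J \<longrightarrow> separated I J" "I \<in> \<C>" "J \<in> \<C>"
    and "x \<in> I" "x' \<in> I" "min x x' < \<sigma>" "\<sigma> < max x x'"
    and "y \<in> J" "y' \<in> J" "min y y' < \<sigma>" "\<sigma> < max y y'"
  shows "I = J"
proof (rule ccontr)
  assume "I \<noteq> J"
  then have "separated I J" using assms by auto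
  then have "x < y \<and> x < y' \<and> x' < y \<and> x' < y' \<or> y < x \<and> y' < x \<and> y < x' \<and> y' < x'"
    using assms unfolding separated_def by auto
  then show False using assms by (auto simp: min_def max_def split: if_splits)
qed

text \<open>The slope of the sum is the mean of \<mu> and \<nu> with the positive weights
  \<open>u\<close> and \<open>v\<close>.\<close>

lemma slope_of_sum_between:
  fixes \<mu> \<nu> u v :: real
  assumes "0 < u" "0 < v" "\<mu> \<noteq> \<nu>"
  shows "min \<mu> \<nu> < (\<mu> * u + \<nu> * v) / (u + v)" "(\<mu> * u + \<nu> * v) / (u + v) < max \<mu> \<nu>"
proof -
  have "\<mu> * u + \<nu> * v - \<mu> * (u + v) = (\<nu> - \<mu>) * v" "\<nu> * (u + v) - (\<mu> * u + \<nu> * v) = (\<nu> - \<mu>) * u"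
    by (simp_all add: algebra_simps)
  moreover have "(\<nu> - \<mu>) * v > 0 \<longleftrightarrow> \<mu> < \<nu>" "(\<nu> - \<mu>) * u > 0 \<longleftrightarrow> \<mu> < \<nu>"
    "(\<nu> - \<mu>) * v < 0 \<longleftrightarrow> \<nu> < \<mu>" "(\<nu> - \<mu>) * u < 0 \<longleftrightarrow> \<nu> < \<mu>"
    using assms by (auto simp: zero_less_mult_iff mult_less_0_iff)
  ultimately have *: "\<mu> < \<nu> \<Longrightarrow> \<mu> * (u + v) < \<mu> * u + \<nu> * v \<and> \<mu> * u + \<nu> * v < \<nu> * (u + v)"
    "\<nu> < \<mu> \<Longrightarrow> \<mu> * (u + v) > \<mu> * u + \<nu> * v \<and> \<mu> * u + \<nu> * v > \<nu> * (u + v)"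
    by linarith+
  have pos: "0 < u + v" using assms by simp
  have "\<mu> < \<nu> \<or> \<nu> < \<mu>" using assms by auto
  then show "min \<mu> \<nu> < (\<mu> * u + \<nu> * v) / (u + v)" "(\<mu> * u + \<nu> * v) / (u + v) < max \<mu> \<nu>"
    using * pos by (auto simp: min_def max_def pos_less_divide_eq pos_divide_less_eq)
qed

section \<open>Incidences with Cartesian products\<close>

text \<open>\<phi> is the rank scaled by k / |D| and rounded down. A fibre consists of consecutive
  ranks and has at most |D| / k + 1 elements; since k \<le> |D|, the 1 is absorbed by the factor
  2.\<close>

lemma monotone_equipartition:
  fixes D :: "real set"
  assumes "finite D" "1 \<le> k" "k \<le> card D"
  shows "\<exists>\<phi>. (\<forall>d\<in>D. \<phi> d < k) \<and> (\<forall>d\<in>D. \<forall>d'\<in>D. d \<le> d' \<longrightarrow> \<phi> d \<le> \<phi> d') \<and>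
    (\<forall>i. card {d \<in> D. \<phi> d = i} * k \<le> 2 * card D)"
proof -
  define rk where "rk d = card {d' \<in> D. d' < d}" for d
  define \<phi> where "\<phi> d = rk d * k div card D" for d
  have pos: "0 < card D" using assms by simp
  have rk_less: "rk d < rk d'" if "d \<in> D" "d < d'" for d d'
    unfolding rk_def using that assms(1) by (intro psubset_card_mono) auto
  have rk_mono: "rk d \<le> rk d'" if "d \<le> d'" for d d'
    unfolding rk_def using that assms(1) by (intro card_mono) auto
  have rk_bound: "rk d < card D" if "d \<in> D" for d
    unfolding rk_def using that assms(1) by (intro psubset_card_mono) auto
  have "\<phi> d < k" if "d \<in> D" for d
    using rk_bound[OF that] assms(2) pos by (simp add: \<phi>_def less_mult_imp_div_less mult.commute)
  moreover have "\<phi> d \<le> \<phi> d'" if "d \<le> d'" for d d'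
    unfolding \<phi>_def using rk_mono[OF that] by (intro div_le_mono mult_right_mono) auto
  moreover have "card {d \<in> D. \<phi> d = i} * k \<le> 2 * card D" for i
  proof (cases "{d \<in> D. \<phi> d = i} = {}")
    case False
    let ?F = "{d \<in> D. \<phi> d = i}"
    have fin: "finite ?F" using assms(1) by simp
    let ?a = "Min ?F" and ?b = "Max ?F"
    have ab: "?a \<in> ?F" "?b \<in> ?F" using False fin by (auto intro!: Min_in Max_in simp del: mem_Collect_eq)
    have inj: "inj_on rk ?F"
      by (rule inj_onI) (metis (no_types, lifting) linorder_neqE mem_Collect_eq order_less_irrefl rk_less)
    have "rk ` ?F \<subseteq> {rk ?a..rk ?b}"
      using fin by (auto intro!: rk_mono)
    then have "card ?F \<le> rk ?b + 1 - rk ?a"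
      using card_mono[of "{rk ?a..rk ?b}" "rk ` ?F"] card_image[OF inj] by simp
    then have "card ?F * k \<le> (rk ?b + 1 - rk ?a) * k" by (rule mult_right_mono) simp
    also have "\<dots> = rk ?b * k + k - rk ?a * k" by (simp add: algebra_simps diff_mult_distrib)
    also have "\<dots> \<le> 2 * card D"
    proof -
      have "rk ?b * k div card D = i" "rk ?a * k div card D = i"
        using ab by (auto simp: \<phi>_def)
      then have "i * card D \<le> rk ?a * k" "rk ?b * k < (i + 1) * card D"
        using pos by (metis div_times_less_eq_dividend, metis Suc_eq_plus1 dividend_less_div_times
            add.commute mult_Suc)
      then show ?thesis using assms(3) by (simp add: algebra_simps)
    qed
    finally show ?thesis .
  next
    case True
    show ?thesis unfolding True by simp
  qed
  ultimately show ?thesis by blast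
qed

text \<open>Because the lines are increasing, each of them meets at most \<open>2 k\<close> of the \<open>k\<^sup>2\<close> cells of a
  \<open>k \<times> k\<close> subdivision of the grid, and inside a cell two points determine the line.\<close>

lemma grid_incidence_bound:
  fixes D X B C :: "real set"
  assumes fin: "finite D" "finite X" "finite B" "finite C" and C: "\<And>c. c \<in> C \<Longrightarrow> 0 < c"
    and k: "1 \<le> k" "k \<le> card D" "k \<le> card X"
  shows "real (card {(d, x, b, c). d \<in> D \<and> x \<in> X \<and> b \<in> B \<and> c \<in> C \<and> c * x = d + b})
    \<le> 2 * real k * (real (card B) * real (card C)) + 4 * (real (card D) * real (card X) / real k)\<^sup>2"
proof -
  obtain \<phi> where \<phi>: "\<And>d. d \<in> D \<Longrightarrow> \<phi> d < k" "\<And>d d'. d \<in> D \<Longrightarrow> d' \<in> D \<Longrightarrow> d \<le> d' \<Longrightarrow> \<phi> d \<le> \<phi> d'"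
    "\<And>i. card {d \<in> D. \<phi> d = i} * k \<le> 2 * card D"
    using monotone_equipartition[OF fin(1) k(1,2)] by auto
  obtain \<psi> where \<psi>: "\<And>x. x \<in> X \<Longrightarrow> \<psi> x < k" "\<And>x x'. x \<in> X \<Longrightarrow> x' \<in> X \<Longrightarrow> x \<le> x' \<Longrightarrow> \<psi> x \<le> \<psi> x'"
    "\<And>i. card {x \<in> X. \<psi> x = i} * k \<le> 2 * card X"
    using monotone_equipartition[OF fin(2) k(1,3)] by auto
  define cell where "cell = (\<lambda>(d, x). (\<phi> d, \<psi> x))"
  define L where "L = (\<lambda>(b, c). {(d, x). d \<in> D \<and> x \<in> X \<and> c * x = d + b})"
  define O' where "O' = (\<lambda>l. {(u, v). (u, v) \<in> collisions cell (L l) \<and> u \<noteq> v})"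
  have Lsub: "L l \<subseteq> D \<times> X" for l by (auto simp: L_def split: prod.splits)
  have finL: "finite (L l)" for l
    using fin by (intro finite_subset[OF Lsub]) auto
  have finO: "finite (O' l)" for l
    by (rule finite_subset[of _ "collisions cell (L l)"]) (auto simp: O'_def finL)
  have line: "real (card (L l)) \<le> 2 * real k + real (card (O' l))" if l: "l \<in> B \<times> C" for l
  proof -
    obtain b c where bc: "l = (b, c)" "c > 0" using l C by auto
    have mono: "\<phi> d \<le> \<phi> d' \<and> \<psi> x \<le> \<psi> x' \<or> \<phi> d' \<le> \<phi> d \<and> \<psi> x' \<le> \<psi> x"
      if "(d, x) \<in> L l" "(d', x') \<in> L l" for d x d' x'
    proof -
      have eq: "c * x = d + b" "c * x' = d' + b" and mem: "d \<in> D" "d' \<in> D" "x \<in> X" "x' \<in> X"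
        using that by (auto simp: L_def bc)
      show ?thesis
      proof (cases "d \<le> d'")
        case True
        then have "c * x \<le> c * x'" using eq by simp
        then have "x \<le> x'" using bc by simp
        then show ?thesis using True \<phi>(2) \<psi>(2) mem by auto
      next
        case False
        then have "c * x' \<le> c * x" using eq by simp
        then have "x' \<le> x" using bc by simp
        then show ?thesis using False \<phi>(2) \<psi>(2) mem by auto
      qed
    qed
    \<comment> \<open>The cells met by one line form a chain in the product order, so the sum of the
      two indices tells them apart; it stays below 2 k.\<close>
    have "inj_on (\<lambda>(i, j). i + j) (cell ` L l)"
      by (rule inj_onI) (use mono in \<open>force simp: cell_def\<close>)
    moreover have "(\<lambda>(i, j). i + j) ` (cell ` L l) \<subseteq> {..<2 * k}"
      using \<phi>(1) \<psi>(1) Lsub[of l] by (force simp: cell_def)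
    ultimately have "card (cell ` L l) \<le> card {..<2 * k}"
      by (intro card_inj_on_le) auto
    then have cells: "real (card (cell ` L l)) \<le> 2 * real k" by simp
    let ?n = "\<lambda>y. real (card {u \<in> L l. cell u = y})"
    have "collisions cell (L l) = O' l \<union> (\<lambda>u. (u, u)) ` L l"
      by (auto simp: O'_def collisions_def)
    moreover have "O' l \<inter> (\<lambda>u. (u, u)) ` L l = {}" by (auto simp: O'_def)
    ultimately have "card (collisions cell (L l)) = card (O' l) + card (L l)"
      using finL finO by (simp add: card_Un_disjoint card_image inj_on_def)
    then have "real (card (O' l)) + real (card (L l)) = (\<Sum>y\<in>cell ` L l. (?n y)\<^sup>2)"
      by (simp add: card_collisions_eq_sum[OF finL] flip: of_nat_add of_nat_power of_nat_sum)
    \<comment> \<open>By n^2 \<ge> 2 n - 1, the points of a line exceed the number of its cells by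
      at most the number of its pairs inside cells.\<close>
    also have "\<dots> \<ge> (\<Sum>y\<in>cell ` L l. 2 * ?n y - 1)"
    proof (rule sum_mono)
      fix y
      have "0 \<le> (?n y - 1)\<^sup>2" by simp
      then show "2 * ?n y - 1 \<le> (?n y)\<^sup>2" by (simp add: power2_eq_square algebra_simps)
    qed
    also have "(\<Sum>y\<in>cell ` L l. 2 * ?n y - 1) = 2 * real (card (L l)) - real (card (cell ` L l))"
    proof -
      have "real (card (L l)) = (\<Sum>y\<in>cell ` L l. ?n y)"
        by (simp add: card_eq_sum_fibres[OF finL[of l], of cell])
      then show ?thesis by (simp add: sum_subtractf sum_distrib_left)
    qed
    finally show ?thesis using cells by linarith
  qed
  have "{(d, x, b, c). d \<in> D \<and> x \<in> X \<and> b \<in> B \<and> c \<in> C \<and> c * x = d + b}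
      = (\<lambda>(l, u). (fst u, snd u, fst l, snd l)) ` (SIGMA l:B \<times> C. L l)"
    by (force simp: L_def image_iff)
  moreover have "inj_on (\<lambda>(l, u). (fst u, snd u, fst l, snd l)) (SIGMA l:B \<times> C. L l)"
    by (auto simp: inj_on_def)
  ultimately have "real (card {(d, x, b, c). d \<in> D \<and> x \<in> X \<and> b \<in> B \<and> c \<in> C \<and> c * x = d + b})
      = (\<Sum>l\<in>B \<times> C. real (card (L l)))"
    using fin finL by (simp add: card_image card_SigmaI)
  also have "\<dots> \<le> (\<Sum>l\<in>B \<times> C. 2 * real k + real (card (O' l)))"
    by (rule sum_mono) (rule line)
  also have "\<dots> = 2 * real k * (real (card B) * real (card C)) + real (card (SIGMA l:B \<times> C. O' l))"
    using fin finO by (simp add: sum.distrib card_SigmaI card_cartesian_product)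
  also have "real (card (SIGMA l:B \<times> C. O' l)) \<le> 4 * (real (card D) * real (card X) / real k)\<^sup>2"
  proof -
    let ?T = "SIGMA u:D \<times> X. {d' \<in> D. \<phi> d' = \<phi> (fst u)} \<times> {x' \<in> X. \<psi> x' = \<psi> (snd u)}"
    have "inj_on snd (SIGMA l:B \<times> C. O' l)"
    proof (rule inj_onI)
      fix p q assume pq: "p \<in> (SIGMA l:B \<times> C. O' l)" "q \<in> (SIGMA l:B \<times> C. O' l)" "snd p = snd q"
      obtain b c d x d' x' where p: "p = ((b, c), ((d, x), (d', x')))" by (metis surj_pair)
      obtain b2 c2 where q: "q = ((b2, c2), ((d, x), (d', x')))" using pq(3) p by (metis prod.collapse snd_conv)
      have e: "c * x = d + b" "c * x' = d' + b" "c2 * x = d + b2" "c2 * x' = d' + b2"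
        and ne: "(d, x) \<noteq> (d', x')"
        using pq(1,2) by (auto simp: p q O'_def collisions_def L_def)
      have "x \<noteq> x'" using e ne by auto
      moreover have "(c - c2) * (x - x') = 0" using e by (simp add: algebra_simps)
      ultimately have "c = c2" by simp
      then show "p = q" using e p q by simp
    qed
    moreover have "snd ` (SIGMA l:B \<times> C. O' l) \<subseteq> ?T"
      using Lsub by (force simp: O'_def collisions_def cell_def L_def)
    moreover have "finite ?T" using fin by (intro finite_SigmaI) auto
    ultimately have "card (SIGMA l:B \<times> C. O' l) \<le> card ?T" by (rule card_inj_on_le)
    also have "\<dots> = (\<Sum>u\<in>D \<times> X. card {d' \<in> D. \<phi> d' = \<phi> (fst u)} * card {x' \<in> X. \<psi> x' = \<psi> (snd u)})"
      using fin by (simp add: card_SigmaI card_cartesian_product)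
    finally have "real (card (SIGMA l:B \<times> C. O' l)) \<le>
      (\<Sum>u\<in>D \<times> X. real (card {d' \<in> D. \<phi> d' = \<phi> (fst u)}) * real (card {x' \<in> X. \<psi> x' = \<psi> (snd u)}))"
      by (simp flip: of_nat_mult of_nat_sum)
    also have "\<dots> \<le> (\<Sum>u\<in>D \<times> X. (2 * real (card D) / real k) * (2 * real (card X) / real k))"
    proof (intro sum_mono mult_mono)
      fix u :: "real \<times> real"
      have "real (card {d' \<in> D. \<phi> d' = \<phi> (fst u)} * k) \<le> real (2 * card D)" using \<phi>(3) of_nat_mono by blast
      then show "real (card {d' \<in> D. \<phi> d' = \<phi> (fst u)}) \<le> 2 * real (card D) / real k"
        using k(1) by (simp add: field_simps)
      have "real (card {x' \<in> X. \<psi> x' = \<psi> (snd u)} * k) \<le> real (2 * card X)" using \<psi>(3) of_nat_mono by blast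
      then show "real (card {x' \<in> X. \<psi> x' = \<psi> (snd u)}) \<le> 2 * real (card X) / real k"
        using k(1) by (simp add: field_simps)
    qed auto
    also have "\<dots> = 4 * (real (card D) * real (card X) / real k)\<^sup>2"
      by (simp add: card_cartesian_product power2_eq_square)
    finally show ?thesis .
  qed
  finally show ?thesis by simp
qed

text \<open>There are at least |D| q incidences. Choosing \<open>k\<close> so that the linear term
  of \<open>grid_incidence_bound\<close> takes at most half of them leaves the quadratic term, which
  yields the cube of \<open>q\<close>.\<close>

lemma rich_abscissae_bound:
  fixes D X B C :: "real set" and q :: real
  assumes fin: "finite D" "finite X" "finite B" "finite C" and C: "\<And>c. c \<in> C \<Longrightarrow> 0 < c"
    and CX: "card C \<le> card X" and q: "0 \<le> q"
    and rich: "\<And>d. d \<in> D \<Longrightarrow> q \<le> real (card {(x, b, c). x \<in> X \<and> b \<in> B \<and> c \<in> C \<and> c * x = d + b})"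
  shows "real (card D) * q ^ 3 \<le> 512 * (real (card B) * real (card C) * real (card X))\<^sup>2"
proof (cases "D = {} \<or> q = 0")
  case False
  then have D0: "D \<noteq> {}" and q0: "0 < q" using q by auto
  let ?T = "\<lambda>d. {(x, b, c). x \<in> X \<and> b \<in> B \<and> c \<in> C \<and> c * x = d + b}"
  let ?I = "{(d, x, b, c). d \<in> D \<and> x \<in> X \<and> b \<in> B \<and> c \<in> C \<and> c * x = d + b}"
  define \<Lambda> where "\<Lambda> = real (card B) * real (card C)"
  have finT: "finite (?T d)" for d
    by (rule finite_subset[of _ "X \<times> B \<times> C"]) (use fin in auto)
  have TBC: "card (?T d) \<le> card (B \<times> C)" for d
  proof (rule card_inj_on_le[of snd])
    show "inj_on snd (?T d)"
    proof (rule inj_onI)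
      fix p q assume "p \<in> ?T d" "q \<in> ?T d" "snd p = snd q"
      then obtain x x' b c where "p = (x, b, c)" "q = (x', b, c)" "c \<in> C" "c * x = d + b" "c * x' = d + b" by auto
      then show "p = q" using C[of c] by (metis less_irrefl mult_left_cancel)
    qed
  qed (use fin in auto)
  have TXC: "card (?T d) \<le> card (X \<times> C)" for d
    by (rule card_inj_on_le[of "\<lambda>(x, b, c). (x, c)"]) (use fin in \<open>force simp: inj_on_def\<close>)+
  obtain d0 where d0: "d0 \<in> D" using D0 by auto
  have qL: "q \<le> \<Lambda>" using rich[OF d0] TBC[of d0]
    by (simp add: \<Lambda>_def card_cartesian_product flip: of_nat_mult)
  have qXC: "q \<le> real (card X) * real (card C)" using rich[OF d0] TXC[of d0]
    by (simp add: card_cartesian_product flip: of_nat_mult)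
  have L0: "0 < \<Lambda>" using qL q0 by linarith
  have "?I = (SIGMA d:D. ?T d)" by auto
  then have "real (card ?I) = (\<Sum>d\<in>D. real (card (?T d)))"
    using fin finT by (simp add: card_SigmaI)
  also have "\<dots> \<ge> (\<Sum>d\<in>D. q)" by (rule sum_mono) (rule rich)
  finally have DI: "real (card D) * q \<le> real (card ?I)" by simp
  have "card ?I \<le> card (X \<times> B \<times> C)"
    by (rule card_inj_on_le[of snd]) (use fin in \<open>force simp: inj_on_def\<close>)+
  then have DX: "real (card D) * q \<le> real (card X) * \<Lambda>"
    using DI by (simp add: \<Lambda>_def card_cartesian_product flip: of_nat_mult)
  show ?thesis
  proof (cases "real (card D) * q < 4 * \<Lambda>")
    \<comment> \<open>Here the desired \<open>k\<close> would be below 1. The trivial bounds for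
      \<open>q\<close>, by the number of lines and by |X| |C|, suffice instead.\<close>
    case True
    have "q ^ 3 * real (card D) = (real (card D) * q) * q\<^sup>2" by (simp add: power2_eq_square power3_eq_cube)
    also have "\<dots> \<le> (4 * \<Lambda>) * q\<^sup>2" using True by (intro mult_right_mono) auto
    also have "q\<^sup>2 \<le> \<Lambda> * (real (card X) * real (card C))"
      unfolding power2_eq_square using qL qXC q by (intro mult_mono) auto
    also have "\<Lambda> * (real (card X) * real (card C)) \<le> \<Lambda> * (real (card X) * real (card X))"
      using CX L0 by (intro mult_left_mono) auto
    finally have "q ^ 3 * real (card D) \<le> 4 * (\<Lambda> * real (card X))\<^sup>2"
      using L0 by (simp add: power2_eq_square mult_ac)
    also have "\<dots> \<le> 512 * (\<Lambda> * real (card X))\<^sup>2" by simp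
    finally show ?thesis by (simp add: \<Lambda>_def mult.commute)
  next
    case False
    \<comment> \<open>The ideal real value of \<open>k\<close>: at most this, the term 2 k \<Lambda>
      is at most |D| q / 2. Rounding down loses at most a factor 2, as z \<ge> 1, and 512 = 8 *
      8^2.\<close>
    define z where "z = real (card D) * q / (4 * \<Lambda>)"
    define k where "k = nat \<lfloor>z\<rfloor>"
    have z1: "1 \<le> z" using False L0 by (simp add: z_def field_simps)
    then have fl: "1 \<le> \<lfloor>z\<rfloor>" by simp
    then have rk: "real k = of_int \<lfloor>z\<rfloor>" by (simp add: k_def)
    have k1: "1 \<le> k" using fl unfolding k_def by linarith
    have "real k \<le> z \<and> z < real k + 1" unfolding rk by linarith
    then have kz: "real k \<le> z" "z \<le> 2 * real k" using k1 by linarith+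
    have "real (card D) * q \<le> real (card D) * (4 * \<Lambda>)" using qL L0 by (intro mult_left_mono) auto
    then have "z \<le> real (card D)" using L0 by (simp add: z_def pos_divide_le_eq)
    then have kD: "k \<le> card D" using kz by linarith
    have "real (card X) * \<Lambda> \<le> real (card X) * (4 * \<Lambda>)" using L0 by (intro mult_left_mono) auto
    from order_trans[OF DX this] have "z \<le> real (card X)"
      using L0 by (simp add: z_def pos_divide_le_eq)
    then have kX: "k \<le> card X" using kz by linarith
    have k0: "0 < real k" using k1 by simp
    let ?d = "real (card D)" and ?x = "real (card X)"
    have "?d * q \<le> 2 * real k * \<Lambda> + 4 * (?d * ?x / real k)\<^sup>2"
      using DI grid_incidence_bound[OF fin C k1 kD kX] by (simp add: \<Lambda>_def)
    moreover have "2 * real k * \<Lambda> \<le> ?d * q / 2"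
      using kz(1) L0 by (simp add: z_def field_simps)
    ultimately have "?d * q \<le> 8 * (?d * ?x / real k)\<^sup>2" by simp
    also have "\<dots> \<le> 8 * (?d * ?x / (z / 2))\<^sup>2"
      using kz z1 k0 by (intro mult_left_mono power_mono divide_left_mono) auto
    also have "?d * ?x / (z / 2) = 8 * \<Lambda> * ?x / q"
      using D0 fin q0 L0 by (simp add: z_def field_simps)
    finally have "?d * q \<le> 512 * (\<Lambda> * ?x)\<^sup>2 / q\<^sup>2"
      by (simp add: power_divide power_mult_distrib)
    then have "?d * q * q\<^sup>2 \<le> 512 * (\<Lambda> * ?x)\<^sup>2" using q0 by (simp add: field_simps)
    then show ?thesis by (simp add: \<Lambda>_def power2_eq_square power3_eq_cube mult_ac)
  qed
next
  case True
  then show ?thesis by auto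
qed

section \<open>Sumsets of sets with few rich differences\<close>

definition diff :: "real \<times> real \<Rightarrow> real" where
  "diff u = fst u - snd u"

definition diff_rep :: "real set \<Rightarrow> real set \<Rightarrow> real \<Rightarrow> nat" where
  "diff_rep A B d = card {u \<in> A \<times> B. diff u = d}"

text \<open>The bound must hold for every finite \<open>B\<close>, because it is applied with
  \<open>B\<close> equal to \<open>A\<close> and to \<open>A + A\<close>. The smaller \<Delta> is
  compared with |A|^2, the fewer rich differences there are.\<close>

definition szemeredi_trotter_const :: "real set \<Rightarrow> real \<Rightarrow> bool" where
  "szemeredi_trotter_const A \<Delta> \<longleftrightarrow> (\<forall>B t. finite B \<and> 1 \<le> t \<longrightarrow>
    real t ^ 3 * real (card {d \<in> diff ` (A \<times> B). t \<le> diff_rep A B d}) \<le> \<Delta> * (real (card B))\<^sup>2)"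

lemma diff_rep_le_card:
  assumes "finite A"
  shows "diff_rep A B d \<le> card A"
  unfolding diff_rep_def
proof (rule card_inj_on_le[of fst])
  show "inj_on fst {u \<in> A \<times> B. diff u = d}" by (auto simp: inj_on_def diff_def)
qed (use assms in auto)

lemma third_moment_bound:
  assumes "finite A" "finite B" "card A \<le> n" "szemeredi_trotter_const A \<Delta>"
  shows "(\<Sum>d\<in>diff ` (A \<times> B). real (diff_rep A B d) ^ 3) \<le> 3 * harm n * (\<Delta> * (real (card B))\<^sup>2)"
proof -
  have "diff_rep A B d \<le> n" for d
    using diff_rep_le_card[OF assms(1), of B d] assms(3) by linarith
  then show ?thesis
    using sum_power_le_harm[of "diff ` (A \<times> B)" "diff_rep A B" n 3 "\<Delta> * (real (card B))\<^sup>2"] assms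
    by (simp add: szemeredi_trotter_const_def)
qed

lemma card_diff_collisions:
  assumes "finite A" "finite B"
  shows "real (card (collisions diff (A \<times> B))) = (\<Sum>d\<in>diff ` (A \<times> B). real (diff_rep A B d) ^ 2)"
  using assms by (simp add: card_collisions_eq_sum diff_rep_def)

text \<open>Cauchy--Schwarz with r^2 = r^(1/2) r^(3/2) places the second moment between the first,
  which is |A| |B|, and the third.\<close>

lemma additive_energy_bound:
  assumes "finite A" "finite B" "card A \<le> n" "szemeredi_trotter_const A \<Delta>"
  shows "(real (card (collisions diff (A \<times> B))))\<^sup>2
    \<le> real (card A) * real (card B) * (3 * harm n * (\<Delta> * (real (card B))\<^sup>2))"
proof -
  let ?Y = "diff ` (A \<times> B)" and ?r = "\<lambda>d. real (diff_rep A B d)"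
  have "real (card (collisions diff (A \<times> B))) = (\<Sum>d\<in>?Y. sqrt (?r d) * (?r d * sqrt (?r d)))"
    unfolding card_diff_collisions[OF assms(1,2)]
    by (intro sum.cong refl) (simp add: power2_eq_square algebra_simps)
  then have "(real (card (collisions diff (A \<times> B))))\<^sup>2
      \<le> (\<Sum>d\<in>?Y. (sqrt (?r d))\<^sup>2) * (\<Sum>d\<in>?Y. (?r d * sqrt (?r d))\<^sup>2)"
    by (simp only: Cauchy_Schwarz_ineq_sum)
  also have "(\<Sum>d\<in>?Y. (sqrt (?r d))\<^sup>2) = real (card A) * real (card B)"
    using card_eq_sum_fibres[of "A \<times> B" diff] assms
    by (simp add: diff_rep_def card_cartesian_product flip: of_nat_mult of_nat_sum)
  also have "(\<Sum>d\<in>?Y. (?r d * sqrt (?r d))\<^sup>2) = (\<Sum>d\<in>?Y. ?r d ^ 3)"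
    by (intro sum.cong refl) (simp add: power_mult_distrib power2_eq_square power3_eq_cube)
  also have "real (card A) * real (card B) * (\<Sum>d\<in>?Y. ?r d ^ 3) \<le>
      real (card A) * real (card B) * (3 * harm n * (\<Delta> * (real (card B))\<^sup>2))"
    by (intro mult_left_mono third_moment_bound assms) simp
  finally show ?thesis .
qed

lemma sumset_eq_image: "A + B = (\<lambda>(a, b). a + b) ` (A \<times> B)" for A B :: "real set"
  by (force simp: set_plus_def)

text \<open>a + b = a' + b' means a - a' = b' - b, so collisions of sums become collisions of
  differences.\<close>

lemma additive_energy_lower:
  fixes A :: "real set"
  assumes "finite A"
  shows "real (card A) ^ 4 \<le> real (card (A + A)) * real (card (collisions diff (A \<times> A)))"
proof -
  let ?plus = "\<lambda>(a, b). a + b :: real"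
  have le: "card (collisions ?plus (A \<times> A)) \<le> card (collisions diff (A \<times> A))"
  proof (rule card_inj_on_le[of "\<lambda>((a, b), (a', b')). ((a, a'), (b', b))"])
    show "finite (collisions diff (A \<times> A))" using assms by simp
  qed (auto simp: inj_on_def collisions_def diff_def)
  have "(real (card (A \<times> A)))\<^sup>2 \<le> real (card (A + A)) * real (card (collisions ?plus (A \<times> A)))"
    by (rule card_square_le_image_collisions) (use assms in \<open>auto simp: sumset_eq_image\<close>)
  also have "\<dots> \<le> real (card (A + A)) * real (card (collisions diff (A \<times> A)))"
    using le by (intro mult_left_mono) auto
  finally show ?thesis
    by (simp add: card_cartesian_product power2_eq_square power4_eq_xxxx mult_ac)
qed

text \<open>Katz--Koester: for a popular difference \<open>s\<close>, the set \<open>A + (A \<inter> (A + s))\<close> lies in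
  \<open>(A + A) \<inter> (A + A + s)\<close>, so the sumset has many representations of \<open>s\<close>.\<close>

lemma sumset_lower_bound:
  fixes A :: "real set"
  assumes fin: "finite A" and ne: "A \<noteq> {}" and n: "card A \<le> n"
    and ST: "szemeredi_trotter_const A \<Delta>"
  shows "real (card A) ^ 19 \<le> 1728 * harm n ^ 9 * \<Delta> ^ 5 * real (card (A + A)) ^ 9"
proof -
  define \<Sigma> where "\<Sigma> = A + A"
  have finS: "finite \<Sigma>" using fin by (simp add: \<Sigma>_def sumset_eq_image)
  let ?Y = "diff ` (A \<times> A)"
  have cA: "1 \<le> card A" using fin ne by (simp add: Suc_leI card_gt_0_iff)
  obtain t where t: "1 \<le> t" "t \<le> n" "(\<Sum>d\<in>?Y. real (diff_rep A A d) ^ 2)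
      \<le> real 2 * harm n * (real t ^ 2 * real (card {d \<in> ?Y. t \<le> diff_rep A A d}))"
  proof (rule popular_level[of ?Y "diff_rep A A" n 2])
    fix d show "diff_rep A A d \<le> n" using diff_rep_le_card[OF fin, of A d] n by linarith
  qed (use fin cA n in auto)
  define P where "P = {d \<in> ?Y. t \<le> diff_rep A A d}"
  have finP: "finite P" using fin by (simp add: P_def)
  let ?E = "real (card (collisions diff (A \<times> A)))"
  let ?E3 = "\<Sum>d\<in>?Y. real (diff_rep A A d) ^ 3"
  have E: "?E \<le> 2 * harm n * ((real t)\<^sup>2 * real (card P))"
    using t(3) by (simp add: card_diff_collisions[OF fin fin] P_def)
  have P3: "real t ^ 3 * real (card P) \<le> \<Delta> * (real (card A))\<^sup>2"
    using ST fin t(1) by (simp add: szemeredi_trotter_const_def P_def)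
  define T where "T = (SIGMA s:P. A \<times> {a \<in> A. a - s \<in> A})"
  define F where "F = (SIGMA s:P. {\<sigma> \<in> \<Sigma>. \<sigma> - s \<in> \<Sigma>})"
  \<comment> \<open>If \<open>a\<close>, \<open>a - s\<close> and \<open>b\<close> lie in
    \<open>A\<close>, then b + a and b + a - s lie in \<Sigma>; hence \<open>?f\<close> maps
    \<open>T\<close> into \<open>F\<close>.\<close>
  let ?f = "\<lambda>(s, b, a). (s :: real, b + a :: real)"
  have finT: "finite T" and finF: "finite F"
    using fin finP finS by (auto simp: T_def F_def)
  have popular: "card {a \<in> A. a - s \<in> A} = diff_rep A A s" for s
    unfolding diff_rep_def
    by (rule bij_betw_same_card[of "\<lambda>a. (a, a - s)"])
      (auto simp: bij_betw_def inj_on_def diff_def image_iff)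
  have "real (card P) * real (card A) * real t = (\<Sum>s\<in>P. real (card A) * real t)" by simp
  also have "\<dots> \<le> (\<Sum>s\<in>P. real (card (A \<times> {a \<in> A. a - s \<in> A})))"
    by (rule sum_mono) (auto simp: card_cartesian_product popular P_def mult_left_mono)
  also have "\<dots> = real (card T)"
    using fin finP by (simp add: T_def card_SigmaI)
  finally have cardT: "real (card P) * real (card A) * real t \<le> real (card T)" .
  have "(real (card T))\<^sup>2 \<le> real (card F) * real (card (collisions ?f T))"
    by (rule card_square_le_image_collisions[OF finT _ finF])
      (force simp: T_def F_def \<Sigma>_def set_plus_def)
  \<comment> \<open>A collision has b' - b = a - a' = (a - s) - (a' - s): three representations of
    one difference, hence the third moment.\<close>
  also have "real (card (collisions ?f T)) \<le> ?E3"
  proof -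
    let ?fib = "\<lambda>d. {u \<in> A \<times> A. diff u = d}"
    let ?Z = "SIGMA d:?Y. ?fib d \<times> ?fib d \<times> ?fib d"
    have "card (collisions ?f T) \<le> card ?Z"
    proof (rule card_inj_on_le[of "\<lambda>((s, b, a), (s', b', a')). (a - a', (b', b), (a, a'), (a - s, a' - s'))"])
      show "finite ?Z" using fin by (intro finite_SigmaI) auto
      show "(\<lambda>((s, b, a), (s', b', a')). (a - a', (b', b), (a, a'), (a - s, a' - s'))) ` collisions ?f T \<subseteq> ?Z"
        by (auto simp: collisions_def T_def diff_def image_iff) blast
      show "inj_on (\<lambda>((s, b, a), (s', b', a')). (a - a', (b', b), (a, a'), (a - s, a' - s'))) (collisions ?f T)"
        by (auto simp: inj_on_def)
    qed
    also have "card ?Z = (\<Sum>d\<in>?Y. diff_rep A A d ^ 3)"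
      using fin by (simp add: card_SigmaI card_cartesian_product diff_rep_def power3_eq_cube mult_ac)
    finally show ?thesis by (simp flip: of_nat_power of_nat_sum)
  qed
  finally have TF: "(real (card T))\<^sup>2 \<le> real (card F) * ?E3" by (simp add: mult_left_mono)
  let ?ES = "real (card (collisions diff (A \<times> \<Sigma>)))"
  \<comment> \<open>An element (s, \<sigma>) of \<open>F\<close> and a representation s = a - a'
    give a - \<sigma> = a' - (\<sigma> - s), a collision between \<open>A\<close> and \<Sigma>. Each
    popular \<open>s\<close> has at least \<open>t\<close> such representations.\<close>
  have tF: "real t * real (card F) \<le> ?ES"
  proof -
    let ?W = "SIGMA v:F. {u \<in> A \<times> A. diff u = fst v}"
    have "card ?W \<le> card (collisions diff (A \<times> \<Sigma>))"
    proof (rule card_inj_on_le[of "\<lambda>((s, \<sigma>), (a, a')). ((a, \<sigma>), (a', \<sigma> - s))"])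
      show "inj_on (\<lambda>((s, \<sigma>), (a, a')). ((a, \<sigma>), (a', \<sigma> - s))) ?W" by (auto simp: inj_on_def)
      show "(\<lambda>((s, \<sigma>), (a, a')). ((a, \<sigma>), (a', \<sigma> - s))) ` ?W \<subseteq> collisions diff (A \<times> \<Sigma>)"
        by (auto simp: collisions_def F_def diff_def)
    qed (use fin finS in auto)
    moreover have "card ?W = (\<Sum>v\<in>F. diff_rep A A (fst v))"
      using fin finF by (simp add: card_SigmaI diff_rep_def)
    moreover have "(\<Sum>v\<in>F. t) \<le> (\<Sum>v\<in>F. diff_rep A A (fst v))"
      by (rule sum_mono) (auto simp: F_def P_def)
    ultimately have "card F * t \<le> card (collisions diff (A \<times> \<Sigma>))" by simp
    then show ?thesis by (simp add: mult.commute flip: of_nat_mult)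
  qed
  have ES: "?ES\<^sup>2 \<le> real (card A) * real (card \<Sigma>) * (3 * harm n * (\<Delta> * (real (card \<Sigma>))\<^sup>2))"
    by (rule additive_energy_bound[OF fin finS n ST])
  have E3: "?E3 \<le> 3 * harm n * (\<Delta> * (real (card A))\<^sup>2)"
    by (rule third_moment_bound[OF fin fin n ST])
  have E4: "real (card A) ^ 4 \<le> real (card \<Sigma>) * ?E"
    using additive_energy_lower[OF fin] by (simp add: \<Sigma>_def)
  define a where "a = real (card A)"
  define s where "s = real (card \<Sigma>)"
  define p where "p = real (card P)"
  define h where "h = (harm n :: real)"
  define e3 where "e3 = ?E3"
  define e where "e = ?E"
  define es where "es = ?ES"
  define \<tau> where "\<tau> = real t"
  define F' where "F' = real (card F)"
  have a1: "1 \<le> a" using cA by (simp add: a_def)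
  have nn: "0 \<le> s" "0 \<le> p" "0 \<le> h" "0 \<le> e3" "0 \<le> e" "0 \<le> es" "0 < \<tau>" "0 \<le> F'"
    using t(1) by (auto simp: s_def p_def h_def e3_def e_def es_def \<tau>_def F'_def sum_nonneg harm_nonneg)
  have "0 \<le> \<Delta> * a\<^sup>2" using P3 order_trans[of 0 "real t ^ 3 * real (card P)"] by (simp add: a_def)
  then have D0: "0 \<le> \<Delta>" using a1 by (simp add: zero_le_mult_iff)
  have f1: "(p * a * \<tau>)\<^sup>2 \<le> F' * e3"
    using order_trans[OF power_mono[OF cardT] TF] by (simp add: p_def a_def \<tau>_def F'_def e3_def)
  have f2: "\<tau> * F' \<le> es" using tF by (simp add: \<tau>_def F'_def es_def)
  have f3: "es\<^sup>2 \<le> a * s * (3 * h * (\<Delta> * s\<^sup>2))" using ES by (simp add: es_def a_def s_def h_def)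
  have f4: "e3 \<le> 3 * h * (\<Delta> * a\<^sup>2)" using E3 by (simp add: e3_def a_def h_def)
  have f5: "\<tau> ^ 3 * p \<le> \<Delta> * a\<^sup>2" using P3 by (simp add: \<tau>_def p_def a_def)
  have f6: "e \<le> 2 * h * (\<tau>\<^sup>2 * p)" using E by (simp add: e_def h_def \<tau>_def p_def)
  have f7: "a ^ 4 \<le> s * e" using E4 by (simp add: a_def s_def e_def)
  have "\<tau> * (p * a * \<tau>)\<^sup>2 \<le> \<tau> * (F' * e3)" using f1 nn by (intro mult_left_mono) auto
  also have "\<dots> = (\<tau> * F') * e3" by simp
  also have "\<dots> \<le> es * (3 * h * (\<Delta> * a\<^sup>2))" using f2 f4 nn by (intro mult_mono) auto
  finally have "(\<tau> * (p * a * \<tau>)\<^sup>2)\<^sup>2 \<le> (es * (3 * h * (\<Delta> * a\<^sup>2)))\<^sup>2"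
    using nn by (intro power_mono) auto
  also have "\<dots> = es\<^sup>2 * (3 * h * (\<Delta> * a\<^sup>2))\<^sup>2" by (simp add: power_mult_distrib)
  also have "\<dots> \<le> (a * s * (3 * h * (\<Delta> * s\<^sup>2))) * (3 * h * (\<Delta> * a\<^sup>2))\<^sup>2"
    using f3 by (intro mult_right_mono) auto
  finally have "a ^ 4 * (p ^ 4 * \<tau> ^ 6) \<le> a ^ 4 * (27 * h ^ 3 * \<Delta> ^ 3 * a * s ^ 3)"
    by (simp add: power_mult_distrib power2_eq_square power3_eq_cube power4_eq_xxxx eval_nat_numeral mult_ac)
  then have g1: "p ^ 4 * \<tau> ^ 6 \<le> 27 * h ^ 3 * \<Delta> ^ 3 * a * s ^ 3" using a1 by simp
  \<comment> \<open>The popular level is limited by \<open>g1\<close>, through p^4 \<tau>^6, and by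
    \<open>f5\<close>, through \<tau>^3 p. As p^4 \<tau>^6 (\<tau>^3 p)^2 = (\<tau>^2 p)^6, the
    sixth power of \<open>f7\<close> eliminates both \<open>p\<close> and \<tau>; the constant is
    1728 = 64 * 27.\<close>
  have "a ^ 19 * a ^ 5 = (a ^ 4) ^ 6" by (simp flip: power_add power_mult)
  also have "\<dots> \<le> (s * e) ^ 6" using f7 a1 by (intro power_mono) auto
  also have "\<dots> \<le> (s * (2 * h * (\<tau>\<^sup>2 * p))) ^ 6"
    using f6 nn by (intro power_mono mult_left_mono) auto
  also have "\<dots> = 64 * h ^ 6 * s ^ 6 * ((p ^ 4 * \<tau> ^ 6) * (\<tau> ^ 3 * p)\<^sup>2)"
    by (simp add: power_mult_distrib flip: power_mult)
  also have "\<dots> \<le> 64 * h ^ 6 * s ^ 6 * ((27 * h ^ 3 * \<Delta> ^ 3 * a * s ^ 3) * (\<Delta> * a\<^sup>2)\<^sup>2)"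
    using nn a1 D0 by (intro mult_left_mono mult_mono[OF g1 power_mono[OF f5]]) auto
  also have "\<dots> = (1728 * h ^ 9 * \<Delta> ^ 5 * s ^ 9) * a ^ 5"
    by (simp add: power_mult_distrib flip: power_mult) (simp add: eval_nat_numeral mult_ac)
  finally have "a ^ 19 * a ^ 5 \<le> (1728 * h ^ 9 * \<Delta> ^ 5 * s ^ 9) * a ^ 5" .
  moreover have "0 < a ^ 5" using a1 by simp
  ultimately have "a ^ 19 \<le> 1728 * h ^ 9 * \<Delta> ^ 5 * s ^ 9" by (rule mult_right_le_imp_le)
  then show ?thesis by (simp add: a_def h_def s_def \<Sigma>_def)
qed

section \<open>Rays through the origin\<close>

text \<open>Points of \<open>X \<times> A\<close> on the line of slope \<mu> are recorded by their
  abscissae, so a ray is X \<inter> \<mu>^(-1) A.\<close>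

definition ray :: "real set \<Rightarrow> real set \<Rightarrow> real \<Rightarrow> real set" where
  "ray X A \<mu> = {x \<in> X. \<mu> * x \<in> A}"

definition ratio :: "real \<times> real \<Rightarrow> real" where
  "ratio u = snd u / fst u"

definition mult_energy :: "real set \<Rightarrow> real set \<Rightarrow> nat" where
  "mult_energy X A = card (collisions ratio (X \<times> A))"

text \<open>Products and quotients are treated together: both satisfy f (\<mu> x) a = \<mu> f x a,
  and equal values of either one lead to equal ratios.\<close>

definition mult_op :: "(real \<Rightarrow> real \<Rightarrow> real) \<Rightarrow> bool" where
  "mult_op f \<longleftrightarrow> f = (*) \<or> f = (/)"

definition op_set :: "(real \<Rightarrow> real \<Rightarrow> real) \<Rightarrow> real set \<Rightarrow> real set \<Rightarrow> real set" where
  "op_set f X A = (\<lambda>(x, a). f x a) ` (X \<times> A)"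

lemma finite_op_set [simp]: "finite X \<Longrightarrow> finite A \<Longrightarrow> finite (op_set f X A)"
  by (simp add: op_set_def)

lemma op_set_mono: "X \<subseteq> X' \<Longrightarrow> A \<subseteq> A' \<Longrightarrow> op_set f X A \<subseteq> op_set f X' A'"
  by (auto simp: op_set_def)

lemma ray_subset: "ray X A \<mu> \<subseteq> X"
  by (auto simp: ray_def)

lemma finite_ray [simp]: "finite X \<Longrightarrow> finite (ray X A \<mu>)"
  by (simp add: ray_def)

lemma card_ratio_fibre:
  assumes "\<And>x. x \<in> X \<Longrightarrow> 0 < x"
  shows "card {u \<in> X \<times> A. ratio u = \<mu>} = card (ray X A \<mu>)"
proof (rule bij_betw_same_card[of fst])
  have "ray X A \<mu> = fst ` {u \<in> X \<times> A. ratio u = \<mu>}"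
    by (force simp: ray_def ratio_def image_iff dest: assms)
  moreover have "inj_on fst {u \<in> X \<times> A. ratio u = \<mu>}"
    by (auto simp: inj_on_def ratio_def dest: assms)
  ultimately show "bij_betw fst {u \<in> X \<times> A. ratio u = \<mu>} (ray X A \<mu>)"
    by (simp add: bij_betw_def)
qed

text \<open>A coincidence x a = x' a' becomes a' / x = a / x' after exchanging \<open>a\<close> and
  \<open>a'\<close>; a coincidence of quotients only has to be inverted.\<close>

lemma mult_energy_lower:
  assumes fin: "finite X" "finite A" and pos: "\<And>x. x \<in> X \<Longrightarrow> 0 < x" "\<And>a. a \<in> A \<Longrightarrow> 0 < a"
    and f: "mult_op f"
  shows "(real (card X) * real (card A))\<^sup>2 \<le> real (card (op_set f X A)) * real (mult_energy X A)"
proof -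
  let ?f = "\<lambda>(x, a). f x a"
  have "card (collisions ?f (X \<times> A)) \<le> mult_energy X A"
  proof (cases "f = (*)")
    case True
    show ?thesis unfolding mult_energy_def
    proof (rule card_inj_on_le[of "\<lambda>((x, a), (x', a')). ((x, a'), (x', a))"])
      show "(\<lambda>((x, a), (x', a')). ((x, a'), (x', a))) ` collisions ?f (X \<times> A) \<subseteq> collisions ratio (X \<times> A)"
      proof -
        have swap: "a' / x = a / x'" if "x * a = x' * a'" "x \<in> X" "x' \<in> X" for x a x' a'
          using that pos(1)[of x] pos(1)[of x'] by (simp add: field_simps)
        show ?thesis unfolding collisions_def ratio_def True by clarsimp (rule swap)
      qed
    qed (use fin in \<open>auto simp: inj_on_def\<close>)
  next
    case False
    have "f = (/)" using f False by (simp add: mult_op_def)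
    have inv: "a / x = a' / x'" if "x / a = x' / a'" for x a x' a' :: real
      using arg_cong[OF that, of inverse] by simp
    show ?thesis unfolding mult_energy_def
    proof (rule card_mono)
      show "collisions ?f (X \<times> A) \<subseteq> collisions ratio (X \<times> A)"
        unfolding collisions_def ratio_def \<open>f = (/)\<close> by clarsimp (rule inv)
    qed (use fin in simp)
  qed
  moreover have "(real (card (X \<times> A)))\<^sup>2 \<le> real (card (op_set f X A)) * real (card (collisions ?f (X \<times> A)))"
    using fin by (intro card_square_le_image_collisions) (auto simp: op_set_def)
  ultimately have "(real (card (X \<times> A)))\<^sup>2 \<le> real (card (op_set f X A)) * real (mult_energy X A)"
    by (meson mult_left_mono of_nat_0_le_iff of_nat_mono order_trans)
  then show ?thesis by (simp add: card_cartesian_product)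
qed

lemma mult_energy_upper:
  assumes fin: "finite X" "finite A" and pos: "\<And>x. x \<in> X \<Longrightarrow> 0 < x" and n: "card X \<le> n"
    and Q: "\<And>t. 1 \<le> t \<Longrightarrow> real t ^ 2 * real (card {\<mu> \<in> ratio ` (X \<times> A). t \<le> card (ray X A \<mu>)}) \<le> Q"
  shows "real (mult_energy X A) \<le> 2 * harm n * Q"
proof -
  have "real (mult_energy X A) = (\<Sum>\<mu>\<in>ratio ` (X \<times> A). real (card (ray X A \<mu>)) ^ 2)"
    using fin by (simp add: mult_energy_def card_collisions_eq_sum card_ratio_fibre[OF pos])
  also have "\<dots> \<le> real 2 * harm n * Q"
  proof (rule sum_power_le_harm)
    fix \<mu>
    show "card (ray X A \<mu>) \<le> n"
      using card_mono[OF fin(1) ray_subset[of X A \<mu>]] n by linarith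
  qed (use fin Q in auto)
  finally show ?thesis by simp
qed

text \<open>The directions (1, \<mu>) and (1, \<nu>) are linearly independent. The weight \<rho> is
  1 for plain vector sums and differs from 1 in general for two linear forms.\<close>

lemma sum_on_rays_determines_points:
  fixes \<mu> \<nu> \<rho> x x' y y' :: real
  assumes "\<mu> \<noteq> \<nu>" "\<rho> \<noteq> 0" "x + \<rho> * x' = y + \<rho> * y'" "\<mu> * x + \<rho> * (\<nu> * x') = \<mu> * y + \<rho> * (\<nu> * y')"
  shows "x = y" "x' = y'"
proof -
  have "\<rho> * (\<nu> - \<mu>) * (x' - y') =
      (\<mu> * x + \<rho> * (\<nu> * x') - (\<mu> * y + \<rho> * (\<nu> * y'))) - \<mu> * (x + \<rho> * x' - (y + \<rho> * y'))"
    by (simp add: algebra_simps)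
  then have "\<rho> * (\<nu> - \<mu>) * (x' - y') = 0" using assms by simp
  then show "x' = y'" using assms by simp
  then show "x = y" using assms by simp
qed

lemma card_le_card_sumset:
  fixes X :: "real set"
  assumes "finite X"
  shows "card X \<le> card (X + X)"
proof (cases "X = {}")
  case False
  then obtain x0 where "x0 \<in> X" by auto
  then show ?thesis using assms
    by (intro card_inj_on_le[of "\<lambda>x. x0 + x"]) (auto simp: set_plus_def inj_on_def finite_set_plus)
qed simp

text \<open>Solymosi's argument: vector sums of points on neighbouring rays fall into disjoint sectors.\<close>

lemma rich_slopes_bound:
  assumes fin: "finite X" "finite A" and pos: "\<And>x. x \<in> X \<Longrightarrow> 0 < x" "\<And>a. a \<in> A \<Longrightarrow> 0 < a"
  shows "real t ^ 2 * real (card {\<mu> \<in> ratio ` (X \<times> A). t \<le> card (ray X A \<mu>)})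
    \<le> 3 * (real (card (X + X)) * real (card (A + A)))"
proof -
  define \<Lambda> where "\<Lambda> = {\<mu> \<in> ratio ` (X \<times> A). t \<le> card (ray X A \<mu>)}"
  have finL: "finite \<Lambda>" using fin by (simp add: \<Lambda>_def)
  \<comment> \<open>Blocks of two slopes: disjoint pairs of neighbours instead of all consecutive
    pairs, at the cost of a constant factor.\<close>
  obtain \<C> where C: "finite \<C>" "card \<C> = card \<Lambda> div 2" "\<And>I. I \<in> \<C> \<Longrightarrow> I \<subseteq> \<Lambda> \<and> card I = 2"
    "\<forall>I\<in>\<C>. \<forall>J\<in>\<C>. I \<noteq> J \<longrightarrow> separated I J"
    using separated_blocks_exist[OF finL, of 2] by auto
  have finI: "finite I" "I \<noteq> {}" if "I \<in> \<C>" for I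
    using C(3)[OF that] finL finite_subset by auto
  have mm: "Min I \<in> I" "Max I \<in> I" "Min I < Max I" if "I \<in> \<C>" for I
  proof -
    show m: "Min I \<in> I" "Max I \<in> I" using finI[OF that] by auto
    show "Min I < Max I"
    proof (rule ccontr)
      assume "\<not> Min I < Max I"
      then have "I \<subseteq> {Min I}" using finI[OF that]
        by (smt (verit) Max_ge Min_le insertI1 subsetI)
      then have "card I \<le> 1" using card_mono[of "{Min I}" I] by simp
      then show False using C(3)[OF that] by simp
    qed
  qed
  let ?U = "SIGMA I:\<C>. ray X A (Min I) \<times> ray X A (Max I)"
  let ?g = "\<lambda>(I, x, x'). (x + x', Min I * x + Max I * x')"
  have "inj_on ?g ?U"
  proof (rule inj_onI)
    fix u v assume uv: "u \<in> ?U" "v \<in> ?U" "?g u = ?g v"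
    obtain I x x' where u: "u = (I, x, x')" by (metis surj_pair)
    obtain J y y' where v: "v = (J, y, y')" by (metis surj_pair)
    have IJ: "I \<in> \<C>" "J \<in> \<C>" and p: "0 < x" "0 < x'" "0 < y" "0 < y'"
      using uv pos by (auto simp: u v ray_def)
    have e: "x + x' = y + y'" "Min I * x + Max I * x' = Min J * y + Max J * y'"
      using uv by (auto simp: u v)
    have "I = J"
    proof (rule separated_sectors_disjoint[OF C(4) IJ])
      show "min (Min I) (Max I) < (Min I * x + Max I * x') / (x + x')"
        "(Min I * x + Max I * x') / (x + x') < max (Min I) (Max I)"
        using slope_of_sum_between[OF p(1,2), of "Min I" "Max I"] mm(3)[OF IJ(1)] by auto
      show "min (Min J) (Max J) < (Min I * x + Max I * x') / (x + x')"
        "(Min I * x + Max I * x') / (x + x') < max (Min J) (Max J)"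
        unfolding e using slope_of_sum_between[OF p(3,4), of "Min J" "Max J"] mm(3)[OF IJ(2)] by auto
    qed (use mm IJ in auto)
    then show "u = v"
      using sum_on_rays_determines_points[of "Min I" "Max I" 1 x x' y y'] e mm(3)[OF IJ(1)]
      by (simp add: u v)
  qed
  moreover have "?g ` ?U \<subseteq> (X + X) \<times> (A + A)"
    by (auto simp: ray_def set_plus_def)
  moreover have "finite ((X + X) \<times> (A + A))" using fin by (simp add: finite_set_plus)
  ultimately have "card ?U \<le> card ((X + X) \<times> (A + A))" by (rule card_inj_on_le)
  moreover have "card ?U = (\<Sum>I\<in>\<C>. card (ray X A (Min I)) * card (ray X A (Max I)))"
    using C(1) fin by (simp add: card_SigmaI card_cartesian_product)
  moreover have lev: "t \<le> card (ray X A \<mu>)" if "I \<in> \<C>" "\<mu> \<in> I" for I \<mu>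
    using C(3)[OF that(1)] that(2) by (auto simp: \<Lambda>_def)
  have "(\<Sum>I\<in>\<C>. t * t) \<le> (\<Sum>I\<in>\<C>. card (ray X A (Min I)) * card (ray X A (Max I)))"
    by (intro sum_mono mult_mono lev[OF _ mm(1)] lev[OF _ mm(2)]) auto
  ultimately have half: "(card \<Lambda> div 2) * (t * t) \<le> card (X + X) * card (A + A)"
    using C(2) by (simp add: card_cartesian_product)
  \<comment> \<open>One slope may be left without a partner. Its t^2 is covered by t \<le> |X| and t
    \<le> |A|, hence 3 = 2 + 1.\<close>
  have "card \<Lambda> * (t * t) \<le> 3 * (card (X + X) * card (A + A))"
  proof (cases "\<Lambda> = {}")
    case False
    then obtain \<mu> where \<mu>: "\<mu> \<in> ratio ` (X \<times> A)" "t \<le> card (ray X A \<mu>)" by (auto simp: \<Lambda>_def)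
    have "\<mu> \<noteq> 0" using \<mu>(1) by (auto simp: ratio_def dest!: pos)
      have "card (ray X A \<mu>) \<le> card A"
        by (rule card_inj_on_le[of "\<lambda>x. \<mu> * x"]) (use fin \<open>\<mu> \<noteq> 0\<close> in \<open>auto simp: ray_def inj_on_def\<close>)
      moreover have "card (ray X A \<mu>) \<le> card X" using fin by (intro card_mono ray_subset)
      ultimately have "t * t \<le> card (X + X) * card (A + A)"
        using \<mu> card_le_card_sumset[OF fin(1)] card_le_card_sumset[OF fin(2)]
        by (intro mult_mono) auto
      moreover have "card \<Lambda> * (t * t) \<le> (2 * (card \<Lambda> div 2) + 1) * (t * t)"
        by (intro mult_right_mono) auto
      ultimately show ?thesis using half by (simp add: algebra_simps)
  qed auto
  then have "real (card \<Lambda> * (t * t)) \<le> real (3 * (card (X + X) * card (A + A)))"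
    using of_nat_mono by blast
  then show ?thesis by (simp add: \<Lambda>_def power2_eq_square mult_ac)
qed

lemma solymosi_energy_bound:
  assumes fin: "finite X" "finite A" and pos: "\<And>x. x \<in> X \<Longrightarrow> 0 < x" "\<And>a. a \<in> A \<Longrightarrow> 0 < a"
    and n: "card X \<le> n"
  shows "real (mult_energy X A) \<le> 6 * harm n * (real (card (X + X)) * real (card (A + A)))"
  using mult_energy_upper[OF fin pos(1) n rich_slopes_bound[OF fin pos]] by simp

section \<open>Overlapping pairs of rays\<close>

text \<open>A Balog--Szemeredi--Gowers statement for sums. If \<open>y + w = z = y' + w'\<close>, then
  \<open>y + y' - z = y - w'\<close>, so the sums of \<open>X \<inter> (z - W)\<close> are, up to few exceptions, translates of
  popular differences; the exceptions are removed by paths of length three.\<close>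

lemma small_sumset_from_closed_triples:
  fixes X W :: "real set" and \<kappa> :: real
  assumes fin: "finite X" "finite W" and cX: "card X = \<tau>" and cW: "card W = \<tau>"
    and \<kappa>: "0 < \<kappa>" and \<tau>: "0 < \<tau>"
    and many: "\<kappa> * real \<tau> ^ 2 \<le> real (card {(y, w). y \<in> X \<and> w \<in> W \<and> y + w \<in> X})"
  shows "\<exists>X'\<subseteq>X. \<kappa> * real \<tau> / 4 \<le> real (card X') \<and> real (card (X' + X')) * \<kappa> ^ 8 \<le> 2 ^ 20 * real \<tau>"
proof -
  \<comment> \<open>With 1/64, the bad pairs counted 32 times use up at most half of the sum of
    squares in \<open>sumG\<close>.\<close>
  define \<eta> where "\<eta> = \<kappa>\<^sup>2 / 64 * real \<tau>"
  define pop where "pop d \<longleftrightarrow> \<eta> \<le> real (diff_rep X W d)" for d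
  define G where "G z = {y \<in> X. z - y \<in> W}" for z
  define bad where "bad z = {(y, y'). y \<in> G z \<and> y' \<in> G z \<and> \<not> pop (y + y' - z)}" for z
  have \<eta>0: "0 < \<eta>" using \<kappa> \<tau> by (simp add: \<eta>_def)
  have finG: "finite (G z)" for z using fin by (simp add: G_def)
  have finbad: "finite (bad z)" for z
    by (rule finite_subset[of _ "G z \<times> G z"]) (auto simp: bad_def finG)
  have "card (SIGMA z:X. G z) = card {(y, w). y \<in> X \<and> w \<in> W \<and> y + w \<in> X}"
  proof (rule bij_betw_same_card[of "\<lambda>(z, y). (y, z - y)"])
    show "bij_betw (\<lambda>(z, y). (y, z - y)) (SIGMA z:X. G z) {(y, w). y \<in> X \<and> w \<in> W \<and> y + w \<in> X}"
      by (rule bij_betw_byWitness[of _ "\<lambda>(y, w). (y + w, y)"]) (auto simp: G_def)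
  qed
  then have "\<kappa> * real \<tau> ^ 2 \<le> (\<Sum>z\<in>X. real (card (G z)))"
    using many fin finG by (simp add: card_SigmaI flip: of_nat_sum)
  then have "(\<kappa> * real \<tau> ^ 2)\<^sup>2 \<le> (\<Sum>z\<in>X. real (card (G z)))\<^sup>2"
    using \<kappa> by (intro power_mono) auto
  also have "\<dots> \<le> (\<Sum>z\<in>X. (real (card (G z)))\<^sup>2) * real (card X)"
    by (rule sum_squared_le_sum_of_squares)
  finally have "(\<kappa>\<^sup>2 * real \<tau> ^ 3) * real \<tau> \<le> (\<Sum>z\<in>X. (real (card (G z)))\<^sup>2) * real \<tau>"
    by (simp add: cX power2_eq_square power3_eq_cube mult_ac)
  then have sumG: "\<kappa>\<^sup>2 * real \<tau> ^ 3 \<le> (\<Sum>z\<in>X. (real (card (G z)))\<^sup>2)" using \<tau> by simp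
  \<comment> \<open>A bad pair at \<open>z\<close> gives the two representations y - (z - y') = y' -
    (z - y) of one unpopular difference, and each representation of such a difference has fewer than
    \<eta> companions.\<close>
  have sumbad: "(\<Sum>z\<in>X. real (card (bad z))) \<le> \<eta> * real \<tau> ^ 2"
  proof -
    let ?S = "{u \<in> X \<times> W. \<not> pop (diff u)}"
    let ?T = "SIGMA u:?S. {v \<in> X \<times> W. diff v = diff u}"
    have "card (SIGMA z:X. bad z) \<le> card ?T"
    proof (rule card_inj_on_le[of "\<lambda>(z, y, y'). ((y, z - y'), (y', z - y))"])
      show "inj_on (\<lambda>(z, y, y'). ((y, z - y'), (y', z - y))) (SIGMA z:X. bad z)"
        by (auto simp: inj_on_def)
      show "(\<lambda>(z, y, y'). ((y, z - y'), (y', z - y))) ` (SIGMA z:X. bad z) \<subseteq> ?T"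
        by (auto simp: bad_def G_def diff_def algebra_simps)
      show "finite ?T" using fin by (intro finite_SigmaI) auto
    qed
    also have "card ?T = (\<Sum>u\<in>?S. diff_rep X W (diff u))"
      using fin by (simp add: card_SigmaI diff_rep_def)
    finally have "real (card (SIGMA z:X. bad z)) \<le> (\<Sum>u\<in>?S. real (diff_rep X W (diff u)))"
      by (simp flip: of_nat_sum)
    also have "\<dots> \<le> (\<Sum>u\<in>?S. \<eta>)" by (rule sum_mono) (auto simp: pop_def)
    also have "\<dots> = real (card ?S) * \<eta>" by simp
    also have "\<dots> \<le> real (card (X \<times> W)) * \<eta>"
      using fin \<eta>0 by (intro mult_right_mono of_nat_mono card_mono) auto
    finally show ?thesis
      using fin finbad by (simp add: card_SigmaI card_cartesian_product cX cW power2_eq_square mult_ac)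
  qed
  \<comment> \<open>Averaging the difference of the two quantities finds one \<open>z\<close> with
    many pairs of which at most 1 in 32 is bad.\<close>
  have "\<exists>z\<in>X. \<kappa>\<^sup>2 * real \<tau> ^ 2 / 2 \<le> (real (card (G z)))\<^sup>2 - 32 * real (card (bad z))"
  proof (rule ccontr)
    assume "\<not> ?thesis"
    then have lt: "(real (card (G z)))\<^sup>2 - 32 * real (card (bad z)) < \<kappa>\<^sup>2 * real \<tau> ^ 2 / 2" if "z \<in> X" for z
      using that by (meson not_le)
    have "(\<Sum>z\<in>X. (real (card (G z)))\<^sup>2 - 32 * real (card (bad z))) < (\<Sum>z\<in>X. \<kappa>\<^sup>2 * real \<tau> ^ 2 / 2)"
      using fin cX \<tau> by (intro sum_strict_mono lt) auto
    moreover have "(\<Sum>z\<in>X. (real (card (G z)))\<^sup>2 - 32 * real (card (bad z))) =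
        (\<Sum>z\<in>X. (real (card (G z)))\<^sup>2) - 32 * (\<Sum>z\<in>X. real (card (bad z)))"
      by (simp add: sum_subtractf sum_distrib_left)
    moreover have "(\<Sum>z\<in>X. \<kappa>\<^sup>2 * real \<tau> ^ 2 / 2) = \<kappa>\<^sup>2 * real \<tau> ^ 3 / 2"
      by (simp add: cX power2_eq_square power3_eq_cube)
    moreover have "32 * (\<eta> * real \<tau> ^ 2) = \<kappa>\<^sup>2 * real \<tau> ^ 3 / 2"
      by (simp add: \<eta>_def power2_eq_square power3_eq_cube)
    ultimately show False using sumG sumbad by linarith
  qed
  then obtain z where z: "z \<in> X" "\<kappa>\<^sup>2 * real \<tau> ^ 2 / 2 \<le> (real (card (G z)))\<^sup>2 - 32 * real (card (bad z))"
    by blast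
  define Y where "Y = G z"
  define N where "N = real (card Y)"
  have finY: "finite Y" and YX: "Y \<subseteq> X" using finG by (auto simp: Y_def G_def)
  have N2: "\<kappa>\<^sup>2 * real \<tau> ^ 2 / 2 \<le> N\<^sup>2" using z(2) by (simp add: N_def Y_def)
  have kt0: "0 \<le> \<kappa>\<^sup>2 * real \<tau> ^ 2" by simp
  have badN: "real (card (bad z)) \<le> N\<^sup>2 / 32"
    using z(2) kt0 unfolding N_def Y_def by linarith
  have Nk: "\<kappa> * real \<tau> / 2 \<le> N"
  proof (rule power2_le_imp_le)
    have "(\<kappa> * real \<tau> / 2)\<^sup>2 = \<kappa>\<^sup>2 * real \<tau> ^ 2 / 4" by (simp add: power_divide power_mult_distrib)
    then show "(\<kappa> * real \<tau> / 2)\<^sup>2 \<le> N\<^sup>2" using N2 kt0 by linarith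
  qed (simp add: N_def)
  have N0: "0 < N" using Nk \<kappa> \<tau> by (smt (verit) divide_pos_pos mult_pos_pos of_nat_0_less_iff)
  define B where "B y = {y' \<in> Y. \<not> pop (y + y' - z)}" for y
  \<comment> \<open>Elements with few bad partners; at least half of \<open>Y\<close> survives.
    Pairs inside \<open>X'\<close> may still be bad, which is why paths are needed.\<close>
  define X' where "X' = {y \<in> Y. 8 * real (card (B y)) \<le> N}"
  have finB: "finite (B y)" for y using finY by (simp add: B_def)
  have XY: "X' \<subseteq> Y" by (auto simp: X'_def)
  have badB: "bad z = (SIGMA y:Y. B y)" by (auto simp: bad_def B_def Y_def)
  have "real (card (Y - X')) * (N / 8) = (\<Sum>y\<in>Y - X'. N / 8)" by simp
  also have "\<dots> \<le> (\<Sum>y\<in>Y - X'. real (card (B y)))"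
    by (rule sum_mono) (auto simp: X'_def)
  also have "\<dots> \<le> (\<Sum>y\<in>Y. real (card (B y)))"
    using finY by (intro sum_mono2) auto
  also have "\<dots> = real (card (bad z))" unfolding badB using finY finB by (simp add: card_SigmaI)
  also have "\<dots> \<le> N / 4 * (N / 8)" using badN by (simp add: power2_eq_square)
  finally have "real (card (Y - X')) \<le> N / 4" using N0 by (simp add: mult_le_cancel_right)
  moreover have "real (card (Y - X')) = N - real (card X')"
    using finY XY by (simp add: N_def card_Diff_subset finite_subset of_nat_diff card_mono)
  ultimately have cX': "N / 2 \<le> real (card X')" using N0 by simp
  define D where "D = {d \<in> diff ` (X \<times> W). pop d}"
  have finD: "finite D" using fin by (simp add: D_def)
  have popD: "d \<in> D" if "pop d" for d
  proof -
    have "diff_rep X W d \<noteq> 0" using that \<eta>0 by (auto simp: pop_def)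
    then have "{u \<in> X \<times> W. diff u = d} \<noteq> {}" unfolding diff_rep_def by (metis card.empty)
    then show ?thesis using that by (auto simp: D_def)
  qed
  have "real (card D) * \<eta> = (\<Sum>d\<in>D. \<eta>)" by simp
  also have "\<dots> \<le> (\<Sum>d\<in>D. real (diff_rep X W d))" by (rule sum_mono) (auto simp: D_def pop_def)
  also have "\<dots> \<le> (\<Sum>d\<in>diff ` (X \<times> W). real (diff_rep X W d))"
    using fin by (intro sum_mono2) (auto simp: D_def)
  also have "\<dots> = real \<tau> ^ 2"
    using card_eq_sum_fibres[of "X \<times> W" diff] fin
    by (simp add: diff_rep_def card_cartesian_product cX cW power2_eq_square flip: of_nat_mult of_nat_sum)
  finally have "real (card D) * \<eta> \<le> real \<tau> ^ 2" .
  then have "real (card D) * (\<kappa>\<^sup>2 / 64) \<le> real \<tau>"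
    using \<tau> by (simp add: \<eta>_def power2_eq_square)
  then have cD: "real (card D) * \<kappa>\<^sup>2 \<le> 64 * real \<tau>" by simp
  \<comment> \<open>Middle vertices of paths y, u, v, y' all of whose edges are popular. Of the N^2
    candidates at most N^2 (1/8 + 1/32 + 1/8) fail, so at least half remain.\<close>
  define V where "V y y' = {(u, v). u \<in> Y \<and> v \<in> Y \<and> pop (y + u - z) \<and> pop (u + v - z) \<and> pop (v + y' - z)}" for y y'
  have finV: "finite (V y y')" for y y'
    by (rule finite_subset[of _ "Y \<times> Y"]) (auto simp: V_def finY)
  have cV: "N\<^sup>2 / 2 \<le> real (card (V y y'))" if yy: "y \<in> X'" "y' \<in> X'" for y y'
  proof -
    have "Y \<times> Y \<subseteq> V y y' \<union> (B y \<times> Y \<union> (bad z \<union> Y \<times> B y'))"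
      by (auto simp: V_def B_def bad_def Y_def add.commute)
    then have "card (Y \<times> Y) \<le> card (V y y' \<union> (B y \<times> Y \<union> (bad z \<union> Y \<times> B y')))"
      by (intro card_mono) (auto simp: finV finB finY finbad)
    also have "\<dots> \<le> card (V y y') + (card (B y \<times> Y) + (card (bad z) + card (Y \<times> B y')))"
      by (meson add_left_mono card_Un_le order_trans)
    finally have "real (card (Y \<times> Y)) \<le>
        real (card (V y y') + (card (B y \<times> Y) + (card (bad z) + card (Y \<times> B y'))))"
      by (rule of_nat_mono)
    then have "N\<^sup>2 \<le> real (card (V y y')) + (real (card (B y)) * N + (real (card (bad z)) + N * real (card (B y'))))"
      by (simp add: card_cartesian_product N_def power2_eq_square)
    moreover have "real (card (B y)) * N \<le> N / 8 * N" "N * real (card (B y')) \<le> N * (N / 8)"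
      using yy N0 by (auto intro!: mult_right_mono mult_left_mono simp: X'_def)
    moreover have "N / 8 * N = N\<^sup>2 / 8" "N * (N / 8) = N\<^sup>2 / 8" by (simp_all add: power2_eq_square)
    ultimately have "N\<^sup>2 \<le> real (card (V y y')) + (N\<^sup>2 / 8 + (N\<^sup>2 / 32 + N\<^sup>2 / 8))"
      using badN by linarith
    then show ?thesis using zero_le_power2[of N] by linarith
  qed
  have "\<forall>\<sigma>\<in>X' + X'. \<exists>p. fst p \<in> X' \<and> snd p \<in> X' \<and> \<sigma> = fst p + snd p"
    by (force simp: set_plus_def)
  then obtain p where p: "\<And>\<sigma>. \<sigma> \<in> X' + X' \<Longrightarrow> fst (p \<sigma>) \<in> X' \<and> snd (p \<sigma>) \<in> X' \<and> \<sigma> = fst (p \<sigma>) + snd (p \<sigma>)"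
    by metis
  have finXX: "finite (X' + X')"
    using XY finY finite_subset by (auto intro!: finite_set_plus)
  let ?K = "SIGMA \<sigma>:X' + X'. V (fst (p \<sigma>)) (snd (p \<sigma>))"
  \<comment> \<open>The alternating sum (y + u - z) - (u + v - z) + (v + y' - z) is y + y' - z. So
    the three popular differences determine the sum \<sigma>, and then \<open>u\<close> and
    \<open>v\<close>, because \<sigma> has the fixed representation p \<sigma>.\<close>
  have "card ?K \<le> card (D \<times> D \<times> D)"
  proof (rule card_inj_on_le[of "\<lambda>(\<sigma>, u, v). (fst (p \<sigma>) + u - z, u + v - z, v + snd (p \<sigma>) - z)"])
    show "inj_on (\<lambda>(\<sigma>, u, v). (fst (p \<sigma>) + u - z, u + v - z, v + snd (p \<sigma>) - z)) ?K"
    proof (rule inj_onI)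
      fix a b assume ab: "a \<in> ?K" "b \<in> ?K" "(\<lambda>(\<sigma>, u, v). (fst (p \<sigma>) + u - z, u + v - z, v + snd (p \<sigma>) - z)) a
        = (\<lambda>(\<sigma>, u, v). (fst (p \<sigma>) + u - z, u + v - z, v + snd (p \<sigma>) - z)) b"
      obtain \<sigma> u v where a: "a = (\<sigma>, u, v)" by (metis surj_pair)
      obtain \<sigma>' u' v' where b: "b = (\<sigma>', u', v')" by (metis surj_pair)
      have s: "\<sigma> \<in> X' + X'" "\<sigma>' \<in> X' + X'"
        and e: "fst (p \<sigma>) + u = fst (p \<sigma>') + u'" "u + v = u' + v'" "v + snd (p \<sigma>) = v' + snd (p \<sigma>')"
        using ab by (auto simp: a b)
      have "\<sigma> = \<sigma>'" using p[OF s(1)] p[OF s(2)] e by linarith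
      then show "a = b" using e by (simp add: a b)
    qed
    show "(\<lambda>(\<sigma>, u, v). (fst (p \<sigma>) + u - z, u + v - z, v + snd (p \<sigma>) - z)) ` ?K \<subseteq> D \<times> D \<times> D"
      by (auto simp: V_def intro!: popD)
  qed (use finD in auto)
  then have "real (card ?K) \<le> real (card D) ^ 3"
    by (simp add: card_cartesian_product power3_eq_cube mult_ac flip: of_nat_mult)
  moreover have "real (card ?K) = (\<Sum>\<sigma>\<in>X' + X'. real (card (V (fst (p \<sigma>)) (snd (p \<sigma>)))))"
    using finXX finV by (simp add: card_SigmaI)
  moreover have "(\<Sum>\<sigma>\<in>X' + X'. N\<^sup>2 / 2) \<le> (\<Sum>\<sigma>\<in>X' + X'. real (card (V (fst (p \<sigma>)) (snd (p \<sigma>)))))"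
    using p by (intro sum_mono cV) auto
  ultimately have K: "real (card (X' + X')) * (N\<^sup>2 / 2) \<le> real (card D) ^ 3" by simp
  let ?s = "real (card (X' + X'))"
  \<comment> \<open>Two powers of \<kappa> pay for N^2, and the other six for the cube of
    |D|.\<close>
  have "?s * \<kappa> ^ 8 * real \<tau> ^ 2 = 4 * \<kappa> ^ 6 * (?s * ((\<kappa>\<^sup>2 * real \<tau> ^ 2 / 2) / 2))"
    by (simp add: eval_nat_numeral)
  also have "\<dots> \<le> 4 * \<kappa> ^ 6 * (?s * (N\<^sup>2 / 2))"
    using N2 \<kappa> by (intro mult_left_mono) auto
  also have "\<dots> \<le> 4 * \<kappa> ^ 6 * real (card D) ^ 3" using K \<kappa> by (intro mult_left_mono) auto
  also have "\<dots> = 4 * (real (card D) * \<kappa>\<^sup>2) ^ 3" by (simp add: power_mult_distrib flip: power_mult)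
  also have "\<dots> \<le> 4 * (64 * real \<tau>) ^ 3" using cD \<kappa> by (intro mult_left_mono power_mono) auto
  also have "\<dots> = 2 ^ 20 * real \<tau> * real \<tau> ^ 2" by (simp add: power_mult_distrib power2_eq_square power3_eq_cube)
  finally have "?s * \<kappa> ^ 8 \<le> 2 ^ 20 * real \<tau>" using \<tau> by (simp add: mult_le_cancel_right)
  moreover have "\<kappa> * real \<tau> / 4 \<le> real (card X')" using cX' Nk by simp
  ultimately show ?thesis using XY YX by blast
qed

text \<open>Solymosi's energy bound for \<open>A\<close> and the part \<open>X'\<close> of
  \<open>X\<close> with small sumset. The product set has about |X'|^2 |A|^2 / (|X' + X'| |A + A|)
  elements at least: \<kappa>^2 is lost in |X'|^2 and \<kappa>^8 in |X' + X'|.\<close>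

lemma shared_ray_gives_many_products:
  fixes A X W :: "real set" and \<kappa> :: real
  assumes finA: "finite A" and posA: "\<And>a. a \<in> A \<Longrightarrow> 0 < a"
    and X: "X \<subseteq> A" "card X = \<tau>" and W: "finite W" "card W = \<tau>"
    and \<kappa>: "0 < \<kappa>" and \<tau>: "0 < \<tau>" and f: "mult_op f"
    and many: "\<kappa> * real \<tau> ^ 2 \<le> real (card {(y, w). y \<in> X \<and> w \<in> W \<and> y + w \<in> X})"
  shows "\<kappa> ^ 10 * real \<tau> * real (card A) ^ 2
    \<le> 2 ^ 27 * harm (card A) * real (card (A + A)) * real (card (op_set f X A))"
proof -
  have finX: "finite X" using X finA finite_subset by auto
  obtain X' where X': "X' \<subseteq> X" "\<kappa> * real \<tau> / 4 \<le> real (card X')"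
    "real (card (X' + X')) * \<kappa> ^ 8 \<le> 2 ^ 20 * real \<tau>"
    using small_sumset_from_closed_triples[OF finX W(1) X(2) W(2) \<kappa> \<tau> many] by auto
  have finX': "finite X'" and XA: "X' \<subseteq> A" using X' X finX finite_subset by auto
  define n s P x h e ss where "n = real (card A)" and "s = real (card (A + A))"
    and "P = real (card (op_set f X A))" and "x = real (card X')" and "h = (harm (card A) :: real)"
    and "e = real (mult_energy X' A)" and "ss = real (card (X' + X'))"
  have h0: "0 \<le> h" by (simp add: h_def harm_nonneg)
  have nn: "0 \<le> s" "0 \<le> P" "0 \<le> x" "0 \<le> e" "0 \<le> ss" "0 \<le> n"
    by (auto simp: s_def P_def x_def e_def ss_def n_def)
  have "(x * n)\<^sup>2 \<le> real (card (op_set f X' A)) * e"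
    unfolding x_def n_def e_def using XA by (intro mult_energy_lower finX' finA posA f) auto
  also have "\<dots> \<le> P * e"
    unfolding P_def using X'(1) finX finA nn by (intro mult_right_mono of_nat_mono card_mono op_set_mono) auto
  also have "\<dots> \<le> P * (6 * h * (ss * s))"
    unfolding e_def h_def ss_def s_def using XA finA
    by (intro mult_left_mono solymosi_energy_bound finX' finA posA card_mono) (auto simp: P_def)
  finally have 1: "(x * n)\<^sup>2 \<le> P * (6 * h * (ss * s))" .
  have "\<kappa> ^ 10 * real \<tau> * n ^ 2 * real \<tau> = 16 * \<kappa> ^ 8 * ((\<kappa> * real \<tau> / 4) * n)\<^sup>2"
    by (simp add: power_mult_distrib power_divide eval_nat_numeral)
  also have "\<dots> \<le> 16 * \<kappa> ^ 8 * (x * n)\<^sup>2"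
    using X'(2) \<kappa> nn by (intro mult_left_mono power_mono mult_right_mono) (auto simp: x_def)
  also have "\<dots> \<le> 16 * \<kappa> ^ 8 * (P * (6 * h * (ss * s)))" using 1 \<kappa> by (intro mult_left_mono) auto
  also have "\<dots> = 96 * h * s * P * (ss * \<kappa> ^ 8)" by simp
  also have "\<dots> \<le> 96 * h * s * P * (2 ^ 20 * real \<tau>)"
    using X'(3) h0 nn by (intro mult_left_mono) (auto simp: ss_def)
  also have "\<dots> \<le> 2 ^ 27 * h * s * P * real \<tau>"
    using h0 nn by (simp add: mult_right_mono)
  finally show ?thesis using \<tau> by (simp add: n_def h_def s_def P_def mult_ac)
qed

section \<open>Disjoint pairs of rays\<close>

text \<open>The factor \<open>\<alpha> \<beta> \<alpha>' \<beta>' < 0\<close> makes \<open>\<rho> = - \<alpha>' \<beta> / (\<alpha> \<beta>')\<close> positive, and a common neighbour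
  \<open>y\<close> of \<open>x\<close> and \<open>x'\<close> expresses \<open>x + \<rho> x'\<close> through \<open>\<alpha> x + \<beta> y\<close> and \<open>\<alpha>' x' + \<beta>' y\<close>. In a
  block of rays, common neighbours between distinct rays exist by Cauchy--Schwarz, and the vector
  sums \<open>v + \<rho> v'\<close> of different blocks lie in different sectors.\<close>

lemma rich_slopes_bound_two_forms:
  fixes X Y U V :: "real set" and Nb :: "real \<Rightarrow> real set" and \<alpha> \<beta> \<alpha>' \<beta>' :: real
  assumes fin: "finite X" "finite Y" "finite U" "finite V" and pos: "\<And>x. x \<in> X \<Longrightarrow> 0 < x"
    and c: "card X \<le> \<tau>" "card Y \<le> \<tau>" "card U \<le> \<tau>" "card V \<le> \<tau>" and \<tau>: "0 < \<tau>"
    and sgn: "\<alpha> * \<beta> * \<alpha>' * \<beta>' < 0" and D0: "1 \<le> D0"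
    and Nb: "\<And>x. x \<in> X \<Longrightarrow> Nb x \<subseteq> Y \<and> card (Nb x) = D0"
    and forms: "\<And>x y. x \<in> X \<Longrightarrow> y \<in> Nb x \<Longrightarrow> \<alpha> * x + \<beta> * y \<in> U \<and> \<alpha>' * x + \<beta>' * y \<in> V"
  shows "real t ^ 2 * real (card {\<mu> \<in> ratio ` (X \<times> X). t \<le> card (ray X X \<mu>)}) * real D0 ^ 6
    \<le> 12 * real \<tau> ^ 8"
proof (cases "t = 0 \<or> {\<mu> \<in> ratio ` (X \<times> X). t \<le> card (ray X X \<mu>)} = {}")
  case True
  then show ?thesis by (auto simp del: Collect_empty_eq)
next
  case False
  define \<Lambda> where "\<Lambda> = {\<mu> \<in> ratio ` (X \<times> X). t \<le> card (ray X X \<mu>)}"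
  have t0: "0 < t" and L0: "\<Lambda> \<noteq> {}" using False by (auto simp: \<Lambda>_def)
  have finL: "finite \<Lambda>" using fin by (simp add: \<Lambda>_def)
  obtain \<mu>0 where \<mu>0: "\<mu>0 \<in> \<Lambda>" using L0 by auto
  have tX: "t \<le> card X"
    using \<mu>0 card_mono[OF fin(1) ray_subset[of X X \<mu>0]] by (auto simp: \<Lambda>_def)
  then have t\<tau>: "t \<le> \<tau>" using c by simp
  have "X \<noteq> {}" using tX t0 by auto
  then obtain x0 where "x0 \<in> X" by auto
  then have D\<tau>: "D0 \<le> \<tau>" using Nb[of x0] card_mono[OF fin(2), of "Nb x0"] c by linarith
  have finNb: "finite (Nb x)" if "x \<in> X" for x using Nb[OF that] fin(2) finite_subset by auto
  define d where "d = real D0"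
  define T where "T = real \<tau>"
  have d1: "1 \<le> d" and dT: "d \<le> T" and T0: "0 < T" using D0 D\<tau> \<tau> by (auto simp: d_def T_def)
  \<comment> \<open>The least block size for which coincidences within a single ray, of which there
    are at most m t^2 d^2, take up no more than half of the Cauchy--Schwarz bound.\<close>
  define m where "m = nat \<lceil>2 * T\<^sup>2 / d\<^sup>2\<rceil>"
  have q2: "2 \<le> 2 * T\<^sup>2 / d\<^sup>2" using d1 dT power_mono[OF dT, of 2] by (simp add: field_simps)
  have mle: "2 * T\<^sup>2 / d\<^sup>2 \<le> real m" and mlt: "real m \<le> 2 * T\<^sup>2 / d\<^sup>2 + 1"
    unfolding m_def using q2 by linarith+
  have m1: "2 * T\<^sup>2 \<le> real m * d\<^sup>2" using mle d1 by (simp add: field_simps)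
  have "real m * d\<^sup>2 \<le> (2 * T\<^sup>2 / d\<^sup>2 + 1) * d\<^sup>2" using mlt by (intro mult_right_mono) auto
  also have "\<dots> = 2 * T\<^sup>2 + d\<^sup>2" using d1 by (simp add: field_simps)
  finally have m2: "real m * d\<^sup>2 \<le> 3 * T\<^sup>2" using d1 power_mono[OF dT, of 2] by simp
  have m0: "0 < m" using mle q2 by (metis gr0I of_nat_0 order_trans not_numeral_le_zero)
  have "\<forall>\<mu>\<in>\<Lambda>. \<exists>R. R \<subseteq> ray X X \<mu> \<and> card R = t"
    using obtain_subset_with_card_n by (metis (no_types, lifting) \<Lambda>_def mem_Collect_eq)
  then obtain R where R: "\<And>\<mu>. \<mu> \<in> \<Lambda> \<Longrightarrow> R \<mu> \<subseteq> ray X X \<mu> \<and> card (R \<mu>) = t" by metis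
  have RX: "x \<in> X" "\<mu> * x \<in> X" if "\<mu> \<in> \<Lambda>" "x \<in> R \<mu>" for \<mu> x
    using R[OF that(1)] that(2) by (auto simp: ray_def)
  have finR: "finite (R \<mu>)" if "\<mu> \<in> \<Lambda>" for \<mu>
    using R[OF that] fin(1) finite_subset[of "R \<mu>" "ray X X \<mu>"] by simp
  have NbY: "y \<in> Y" if "x \<in> X" "y \<in> Nb x" for x y using Nb[OF that(1)] that(2) by auto
  \<comment> \<open>A point on ray \<open>i\<close> and a point on ray \<open>j\<close> together
    with a common neighbour \<open>y1\<close> of their abscissae and a common neighbour
    \<open>y2\<close> of their ordinates.\<close>
  define K where "K i j = {(x, x', y1, y2). x \<in> R i \<and> x' \<in> R j \<and> y1 \<in> Nb x \<inter> Nb x' \<and> y2 \<in> Nb (i * x) \<inter> Nb (j * x')}" for i j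
  have finK: "finite (K i j)" if "i \<in> \<Lambda>" "j \<in> \<Lambda>" for i j
  proof (rule finite_subset)
    show "K i j \<subseteq> R i \<times> R j \<times> Y \<times> Y"
      using that by (auto simp: K_def intro: NbY[OF RX(1)] NbY[OF RX(2)])
  qed (use finR that fin in auto)
  obtain \<C> where C: "finite \<C>" "card \<C> = card \<Lambda> div m" "\<And>I. I \<in> \<C> \<Longrightarrow> I \<subseteq> \<Lambda> \<and> card I = m"
    "\<forall>I\<in>\<C>. \<forall>J\<in>\<C>. I \<noteq> J \<longrightarrow> separated I J"
    using separated_blocks_exist[OF finL m0] by auto
  \<comment> \<open>Cauchy--Schwarz provides m^2 t^2 d^4 / T^2 coincidences in a block. The half not
    lost to single rays is spread over fewer than m^2 pairs of distinct rays.\<close>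
  define w where "w = real t ^ 2 * d ^ 4 / (2 * T\<^sup>2)"
  have good_pair: "\<exists>p. fst p \<in> I \<and> snd p \<in> I \<and> fst p \<noteq> snd p \<and> w \<le> real (card (K (fst p) (snd p)))"
    if I: "I \<in> \<C>" for I
  proof (rule ccontr)
    assume neg: "\<not> ?thesis"
    then have small: "real (card (K i j)) < w" if "i \<in> I" "j \<in> I" "i \<noteq> j" for i j
      using that by (metis fst_conv snd_conv not_le)
    have IL: "I \<subseteq> \<Lambda>" and cI: "card I = m" using C(3)[OF I] by auto
    have finI: "finite I" using IL finL finite_subset by auto
    \<comment> \<open>Every chosen point of the block is listed with its D0^2 pairs of neighbours in
      \<open>Y \<times> Y\<close>; a collision of \<open>g\<close> is a pair of points with common
      neighbours.\<close>
    define S where "S = (SIGMA i:I. SIGMA x:R i. Nb x \<times> Nb (i * x))"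
    define g where "g = (\<lambda>(i :: real, x :: real, y :: real \<times> real). y)"
    have finS: "finite S"
      unfolding S_def using finI IL finR finNb RX by (intro finite_SigmaI) blast+
    have "card S = (\<Sum>i\<in>I. card (SIGMA x:R i. Nb x \<times> Nb (i * x)))"
      unfolding S_def using finI IL finR finNb RX by (intro card_SigmaI ballI finite_SigmaI) blast+
    also have "\<dots> = (\<Sum>i\<in>I. t * (D0 * D0))"
    proof (rule sum.cong[OF refl])
      fix i assume i: "i \<in> I"
      then have iL: "i \<in> \<Lambda>" using IL by auto
      have "card (SIGMA x:R i. Nb x \<times> Nb (i * x)) = (\<Sum>x\<in>R i. card (Nb x \<times> Nb (i * x)))"
        using finR[OF iL] finNb RX[OF iL] by (intro card_SigmaI ballI finite_cartesian_product) blast+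
      also have "\<dots> = (\<Sum>x\<in>R i. D0 * D0)"
        using RX[OF iL] Nb by (intro sum.cong refl) (simp add: card_cartesian_product)
      finally show "card (SIGMA x:R i. Nb x \<times> Nb (i * x)) = t * (D0 * D0)" using R[OF iL] by simp
    qed
    finally have cS: "real (card S) = real m * real t * d\<^sup>2"
      using cI by (simp add: d_def power2_eq_square)
    have "(real (card S))\<^sup>2 \<le> real (card (Y \<times> Y)) * real (card (collisions g S))"
    proof (rule card_square_le_image_collisions[OF finS])
      show "g ` S \<subseteq> Y \<times> Y" using IL by (auto simp: S_def g_def intro: NbY[OF RX(1)] NbY[OF RX(2)])
    qed (use fin in auto)
    also have "\<dots> \<le> T\<^sup>2 * real (card (collisions g S))"
      using c(2) by (intro mult_right_mono) (auto simp: card_cartesian_product T_def power2_eq_square intro!: mult_mono)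
    finally have CS: "(real (card S))\<^sup>2 \<le> T\<^sup>2 * real (card (collisions g S))" .
    let ?P = "{p \<in> I \<times> I. fst p \<noteq> snd p}"
    let ?diag = "SIGMA i:I. SIGMA x:R i. R i \<times> (Nb x \<times> Nb (i * x))"
    let ?off = "SIGMA p:?P. K (fst p) (snd p)"
    have fd: "finite ?diag" using finI IL finR finNb RX by (intro finite_SigmaI) blast+
    have ILm: "i \<in> \<Lambda>" if "i \<in> I" for i using IL that by auto
    have fo: "finite ?off" using finI by (intro finite_SigmaI) (auto intro!: finK ILm)
    have "card (collisions g S) \<le> card (?diag <+> ?off)"
    proof (rule card_inj_on_le)
      let ?h = "\<lambda>((i, x, y), (j, x', y')). if i = j then Inl (i, x, x', y) else Inr ((i, j), (x, x', y))"
      show "inj_on ?h (collisions g S)"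
        by (auto simp: inj_on_def collisions_def g_def split: if_splits)
      show "?h ` collisions g S \<subseteq> ?diag <+> ?off"
        by (auto simp: collisions_def g_def S_def K_def split: if_splits)
      show "finite (?diag <+> ?off)" using fd fo by simp
    qed
    also have "\<dots> = card ?diag + card ?off" using fd fo by (rule card_Plus)
    finally have split: "real (card (collisions g S)) \<le> real (card ?diag) + real (card ?off)"
      by (simp flip: of_nat_add)
    have "card ?diag = (\<Sum>i\<in>I. card (SIGMA x:R i. R i \<times> (Nb x \<times> Nb (i * x))))"
      using finI IL finR finNb RX by (intro card_SigmaI ballI finite_SigmaI) blast+
    also have "\<dots> = (\<Sum>i\<in>I. t * (t * (D0 * D0)))"
    proof (rule sum.cong[OF refl])
      fix i assume i: "i \<in> I"
      then have iL: "i \<in> \<Lambda>" using IL by auto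
      have "card (SIGMA x:R i. R i \<times> (Nb x \<times> Nb (i * x))) = (\<Sum>x\<in>R i. card (R i \<times> (Nb x \<times> Nb (i * x))))"
        using finR[OF iL] finNb RX[OF iL] by (intro card_SigmaI ballI finite_cartesian_product) blast+
      also have "\<dots> = (\<Sum>x\<in>R i. t * (D0 * D0))"
        using RX[OF iL] Nb R[OF iL] by (intro sum.cong refl) (simp add: card_cartesian_product)
      finally show "card (SIGMA x:R i. R i \<times> (Nb x \<times> Nb (i * x))) = t * (t * (D0 * D0))" using R[OF iL] by simp
    qed
    finally have cdiag: "real (card ?diag) = real m * real t ^ 2 * d\<^sup>2"
      using cI by (simp add: d_def power2_eq_square)
    have "card ?P < m * m"
    proof -
      obtain i where "i \<in> I" using cI m0 by fastforce
      then have "(i, i) \<in> I \<times> I" "(i, i) \<notin> ?P" by auto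
      then have "?P \<subset> I \<times> I" by blast
      then have "card ?P < card (I \<times> I)" using finI by (intro psubset_card_mono) auto
      then show ?thesis using cI by (simp add: card_cartesian_product)
    qed
    then have cP: "real (card ?P) < real m * real m" by (simp flip: of_nat_mult)
    have w0: "0 < w" using t0 d1 T0 by (simp add: w_def)
    have "real (card ?off) = (\<Sum>p\<in>?P. real (card (K (fst p) (snd p))))"
      using finI by (subst card_SigmaI) (auto intro!: finK ILm)
    also have "\<dots> \<le> (\<Sum>p\<in>?P. w)" using small by (intro sum_mono) (auto intro: less_imp_le)
    also have "\<dots> = real (card ?P) * w" by simp
    also have "\<dots> < real m * real m * w" using cP w0 by (rule mult_strict_right_mono)
    finally have coff: "real (card ?off) < real m * real m * w" .
    have "(real m * real t * d\<^sup>2)\<^sup>2 < T\<^sup>2 * (real m * real t ^ 2 * d\<^sup>2 + real m * real m * w)"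
    proof -
      have "real (card (collisions g S)) < real m * real t ^ 2 * d\<^sup>2 + real m * real m * w"
        using split coff unfolding cdiag by linarith
      then have "T\<^sup>2 * real (card (collisions g S)) < T\<^sup>2 * (real m * real t ^ 2 * d\<^sup>2 + real m * real m * w)"
        using T0 by (intro mult_strict_left_mono) auto
      then show ?thesis using CS unfolding cS by linarith
    qed
    also have "\<dots> = (2 * T\<^sup>2) * (real m * real t ^ 2 * d\<^sup>2) / 2 + (real m * real t * d\<^sup>2)\<^sup>2 / 2"
      using T0 by (simp add: w_def power2_eq_square eval_nat_numeral field_simps)
    also have "\<dots> \<le> (real m * d\<^sup>2) * (real m * real t ^ 2 * d\<^sup>2) / 2 + (real m * real t * d\<^sup>2)\<^sup>2 / 2"
      using m1 by (intro add_right_mono divide_right_mono mult_right_mono) auto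
    also have "\<dots> = (real m * real t * d\<^sup>2)\<^sup>2" by (simp add: power2_eq_square)
    finally show False by simp
  qed
  then obtain p where p: "\<And>I. I \<in> \<C> \<Longrightarrow> fst (p I) \<in> I \<and> snd (p I) \<in> I \<and> fst (p I) \<noteq> snd (p I) \<and>
      w \<le> real (card (K (fst (p I)) (snd (p I))))" by metis
  define \<rho> where "\<rho> = - (\<alpha>' * \<beta>) / (\<alpha> * \<beta>')"
  have nz: "\<alpha> \<noteq> 0" "\<beta> \<noteq> 0" "\<alpha>' \<noteq> 0" "\<beta>' \<noteq> 0" using sgn by auto
  have "\<rho> * (\<alpha> * \<beta>')\<^sup>2 = - (\<alpha> * \<beta> * \<alpha>' * \<beta>')" using nz by (simp add: \<rho>_def power2_eq_square)
  then have "0 < \<rho> * (\<alpha> * \<beta>')\<^sup>2" using sgn by simp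
  then have \<rho>0: "0 < \<rho>" by (simp add: zero_less_mult_iff)
  have combine: "\<beta>' * (\<alpha> * x + \<beta> * y) - \<beta> * (\<alpha>' * x' + \<beta>' * y) = \<alpha> * \<beta>' * (x + \<rho> * x')" for x x' y
    using nz by (simp add: \<rho>_def field_simps)
  let ?Z = "SIGMA I:\<C>. K (fst (p I)) (snd (p I))"
  let ?a = "\<lambda>(I, x, x', y1, y2). (\<alpha> * x + \<beta> * y1, \<alpha>' * x' + \<beta>' * y1,
      \<alpha> * (fst (p I) * x) + \<beta> * y2, \<alpha>' * (snd (p I) * x') + \<beta>' * y2)"
  have pL: "fst (p I) \<in> \<Lambda>" "snd (p I) \<in> \<Lambda>" if "I \<in> \<C>" for I
    using p[OF that] C(3)[OF that] by auto
  have fU: "\<alpha> * x + \<beta> * y \<in> U" and fV: "\<alpha>' * x + \<beta>' * y \<in> V" if "x \<in> X" "y \<in> Nb x" for x y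
    using forms that by auto
  \<comment> \<open>The four values of the forms give both coordinates of the vector sum with weight
    \<rho>. Its slope reveals the block, hence the two rays; then the points follow, and from them
    \<open>y1\<close> and \<open>y2\<close>.\<close>
  have "card ?Z \<le> card (U \<times> V \<times> U \<times> V)"
  proof (rule card_inj_on_le[of ?a])
    show "?a ` ?Z \<subseteq> U \<times> V \<times> U \<times> V"
      by (auto simp: K_def intro!: fU[OF RX(1)[OF pL(1)]] fU[OF RX(2)[OF pL(1)]]
          fV[OF RX(1)[OF pL(2)]] fV[OF RX(2)[OF pL(2)]])
    show "finite (U \<times> V \<times> U \<times> V)" using fin by simp
    show "inj_on ?a ?Z"
    proof (rule inj_onI)
      fix u v assume uv: "u \<in> ?Z" "v \<in> ?Z" "?a u = ?a v"
      obtain I x x' y1 y2 where u: "u = (I, x, x', y1, y2)" by (metis surj_pair)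
      obtain J z z' q1 q2 where v: "v = (J, z, z', q1, q2)" by (metis surj_pair)
      define i j k l where "i = fst (p I)" and "j = snd (p I)" and "k = fst (p J)" and "l = snd (p J)"
      have IJ: "I \<in> \<C>" "J \<in> \<C>" and mem: "x \<in> R i" "x' \<in> R j" "z \<in> R k" "z' \<in> R l"
        using uv by (auto simp: u v K_def i_def j_def k_def l_def)
      have e: "\<alpha> * x + \<beta> * y1 = \<alpha> * z + \<beta> * q1" "\<alpha>' * x' + \<beta>' * y1 = \<alpha>' * z' + \<beta>' * q1"
        "\<alpha> * (i * x) + \<beta> * y2 = \<alpha> * (k * z) + \<beta> * q2" "\<alpha>' * (j * x') + \<beta>' * y2 = \<alpha>' * (l * z') + \<beta>' * q2"
        using uv by (auto simp: u v i_def j_def k_def l_def)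
      have ij: "i \<in> I" "j \<in> I" "i \<noteq> j" "k \<in> J" "l \<in> J" "k \<noteq> l"
        using p[OF IJ(1)] p[OF IJ(2)] by (auto simp: i_def j_def k_def l_def)
      have ps: "0 < x" "0 < \<rho> * x'" "0 < z" "0 < \<rho> * z'"
        using mem RX pL[OF IJ(1)] pL[OF IJ(2)] pos \<rho>0 by (auto simp: i_def j_def k_def l_def)
      have "\<alpha> * \<beta>' * (x + \<rho> * x') = \<alpha> * \<beta>' * (z + \<rho> * z')"
        by (simp only: combine[of x y1 x', symmetric] combine[of z q1 z', symmetric] e(1,2))
      then have s1: "x + \<rho> * x' = z + \<rho> * z'" using nz by simp
      have "\<alpha> * \<beta>' * (i * x + \<rho> * (j * x')) = \<alpha> * \<beta>' * (k * z + \<rho> * (l * z'))"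
        by (simp only: combine[of "i * x" y2 "j * x'", symmetric]
            combine[of "k * z" q2 "l * z'", symmetric] e(3,4))
      then have s2: "i * x + \<rho> * (j * x') = k * z + \<rho> * (l * z')" using nz by simp
      then have s2': "i * x + j * (\<rho> * x') = k * z + l * (\<rho> * z')" by (simp add: mult.left_commute)
      have IJeq: "I = J"
      proof (rule separated_sectors_disjoint[OF C(4) IJ ij(1,2) _ _ ij(4,5)])
        show "min i j < (i * x + j * (\<rho> * x')) / (x + \<rho> * x')"
          "(i * x + j * (\<rho> * x')) / (x + \<rho> * x') < max i j"
          using slope_of_sum_between[OF ps(1,2) ij(3)] by auto
        show "min k l < (i * x + j * (\<rho> * x')) / (x + \<rho> * x')"
          "(i * x + j * (\<rho> * x')) / (x + \<rho> * x') < max k l"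
          unfolding s1 s2' using slope_of_sum_between[OF ps(3,4) ij(6)] by auto
      qed
      then have kl: "k = i" "l = j" by (auto simp: i_def j_def k_def l_def)
      have "x = z" "x' = z'"
        using sum_on_rays_determines_points[OF ij(3) _ s1] s2 \<rho>0 kl by auto
      moreover have "y1 = q1" "y2 = q2" using e(1,3) nz kl calculation by auto
      ultimately show "u = v" using IJeq by (simp add: u v)
    qed
  qed
  also have "\<dots> \<le> \<tau> * (\<tau> * (\<tau> * \<tau>))"
    unfolding card_cartesian_product using c by (intro mult_mono) auto
  finally have "real (card ?Z) \<le> T ^ 4" by (simp add: T_def eval_nat_numeral flip: of_nat_mult)
  moreover have "real (card ?Z) = (\<Sum>I\<in>\<C>. real (card (K (fst (p I)) (snd (p I)))))"
    using C(1) by (subst card_SigmaI) (auto intro!: finK pL)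
  moreover have "(\<Sum>I\<in>\<C>. w) \<le> (\<Sum>I\<in>\<C>. real (card (K (fst (p I)) (snd (p I)))))"
    using p by (intro sum_mono) auto
  ultimately have "real (card \<Lambda> div m) * w \<le> T ^ 4" using C(2) by simp
  then have q: "real (card \<Lambda> div m) * (real t ^ 2 * d ^ 4) \<le> 2 * T ^ 6"
    using T0 by (simp add: w_def field_simps eval_nat_numeral)
  have "real t ^ 2 * real (card \<Lambda>) * d ^ 6 \<le> 12 * T ^ 8"
  proof (cases "card \<Lambda> div m = 0")
    case False
    have "card \<Lambda> = (card \<Lambda> div m) * m + card \<Lambda> mod m" by simp
    also have "\<dots> \<le> (card \<Lambda> div m) * m + m" using m0 by (intro add_left_mono) (simp add: less_imp_le)
    also have "\<dots> \<le> 2 * (card \<Lambda> div m) * m" using False by (cases "card \<Lambda> div m") auto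
    finally have "real (card \<Lambda>) \<le> 2 * real (card \<Lambda> div m) * real m"
      by (metis (mono_tags) of_nat_le_iff of_nat_mult of_nat_numeral)
    then have "real t ^ 2 * real (card \<Lambda>) * d ^ 6 \<le> real t ^ 2 * (2 * real (card \<Lambda> div m) * real m) * d ^ 6"
      using d1 by (intro mult_right_mono mult_left_mono) auto
    also have "\<dots> = 2 * (real m * d\<^sup>2) * (real (card \<Lambda> div m) * (real t ^ 2 * d ^ 4))"
      by (simp add: eval_nat_numeral)
    also have "\<dots> \<le> 2 * (3 * T\<^sup>2) * (2 * T ^ 6)" using d1 by (intro mult_mono[OF mult_left_mono[OF m2] q]) auto
    also have "\<dots> = 12 * T ^ 8" by (simp add: eval_nat_numeral)
    finally show ?thesis .
  next
    \<comment> \<open>No complete block exists. Now |\<Lambda>| \<le> m, and m d^2 \<le> 3 T^2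
      together with t, d \<le> T is enough.\<close>
    case True
    then have "card \<Lambda> \<le> m" using m0 by (simp add: div_eq_0_iff)
    then have "real t ^ 2 * real (card \<Lambda>) * d ^ 6 \<le> real t ^ 2 * real m * d ^ 6"
      using d1 by (intro mult_right_mono mult_left_mono) auto
    also have "\<dots> = (real m * d\<^sup>2) * (real t ^ 2 * d ^ 4)" by (simp add: eval_nat_numeral)
    also have "\<dots> \<le> (3 * T\<^sup>2) * (T ^ 2 * T ^ 4)"
      using d1 dT t\<tau> by (intro mult_mono[OF m2 mult_mono[OF power_mono power_mono]]) (auto simp: T_def)
    also have "\<dots> \<le> 12 * T ^ 8" using T0 by (simp add: eval_nat_numeral)
    finally show ?thesis .
  qed
  then show ?thesis by (simp add: \<Lambda>_def d_def T_def)
qed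

text \<open>Pruning to vertices of one degree \<open>D0\<close> makes
  \<open>rich_slopes_bound_two_forms\<close> applicable, so the energy of the remaining set
  \<open>X'\<close> is at most about T^8 / d^6 and its product set at least about x^4 d^6 / T^8.
  Density gives d x >~ \<kappa> T^2, used four times, and d >~ \<kappa> T, used twice: hence
  \<kappa>^6.\<close>

lemma two_forms_give_many_products:
  fixes X Y U V :: "real set" and \<alpha> \<beta> \<alpha>' \<beta>' \<kappa> :: real
  assumes fin: "finite X" "finite Y" "finite U" "finite V" and pos: "\<And>x. x \<in> X \<Longrightarrow> 0 < x"
    and c: "card X = \<tau>" "card Y = \<tau>" "card U \<le> \<tau>" "card V \<le> \<tau>" and \<tau>: "0 < \<tau>" "\<tau> \<le> n"
    and sgn: "\<alpha> * \<beta> * \<alpha>' * \<beta>' < 0" and \<kappa>: "0 < \<kappa>" and f: "mult_op f"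
    and many: "\<kappa> * real \<tau> ^ 2
      \<le> real (card {(x, y). x \<in> X \<and> y \<in> Y \<and> \<alpha> * x + \<beta> * y \<in> U \<and> \<alpha>' * x + \<beta>' * y \<in> V})"
  shows "\<kappa> ^ 6 * real \<tau> ^ 2 \<le> 24 * harm n ^ 7 * real (card (op_set f X X))"
proof -
  define N where "N x = {y \<in> Y. \<alpha> * x + \<beta> * y \<in> U \<and> \<alpha>' * x + \<beta>' * y \<in> V}" for x
  have finN: "finite (N x)" for x using fin by (simp add: N_def)
  have "{(x, y). x \<in> X \<and> y \<in> Y \<and> \<alpha> * x + \<beta> * y \<in> U \<and> \<alpha>' * x + \<beta>' * y \<in> V} = (SIGMA x:X. N x)"
    by (auto simp: N_def)
  then have sumN: "\<kappa> * real \<tau> ^ 2 \<le> (\<Sum>x\<in>X. real (card (N x)) ^ 1)"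
    using many fin finN by (simp add: card_SigmaI)
  obtain D0 where D0: "1 \<le> D0" "D0 \<le> n"
    "(\<Sum>x\<in>X. real (card (N x)) ^ 1) \<le> real 1 * harm n * (real D0 ^ 1 * real (card {x \<in> X. D0 \<le> card (N x)}))"
  proof (rule popular_level[of X "\<lambda>x. card (N x)" n 1])
    fix x show "card (N x) \<le> n" using card_mono[OF fin(2), of "N x"] c \<tau> by (auto simp: N_def)
  qed (use fin \<tau> in auto)
  define X' where "X' = {x \<in> X. D0 \<le> card (N x)}"
  have finX': "finite X'" and sub: "X' \<subseteq> X" using fin by (auto simp: X'_def)
  have "\<forall>x\<in>X'. \<exists>M. M \<subseteq> N x \<and> card M = D0"
    using obtain_subset_with_card_n by (metis (no_types, lifting) X'_def mem_Collect_eq)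
  then obtain Nb where Nb: "\<And>x. x \<in> X' \<Longrightarrow> Nb x \<subseteq> N x \<and> card (Nb x) = D0" by metis
  define h x d T e P where "h = (harm n :: real)" and "x = real (card X')" and "d = real D0"
    and "T = real \<tau>" and "e = real (mult_energy X' X')" and "P = real (card (op_set f X X))"
  have h1: "1 \<le> h" using \<tau> harm_mono[of 1 n] by (simp add: h_def harm_expand)
  have d1: "1 \<le> d" and T0: "0 < T" using D0 \<tau> by (auto simp: d_def T_def)
  have nn: "0 \<le> x" "0 \<le> e" "0 \<le> P" by (auto simp: x_def e_def P_def)
  have kT: "\<kappa> * T\<^sup>2 \<le> h * (d * x)" using sumN D0(3) by (simp add: h_def d_def x_def X'_def T_def)
  have xT: "x \<le> T" using card_mono[OF fin(1) sub] c by (simp add: x_def T_def)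
  have "\<kappa> * T * T \<le> h * (d * x)" using kT by (simp add: power2_eq_square)
  also have "\<dots> \<le> h * (d * T)" using xT h1 d1 by (intro mult_left_mono) auto
  finally have kd: "\<kappa> * T \<le> h * d" using T0 by (simp add: mult_le_cancel_right)
  have "e \<le> 2 * h * (12 * T ^ 8 / d ^ 6)" unfolding e_def h_def
  proof (rule mult_energy_upper[OF finX' finX'])
    show "0 < x" if "x \<in> X'" for x using that sub pos by auto
    show "card X' \<le> n" using card_mono[OF fin(1) sub] c \<tau> by simp
    fix t :: nat
    have "real t ^ 2 * real (card {\<mu> \<in> ratio ` (X' \<times> X'). t \<le> card (ray X' X' \<mu>)}) * real D0 ^ 6 \<le> 12 * real \<tau> ^ 8"
    proof (rule rich_slopes_bound_two_forms[OF finX' fin(2,3,4) _ _ _ c(3,4) \<tau>(1) sgn D0(1)])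
      show "card X' \<le> \<tau>" using card_mono[OF fin(1) sub] c by simp
      show "Nb x \<subseteq> Y \<and> card (Nb x) = D0" if "x \<in> X'" for x using Nb[OF that] by (auto simp: N_def)
      show "\<alpha> * x + \<beta> * y \<in> U \<and> \<alpha>' * x + \<beta>' * y \<in> V" if "x \<in> X'" "y \<in> Nb x" for x y
        using Nb[OF that(1)] that(2) by (auto simp: N_def)
    qed (use sub pos c in auto)
    then show "real t ^ 2 * real (card {\<mu> \<in> ratio ` (X' \<times> X'). t \<le> card (ray X' X' \<mu>)}) \<le> 12 * T ^ 8 / d ^ 6"
      using d1 by (simp add: T_def d_def field_simps)
  qed
  then have ed: "e * d ^ 6 \<le> 24 * h * T ^ 8" using d1 by (simp add: field_simps)
  have "(x * x)\<^sup>2 \<le> real (card (op_set f X' X')) * e"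
    unfolding x_def e_def using sub pos by (intro mult_energy_lower finX' f) auto
  also have "\<dots> \<le> P * e" unfolding P_def
    using sub fin nn by (intro mult_right_mono of_nat_mono card_mono op_set_mono) auto
  finally have x4: "(x * x)\<^sup>2 \<le> P * e" .
  have "\<kappa> ^ 6 * T\<^sup>2 * T ^ 8 = (\<kappa> * T\<^sup>2) ^ 4 * (\<kappa> * T)\<^sup>2"
    by (simp add: power_mult_distrib flip: power_mult power_add)
  also have "\<dots> \<le> (h * (d * x)) ^ 4 * (h * d)\<^sup>2"
    using \<kappa> T0 h1 d1 nn by (intro mult_mono[OF power_mono[OF kT] power_mono[OF kd]]) auto
  also have "\<dots> = h ^ 6 * d ^ 6 * (x * x)\<^sup>2" by (simp add: eval_nat_numeral)
  also have "\<dots> \<le> h ^ 6 * d ^ 6 * (P * e)" using x4 h1 d1 by (intro mult_left_mono) auto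
  also have "\<dots> = h ^ 6 * P * (e * d ^ 6)" by simp
  also have "\<dots> \<le> h ^ 6 * P * (24 * h * T ^ 8)" using ed h1 nn by (intro mult_left_mono) auto
  also have "\<dots> = (24 * h ^ 7 * P) * T ^ 8" by (simp add: eval_nat_numeral)
  finally have "\<kappa> ^ 6 * T\<^sup>2 \<le> 24 * h ^ 7 * P" using T0 by (simp add: mult_le_cancel_right)
  then show ?thesis by (simp add: T_def h_def P_def)
qed

text \<open>Subtracting \<mu>4 or \<mu>3 times the first equation from the second eliminates
  \<open>b4\<close> or \<open>b3\<close>, and leaves two linear forms in \<open>b1\<close>,
  \<open>b2\<close> with values in dilates of \<open>B3\<close> and \<open>B4\<close>. The product
  of their coefficients is (e1 e2)^2 times the product in \<open>sgn\<close>; the signs of the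
  \<open>e\<close>s drop out.\<close>

lemma four_term_relation_gives_many_products:
  fixes B1 B2 B3 B4 :: "real set" and e1 e2 e3 e4 \<mu>1 \<mu>2 \<mu>3 \<mu>4 \<kappa> :: real
  assumes fin: "finite B1" "finite B2" "finite B3" "finite B4" and pos: "\<And>x. x \<in> B1 \<Longrightarrow> 0 < x"
    and c: "card B1 = \<tau>" "card B2 = \<tau>" "card B3 = \<tau>" "card B4 = \<tau>" and \<tau>: "0 < \<tau>" "\<tau> \<le> n"
    and e: "e1 \<noteq> 0" "e2 \<noteq> 0" "e3 \<noteq> 0" "e4 \<noteq> 0" and ne: "\<mu>3 \<noteq> \<mu>4"
    and sgn: "(\<mu>1 - \<mu>3) * (\<mu>2 - \<mu>3) * (\<mu>1 - \<mu>4) * (\<mu>2 - \<mu>4) < 0"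
    and \<kappa>: "0 < \<kappa>" and f: "mult_op f"
    and many: "\<kappa> * real \<tau> ^ 2 \<le> real (card {(b1, b2, b3, b4). b1 \<in> B1 \<and> b2 \<in> B2 \<and> b3 \<in> B3 \<and> b4 \<in> B4 \<and>
      e1 * b1 + e2 * b2 + e3 * b3 + e4 * b4 = 0 \<and>
      e1 * \<mu>1 * b1 + e2 * \<mu>2 * b2 + e3 * \<mu>3 * b3 + e4 * \<mu>4 * b4 = 0})"
  shows "\<kappa> ^ 6 * real \<tau> ^ 2 \<le> 24 * harm n ^ 7 * real (card (op_set f B1 B1))"
proof -
  define U where "U = (\<lambda>b. - (e3 * (\<mu>3 - \<mu>4)) * b) ` B3"
  define V where "V = (\<lambda>b. - (e4 * (\<mu>4 - \<mu>3)) * b) ` B4"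
  define \<alpha> \<beta> \<alpha>' \<beta>' where "\<alpha> = e1 * (\<mu>1 - \<mu>4)" and "\<beta> = e2 * (\<mu>2 - \<mu>4)"
    and "\<alpha>' = e1 * (\<mu>1 - \<mu>3)" and "\<beta>' = e2 * (\<mu>2 - \<mu>3)"
  let ?S = "{(b1, b2, b3, b4). b1 \<in> B1 \<and> b2 \<in> B2 \<and> b3 \<in> B3 \<and> b4 \<in> B4 \<and>
      e1 * b1 + e2 * b2 + e3 * b3 + e4 * b4 = 0 \<and>
      e1 * \<mu>1 * b1 + e2 * \<mu>2 * b2 + e3 * \<mu>3 * b3 + e4 * \<mu>4 * b4 = 0}"
  let ?G = "{(x, y). x \<in> B1 \<and> y \<in> B2 \<and> \<alpha> * x + \<beta> * y \<in> U \<and> \<alpha>' * x + \<beta>' * y \<in> V}"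
  have elim: "\<alpha> * b1 + \<beta> * b2 = - (e3 * (\<mu>3 - \<mu>4)) * b3" "\<alpha>' * b1 + \<beta>' * b2 = - (e4 * (\<mu>4 - \<mu>3)) * b4"
    if "e1 * b1 + e2 * b2 + e3 * b3 + e4 * b4 = 0"
      "e1 * \<mu>1 * b1 + e2 * \<mu>2 * b2 + e3 * \<mu>3 * b3 + e4 * \<mu>4 * b4 = 0" for b1 b2 b3 b4
  proof -
    have "\<alpha> * b1 + \<beta> * b2 + e3 * (\<mu>3 - \<mu>4) * b3 =
        (e1 * \<mu>1 * b1 + e2 * \<mu>2 * b2 + e3 * \<mu>3 * b3 + e4 * \<mu>4 * b4) - \<mu>4 * (e1 * b1 + e2 * b2 + e3 * b3 + e4 * b4)"
      by (simp add: \<alpha>_def \<beta>_def algebra_simps)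
    then show "\<alpha> * b1 + \<beta> * b2 = - (e3 * (\<mu>3 - \<mu>4)) * b3" using that by simp
    have "\<alpha>' * b1 + \<beta>' * b2 + e4 * (\<mu>4 - \<mu>3) * b4 =
        (e1 * \<mu>1 * b1 + e2 * \<mu>2 * b2 + e3 * \<mu>3 * b3 + e4 * \<mu>4 * b4) - \<mu>3 * (e1 * b1 + e2 * b2 + e3 * b3 + e4 * b4)"
      by (simp add: \<alpha>'_def \<beta>'_def algebra_simps)
    then show "\<alpha>' * b1 + \<beta>' * b2 = - (e4 * (\<mu>4 - \<mu>3)) * b4" using that by simp
  qed
  have "card ?S \<le> card ?G"
  proof (rule card_inj_on_le[of "\<lambda>(b1, b2, b3, b4). (b1, b2)"])
    show "inj_on (\<lambda>(b1, b2, b3, b4). (b1, b2)) ?S"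
    proof (rule inj_onI)
      fix u v assume uv: "u \<in> ?S" "v \<in> ?S" "(\<lambda>(b1, b2, b3, b4). (b1, b2)) u = (\<lambda>(b1, b2, b3, b4). (b1, b2)) v"
      obtain b1 b2 b3 b4 where u: "u = (b1, b2, b3, b4)" by (metis surj_pair)
      obtain c3 c4 where v: "v = (b1, b2, c3, c4)" using uv(3) u by (metis (no_types, lifting) case_prod_conv prod.inject surj_pair)
      have "- (e3 * (\<mu>3 - \<mu>4)) * b3 = - (e3 * (\<mu>3 - \<mu>4)) * c3" "- (e4 * (\<mu>4 - \<mu>3)) * b4 = - (e4 * (\<mu>4 - \<mu>3)) * c4"
        using uv elim[of b1 b2 b3 b4] elim[of b1 b2 c3 c4] by (auto simp: u v)
      then show "u = v" using e ne by (simp add: u v)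
    qed
    show "(\<lambda>(b1, b2, b3, b4). (b1, b2)) ` ?S \<subseteq> ?G"
      using elim by (auto simp: U_def V_def simp del: mult_minus_left)
    show "finite ?G" by (rule finite_subset[of _ "B1 \<times> B2"]) (use fin in auto)
  qed
  then have many': "\<kappa> * real \<tau> ^ 2 \<le> real (card ?G)" using many by linarith
  have "\<alpha> * \<beta> * \<alpha>' * \<beta>' = (e1 * e2)\<^sup>2 * ((\<mu>1 - \<mu>3) * (\<mu>2 - \<mu>3) * (\<mu>1 - \<mu>4) * (\<mu>2 - \<mu>4))"
    by (simp add: \<alpha>_def \<beta>_def \<alpha>'_def \<beta>'_def power2_eq_square)
  then have sgn': "\<alpha> * \<beta> * \<alpha>' * \<beta>' < 0" using sgn e by (simp add: mult_pos_neg)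
  show ?thesis
    by (rule two_forms_give_many_products[OF fin(1,2) _ _ pos c(1,2) _ _ \<tau> sgn' \<kappa> f many'])
      (use fin c in \<open>auto simp: U_def V_def intro: card_image_le[THEN order_trans]\<close>)
qed

section \<open>Coincidences of vector sums as linear relations\<close>

definition sum_collisions :: "(real \<Rightarrow> real set) \<Rightarrow> real \<Rightarrow> real \<Rightarrow> real \<Rightarrow> real \<Rightarrow> (real \<times> real \<times> real \<times> real) set" where
  "sum_collisions Q i j k l = {(a, b, c, d). a \<in> Q i \<and> b \<in> Q j \<and> c \<in> Q k \<and> d \<in> Q l \<and>
    a + b = c + d \<and> i * a + j * b = k * c + l * d}"

lemma finite_sum_collisions:
  assumes "finite (Q i)" "finite (Q j)" "finite (Q k)" "finite (Q l)"
  shows "finite (sum_collisions Q i j k l)"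
  by (rule finite_subset[of _ "Q i \<times> Q j \<times> Q k \<times> Q l"]) (use assms in \<open>auto simp: sum_collisions_def\<close>)

lemma card_sum_collisions_swap:
  "card (sum_collisions Q i j k l) = card (sum_collisions Q j i k l)"
  "card (sum_collisions Q i j k l) = card (sum_collisions Q i j l k)"
proof -
  show "card (sum_collisions Q i j k l) = card (sum_collisions Q j i k l)"
  proof (rule bij_betw_same_card[of "\<lambda>(a, b, c, d). (b, a, c, d)"])
    show "bij_betw (\<lambda>(a, b, c, d). (b, a, c, d)) (sum_collisions Q i j k l) (sum_collisions Q j i k l)"
      by (rule bij_betw_byWitness[of _ "\<lambda>(a, b, c, d). (b, a, c, d)"]) (auto simp: sum_collisions_def)
  qed
  show "card (sum_collisions Q i j k l) = card (sum_collisions Q i j l k)"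
  proof (rule bij_betw_same_card[of "\<lambda>(a, b, c, d). (a, b, d, c)"])
    show "bij_betw (\<lambda>(a, b, c, d). (a, b, d, c)) (sum_collisions Q i j k l) (sum_collisions Q i j l k)"
      by (rule bij_betw_byWitness[of _ "\<lambda>(a, b, c, d). (a, b, d, c)"]) (auto simp: sum_collisions_def)
  qed
qed

text \<open>Each product is negative if and only if the two pairs interlace; the product of all three is
  minus a square.\<close>

lemma interlacing_pairing:
  fixes i j k l :: real
  assumes "distinct [i, j, k, l]"
  shows "(i - k) * (j - k) * (i - l) * (j - l) < 0 \<or> (i - j) * (k - j) * (i - l) * (k - l) < 0 \<or>
    (i - j) * (l - j) * (i - k) * (l - k) < 0"
proof (rule ccontr)
  define p q r s t u where "p = i - j" and "q = i - k" and "r = i - l" and "s = j - k"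
    and "t = j - l" and "u = k - l"
  have sw: "k - j = - s" "l - j = - t" "l - k = - u" by (simp_all add: s_def t_def u_def)
  assume "\<not> ?thesis"
  then have nn: "0 \<le> q * s * r * t" "0 \<le> p * - s * r * u" "0 \<le> p * - t * q * - u"
    unfolding sw by (simp_all only: p_def q_def r_def s_def t_def u_def not_less de_Morgan_disj)
  have "0 \<le> (q * s * r * t) * (p * - s * r * u) * (p * - t * q * - u)"
    by (rule mult_nonneg_nonneg[OF mult_nonneg_nonneg[OF nn(1,2)] nn(3)])
  also have "\<dots> = - ((p * q * r * s * t * u)\<^sup>2)" by (simp add: power2_eq_square)
  also have "\<dots> < 0" using assms by (simp add: p_def q_def r_def s_def t_def u_def)
  finally show False by simp
qed

text \<open>Some pairing of the four slopes interlaces. Regrouping the terms accordingly only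
  permutes the coefficients 1 and -1, whose signs do not affect the four-term argument;
  \<open>Q i\<close> is kept in first place, so that it is the set that receives many
  products.\<close>

lemma disjoint_pairs_give_many_products:
  fixes Q :: "real \<Rightarrow> real set" and \<kappa> :: real
  assumes Q: "\<And>\<mu>. \<mu> \<in> {i, j, k, l} \<Longrightarrow> finite (Q \<mu>) \<and> card (Q \<mu>) = \<tau>" and pos: "\<And>x. x \<in> Q i \<Longrightarrow> 0 < x"
    and \<tau>: "0 < \<tau>" "\<tau> \<le> n" and ne: "distinct [i, j, k, l]" and \<kappa>: "0 < \<kappa>" and f: "mult_op f"
    and many: "\<kappa> * real \<tau> ^ 2 \<le> real (card (sum_collisions Q i j k l))"
  shows "\<kappa> ^ 6 * real \<tau> ^ 2 \<le> 24 * harm n ^ 7 * real (card (op_set f (Q i) (Q i)))"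
proof -
  have fin: "finite (Q i)" "finite (Q j)" "finite (Q k)" "finite (Q l)"
    and c: "card (Q i) = \<tau>" "card (Q j) = \<tau>" "card (Q k) = \<tau>" "card (Q l) = \<tau>" using Q by auto
  have fin4: "finite {(b1, b2, b3, b4). b1 \<in> B1 \<and> b2 \<in> B2 \<and> b3 \<in> B3 \<and> b4 \<in> B4 \<and> P b1 b2 b3 b4}"
    if "finite B1" "finite B2" "finite B3" "finite B4" for B1 B2 B3 B4 :: "real set" and P
    by (rule finite_subset[of _ "B1 \<times> B2 \<times> B3 \<times> B4"]) (use that in auto)
  have one: "(1::real) \<noteq> 0" "(- 1::real) \<noteq> 0" by auto
  from interlacing_pairing[OF ne] consider
    "(i - k) * (j - k) * (i - l) * (j - l) < 0" | "(i - j) * (k - j) * (i - l) * (k - l) < 0" |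
    "(i - j) * (l - j) * (i - k) * (l - k) < 0" by blast
  then show ?thesis
  proof cases
    case 1
    let ?S = "{(b1, b2, b3, b4). b1 \<in> Q i \<and> b2 \<in> Q j \<and> b3 \<in> Q k \<and> b4 \<in> Q l \<and>
      1 * b1 + 1 * b2 + (- 1) * b3 + (- 1) * b4 = 0 \<and> 1 * i * b1 + 1 * j * b2 + (- 1) * k * b3 + (- 1) * l * b4 = 0}"
    have "card (sum_collisions Q i j k l) \<le> card ?S"
      by (rule card_mono[OF fin4[OF fin(1,2,3,4)]]) (auto simp: sum_collisions_def)
    then have m: "\<kappa> * real \<tau> ^ 2 \<le> real (card ?S)" using many by linarith
    show ?thesis
      by (rule four_term_relation_gives_many_products[OF fin pos c \<tau> one(1,1,2,2) _ 1 \<kappa> f m])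
        (use ne in auto)
  next
    case 2
    let ?S = "{(b1, b2, b3, b4). b1 \<in> Q i \<and> b2 \<in> Q k \<and> b3 \<in> Q j \<and> b4 \<in> Q l \<and>
      1 * b1 + (- 1) * b2 + 1 * b3 + (- 1) * b4 = 0 \<and> 1 * i * b1 + (- 1) * k * b2 + 1 * j * b3 + (- 1) * l * b4 = 0}"
    have "card (sum_collisions Q i j k l) \<le> card ?S"
      by (rule card_inj_on_le[of "\<lambda>(a, b, c, d). (a, c, b, d)", OF _ _ fin4[OF fin(1,3,2,4)]])
        (auto simp: sum_collisions_def inj_on_def)
    then have m: "\<kappa> * real \<tau> ^ 2 \<le> real (card ?S)" using many by linarith
    show ?thesis
      by (rule four_term_relation_gives_many_products[OF fin(1,3,2,4) pos c(1,3,2,4) \<tau> one(1,2,1,2) _ 2 \<kappa> f m])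
        (use ne in auto)
  next
    case 3
    let ?S = "{(b1, b2, b3, b4). b1 \<in> Q i \<and> b2 \<in> Q l \<and> b3 \<in> Q j \<and> b4 \<in> Q k \<and>
      1 * b1 + (- 1) * b2 + 1 * b3 + (- 1) * b4 = 0 \<and> 1 * i * b1 + (- 1) * l * b2 + 1 * j * b3 + (- 1) * k * b4 = 0}"
    have "card (sum_collisions Q i j k l) \<le> card ?S"
      by (rule card_inj_on_le[of "\<lambda>(a, b, c, d). (a, d, b, c)", OF _ _ fin4[OF fin(1,4,2,3)]])
        (auto simp: sum_collisions_def inj_on_def)
    then have m: "\<kappa> * real \<tau> ^ 2 \<le> real (card ?S)" using many by linarith
    show ?thesis
      by (rule four_term_relation_gives_many_products[OF fin(1,4,2,3) pos c(1,4,2,3) \<tau> one(1,2,1,2) _ 3 \<kappa> f m])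
        (use ne in auto)
  qed
qed

text \<open>With ray \<open>i\<close> on both sides no pairing interlaces, so the four-term argument
  fails. Instead, eliminating \<open>b\<close> gives a = c + (1 - \<eta>) d with \<open>a\<close>
  and \<open>c\<close> in the same set \<open>Q i\<close>: an additive relation within one
  ray.\<close>

lemma overlapping_pairs_give_many_products:
  fixes Q :: "real \<Rightarrow> real set" and \<kappa> :: real
  assumes finA: "finite A" and posA: "\<And>a. a \<in> A \<Longrightarrow> 0 < a" and QA: "Q i \<subseteq> A"
    and Q: "\<And>\<mu>. \<mu> \<in> {i, j, l} \<Longrightarrow> finite (Q \<mu>) \<and> card (Q \<mu>) = \<tau>"
    and \<tau>: "0 < \<tau>" and ne: "distinct [i, j, l]" and \<kappa>: "0 < \<kappa>" and f: "mult_op f"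
    and many: "\<kappa> * real \<tau> ^ 2 \<le> real (card (sum_collisions Q i j i l))"
  shows "\<kappa> ^ 10 * real \<tau> * real (card A) ^ 2
    \<le> 2 ^ 27 * harm (card A) * real (card (A + A)) * real (card (op_set f (Q i) A))"
proof -
  define \<eta> where "\<eta> = (l - i) / (j - i)"
  have \<eta>1: "1 - \<eta> \<noteq> 0" using ne by (simp add: \<eta>_def field_simps)
  define W where "W = (\<lambda>d. (1 - \<eta>) * d) ` Q l"
  have W: "finite W" "card W = \<tau>"
    using Q[of l] \<eta>1 by (auto simp: W_def card_image inj_on_def)
  have rel: "b = \<eta> * d" "a = c + (1 - \<eta>) * d" if "a + b = c + d" "i * a + j * b = i * c + l * d" for a b c d
  proof -
    have "(j - i) * b - (l - i) * d = (i * a + j * b - (i * c + l * d)) - i * (a + b - (c + d))"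
      by (simp add: algebra_simps)
    then have "(j - i) * b = (l - i) * d" using that by simp
    then show "b = \<eta> * d" using ne by (simp add: \<eta>_def field_simps)
    then show "a = c + (1 - \<eta>) * d" using that(1) by (simp add: algebra_simps)
  qed
  have "card (sum_collisions Q i j i l) \<le> card {(y, w). y \<in> Q i \<and> w \<in> W \<and> y + w \<in> Q i}"
  proof (rule card_inj_on_le[of "\<lambda>(a, b, c, d). (c, (1 - \<eta>) * d)"])
    show "inj_on (\<lambda>(a, b, c, d). (c, (1 - \<eta>) * d)) (sum_collisions Q i j i l)"
    proof (rule inj_onI)
      fix u v assume uv: "u \<in> sum_collisions Q i j i l" "v \<in> sum_collisions Q i j i l"
        "(\<lambda>(a, b, c, d). (c, (1 - \<eta>) * d)) u = (\<lambda>(a, b, c, d). (c, (1 - \<eta>) * d)) v"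
      obtain a b c d where u: "u = (a, b, c, d)" by (metis surj_pair)
      obtain a' b' c' d' where v: "v = (a', b', c', d')" by (metis surj_pair)
      have "c = c'" "d = d'" using uv(3) \<eta>1 by (auto simp: u v)
      moreover have "b = \<eta> * d" "a = c + (1 - \<eta>) * d" "b' = \<eta> * d'" "a' = c' + (1 - \<eta>) * d'"
        using uv(1,2) rel[of a b c d] rel[of a' b' c' d'] by (auto simp: u v sum_collisions_def)
      ultimately show "u = v" by (simp add: u v)
    qed
    show "(\<lambda>(a, b, c, d). (c, (1 - \<eta>) * d)) ` sum_collisions Q i j i l \<subseteq> {(y, w). y \<in> Q i \<and> w \<in> W \<and> y + w \<in> Q i}"
    proof clarify
      fix a b c d assume "(a, b, c, d) \<in> sum_collisions Q i j i l"
      then show "c \<in> Q i \<and> (1 - \<eta>) * d \<in> W \<and> c + (1 - \<eta>) * d \<in> Q i"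
        using rel(2)[of a b c d] by (auto simp: sum_collisions_def W_def)
    qed
    show "finite {(y, w). y \<in> Q i \<and> w \<in> W \<and> y + w \<in> Q i}"
      by (rule finite_subset[of _ "Q i \<times> W"]) (use Q W in auto)
  qed
  then have "\<kappa> * real \<tau> ^ 2 \<le> real (card {(y, w). y \<in> Q i \<and> w \<in> W \<and> y + w \<in> Q i})"
    using many by linarith
  then show ?thesis
    using shared_ray_gives_many_products[OF finA posA QA _ W \<kappa> \<tau> f] Q by auto
qed

section \<open>Blocks of rays\<close>

definition vec_sum :: "real \<times> real \<times> real \<times> real \<Rightarrow> real \<times> real" where
  "vec_sum = (\<lambda>(i, j, a, b). (a + b, i * a + j * b))"

definition ray_pairs :: "(real \<Rightarrow> real set) \<Rightarrow> real set \<Rightarrow> (real \<times> real \<times> real \<times> real) set" where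
  "ray_pairs Q I = {(i, j, a, b). i \<in> I \<and> j \<in> I \<and> i < j \<and> a \<in> Q i \<and> b \<in> Q j}"

text \<open>The thresholds are balanced. A pair of rays coincides with itself at most \<tau>^2
  times, with each of at most 4 m pairs sharing a ray at most \<tau>^2 / m times, and with each of
  at most m^2 others at most \<tau>^2 / m^2 times: 6 \<tau>^2 in all. Cauchy--Schwarz over at least
  m^2 / 4 pairs then gives 24 = 6 * 4.\<close>

lemma block_vec_sums_lower:
  fixes Q :: "real \<Rightarrow> real set"
  assumes finI: "finite I" and m: "card I = m" "2 \<le> m"
    and Q: "\<And>\<mu>. \<mu> \<in> I \<Longrightarrow> finite (Q \<mu>) \<and> card (Q \<mu>) = \<tau>" and \<tau>: "0 < \<tau>"
    and disj: "\<And>i j k l. {i, j, k, l} \<subseteq> I \<Longrightarrow> distinct [i, j, k, l] \<Longrightarrow>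
      real (card (sum_collisions Q i j k l)) \<le> real \<tau> ^ 2 / real m ^ 2"
    and over: "\<And>i j l. {i, j, l} \<subseteq> I \<Longrightarrow> distinct [i, j, l] \<Longrightarrow>
      real (card (sum_collisions Q i j i l)) \<le> real \<tau> ^ 2 / real m"
  shows "real m ^ 2 * real \<tau> ^ 2 \<le> 24 * real (card (vec_sum ` ray_pairs Q I))"
proof -
  define P where "P = {p \<in> I \<times> I. fst p < snd p}"
  define c where "c p q = real (card (sum_collisions Q (fst p) (snd p) (fst q) (snd q)))" for p q
  define Sh where "Sh p = ({fst p} \<times> I \<union> I \<times> {fst p}) \<union> ({snd p} \<times> I \<union> I \<times> {snd p})" for p
  define T where "T = real \<tau> ^ 2"
  have finP: "finite P" using finI by (simp add: P_def)
  have finQ: "finite (Q \<mu>)" and cQ: "card (Q \<mu>) = \<tau>" if "\<mu> \<in> I" for \<mu> using Q[OF that] by auto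
  have m0: "0 < real m" and T0: "0 < T" using m \<tau> by (auto simp: T_def)
  have PI: "fst p \<in> I" "snd p \<in> I" "fst p < snd p" if "p \<in> P" for p using that by (auto simp: P_def)
  have finS: "finite (sum_collisions Q (fst p) (snd p) (fst q) (snd q))" if "p \<in> P" "q \<in> P" for p q
    using PI[OF that(1)] PI[OF that(2)] by (intro finite_sum_collisions finQ)
  have rp: "ray_pairs Q I = (\<lambda>(p, u). (fst p, snd p, fst u, snd u)) ` (SIGMA p:P. Q (fst p) \<times> Q (snd p))"
    by (force simp: ray_pairs_def P_def image_iff)
  have "inj_on (\<lambda>(p, u). (fst p, snd p, fst u, snd u)) (SIGMA p:P. Q (fst p) \<times> Q (snd p))"
    by (auto simp: inj_on_def)
  then have "card (ray_pairs Q I) = card (SIGMA p:P. Q (fst p) \<times> Q (snd p))" unfolding rp by (rule card_image)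
  also have "\<dots> = (\<Sum>p\<in>P. card (Q (fst p) \<times> Q (snd p)))"
    using finP PI finQ by (intro card_SigmaI) auto
  also have "\<dots> = (\<Sum>p\<in>P. \<tau> * \<tau>)"
    using PI cQ by (intro sum.cong refl) (simp add: card_cartesian_product)
  finally have cT: "real (card (ray_pairs Q I)) = real (card P) * T" by (simp add: T_def power2_eq_square)
  have finT: "finite (ray_pairs Q I)"
    unfolding rp using finP PI finQ by (intro finite_imageI finite_SigmaI finite_cartesian_product) auto
  have same: "c p p \<le> T" if p: "p \<in> P" for p
  proof -
    have "card (sum_collisions Q (fst p) (snd p) (fst p) (snd p)) \<le> card (Q (fst p) \<times> Q (snd p))"
    proof (rule card_inj_on_le[of "\<lambda>(a, b, c, d). (a, b)"])
      show "inj_on (\<lambda>(a, b, c, d). (a, b)) (sum_collisions Q (fst p) (snd p) (fst p) (snd p))"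
      proof (rule inj_onI)
        fix u v assume uv: "u \<in> sum_collisions Q (fst p) (snd p) (fst p) (snd p)"
          "v \<in> sum_collisions Q (fst p) (snd p) (fst p) (snd p)"
          "(\<lambda>(a, b, c, d). (a, b)) u = (\<lambda>(a, b, c, d). (a, b)) v"
        obtain a b x y where u: "u = (a, b, x, y)" by (metis surj_pair)
        obtain a' b' x' y' where v: "v = (a', b', x', y')" by (metis surj_pair)
        have ab: "a' = a" "b' = b" using uv(3) by (auto simp: u v)
        have e: "x + 1 * y = x' + 1 * y'" "fst p * x + 1 * (snd p * y) = fst p * x' + 1 * (snd p * y')"
          using uv(1,2) by (auto simp: u v ab sum_collisions_def)
        have "fst p \<noteq> snd p" using PI[OF p] by simp
        from sum_on_rays_determines_points[OF this _ e] show "u = v" by (simp add: u v ab)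
      qed
    qed (use finQ PI[OF p] in \<open>auto simp: sum_collisions_def\<close>)
    then show ?thesis
      using cQ PI[OF p] by (simp add: c_def T_def card_cartesian_product power2_eq_square flip: of_nat_mult)
  qed
  have shared: "c p q \<le> T / real m" if p: "p \<in> P" and q: "q \<in> P" and ne: "p \<noteq> q" and s: "q \<in> Sh p" for p q
  proof -
    obtain i j where pp: "p = (i, j)" by fastforce
    obtain k l where qq: "q = (k, l)" by fastforce
    have ij: "i \<in> I" "j \<in> I" "i < j" "k \<in> I" "l \<in> I" "k < l" using PI[OF p] PI[OF q] by (auto simp: pp qq)
    have "k = i \<or> l = i \<or> k = j \<or> l = j" using s by (auto simp: Sh_def pp qq)
    \<comment> \<open>The shared slope can be first or second in either pair; swapping within a pair
      brings it to the front.\<close>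
    then consider "k = i" "l \<noteq> j" | "l = i" | "k = j" | "l = j" "k \<noteq> i" using ne by (auto simp: pp qq)
    then show ?thesis
    proof cases
      case 1
      then show ?thesis using over[of i j l] ij by (simp add: c_def pp qq T_def)
    next
      case 2
      then show ?thesis using over[of i j k] ij card_sum_collisions_swap(2)[of Q i j k i]
        by (simp add: c_def pp qq T_def)
    next
      case 3
      then show ?thesis using over[of j i l] ij card_sum_collisions_swap(1)[of Q i j j l]
        by (simp add: c_def pp qq T_def)
    next
      case 4
      then show ?thesis using over[of j i k] ij card_sum_collisions_swap(1)[of Q i j k j]
          card_sum_collisions_swap(2)[of Q j i k j]
        by (simp add: c_def pp qq T_def)
    qed
  qed
  have other: "c p q \<le> T / real m ^ 2" if p: "p \<in> P" and q: "q \<in> P" and s: "q \<notin> Sh p" for p q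
    using disj[of "fst p" "snd p" "fst q" "snd q"] PI[OF p] PI[OF q] s
    by (cases p, cases q) (auto simp: c_def T_def Sh_def)
  have cSh: "real (card (P \<inter> Sh p)) \<le> 4 * real m" for p
  proof -
    have finSh: "finite (Sh p)" using finI by (simp add: Sh_def)
    have half: "card ({x} \<times> I \<union> I \<times> {x}) \<le> 2 * m" for x
      using card_Un_le[of "{x} \<times> I" "I \<times> {x}"] m by (simp add: card_cartesian_product)
    have "card (P \<inter> Sh p) \<le> card (Sh p)" using finSh by (intro card_mono) auto
    also have "\<dots> \<le> 2 * m + 2 * m"
      unfolding Sh_def using card_Un_le half by (meson add_mono order_trans)
    finally show ?thesis by simp
  qed
  have "P \<subseteq> I \<times> I" by (auto simp: P_def)
  then have "card P \<le> card (I \<times> I)" using finI by (intro card_mono) auto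
  then have cP: "real (card P) \<le> real m ^ 2"
    using m by (simp add: card_cartesian_product power2_eq_square flip: of_nat_mult)
  have row: "(\<Sum>q\<in>P. c p q) \<le> 6 * T" if p: "p \<in> P" for p
  proof -
    have bound: "c p q \<le> (if q = p then T else 0) + ((if q \<in> Sh p then T / real m else 0) + T / real m ^ 2)"
      if q: "q \<in> P" for q
    proof -
      have nn: "0 \<le> T / real m" "0 \<le> T / real m ^ 2" using T0 by auto
      consider "q = p" | "q \<noteq> p" "q \<in> Sh p" | "q \<noteq> p" "q \<notin> Sh p" by blast
      then show ?thesis
      proof cases
        case 1
        then show ?thesis using same[OF p] nn by (auto simp: algebra_simps)
      next
        case 2
        then show ?thesis using shared[OF p q] nn by auto
      next
        case 3
        then show ?thesis using other[OF p q] by auto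
      qed
    qed
    have "(\<Sum>q\<in>P. c p q) \<le> (\<Sum>q\<in>P. (if q = p then T else 0) + ((if q \<in> Sh p then T / real m else 0) + T / real m ^ 2))"
      by (rule sum_mono) (rule bound)
    also have "\<dots> = (\<Sum>q\<in>P. if q = p then T else 0) + ((\<Sum>q\<in>P. if q \<in> Sh p then T / real m else 0) + real (card P) * (T / real m ^ 2))"
      by (simp add: sum.distrib)
    also have "(\<Sum>q\<in>P. if q = p then T else 0) = T" using finP p by simp
    also have "(\<Sum>q\<in>P. if q \<in> Sh p then T / real m else 0) = real (card (P \<inter> Sh p)) * (T / real m)"
      using finP by (simp flip: sum.inter_restrict)
    also have "real (card (P \<inter> Sh p)) * (T / real m) \<le> 4 * real m * (T / real m)"
      using cSh T0 by (intro mult_right_mono) auto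
    also have "real (card P) * (T / real m ^ 2) \<le> real m ^ 2 * (T / real m ^ 2)"
      using cP T0 by (intro mult_right_mono) auto
    finally show ?thesis using m0 by simp
  qed
  have "card (collisions vec_sum (ray_pairs Q I)) \<le>
      card (SIGMA pq:P \<times> P. sum_collisions Q (fst (fst pq)) (snd (fst pq)) (fst (snd pq)) (snd (snd pq)))"
  proof (rule card_inj_on_le[of "\<lambda>((i, j, a, b), (k, l, c, d)). (((i, j), (k, l)), (a, b, c, d))"])
    show "finite (SIGMA pq:P \<times> P. sum_collisions Q (fst (fst pq)) (snd (fst pq)) (fst (snd pq)) (snd (snd pq)))"
      using finP finS by (intro finite_SigmaI) auto
  qed (auto simp: inj_on_def collisions_def ray_pairs_def vec_sum_def P_def sum_collisions_def)
  also have "\<dots> = (\<Sum>pq\<in>P \<times> P. card (sum_collisions Q (fst (fst pq)) (snd (fst pq)) (fst (snd pq)) (snd (snd pq))))"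
    using finP finS by (intro card_SigmaI) auto
  finally have "real (card (collisions vec_sum (ray_pairs Q I))) \<le> (\<Sum>pq\<in>P \<times> P. c (fst pq) (snd pq))"
    unfolding c_def by (simp only: of_nat_le_iff flip: of_nat_sum)
  also have "\<dots> = (\<Sum>p\<in>P. \<Sum>q\<in>P. c p q)" by (simp add: sum.cartesian_product case_prod_beta)
  also have "\<dots> \<le> (\<Sum>p\<in>P. 6 * T)" by (rule sum_mono) (rule row)
  finally have coll: "real (card (collisions vec_sum (ray_pairs Q I))) \<le> real (card P) * (6 * T)" by simp
  let ?V = "real (card (vec_sum ` ray_pairs Q I))"
  have "(real (card P) * T)\<^sup>2 \<le> ?V * real (card (collisions vec_sum (ray_pairs Q I)))"
    using card_square_le_image_collisions[OF finT subset_refl, of vec_sum] finT cT by simp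
  also have "\<dots> \<le> ?V * (real (card P) * (6 * T))" using coll by (intro mult_left_mono) auto
  finally have V1: "(real (card P) * T) * (real (card P) * T) \<le> (6 * ?V) * (real (card P) * T)"
    by (simp add: power2_eq_square mult_ac)
  \<comment> \<open>For m \<ge> 2 the diagonal is at most half of I \<times> I, so the increasing
    pairs make up at least a quarter.\<close>
  have "I \<times> I \<subseteq> P \<union> (prod.swap ` P \<union> (\<lambda>i. (i, i)) ` I)"
    by (force simp: P_def image_iff)
  then have "card (I \<times> I) \<le> card (P \<union> (prod.swap ` P \<union> (\<lambda>i. (i, i)) ` I))"
    using finI finP by (intro card_mono) auto
  also have "\<dots> \<le> card P + (card P + card I)"
    using finP finI by (meson add_mono card_Un_le card_image_le le_refl order_trans)
  finally have "m * m \<le> 2 * card P + m" using m by (simp add: card_cartesian_product)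
  moreover have "2 * m \<le> m * m" using m by simp
  ultimately have "m * m \<le> 4 * card P" by linarith
  then have mP: "real m ^ 2 \<le> 4 * real (card P)"
    by (metis of_nat_le_iff of_nat_mult of_nat_numeral power2_eq_square)
  then have "0 < real (card P)" using m0 by (smt (verit) zero_less_power)
  then have "real (card P) * T \<le> 6 * ?V" using V1 T0 by (simp add: mult_le_cancel_right)
  moreover have "real m ^ 2 * T \<le> 4 * real (card P) * T" using mP T0 by (intro mult_right_mono) auto
  ultimately show ?thesis by (simp add: T_def)
qed

text \<open>The refinement of Solymosi's argument due to Konyagin and Shkredov: if vector sums from
  different pairs of rays rarely coincide, a block of \<open>m\<close> rays yields \<open>m\<close> times as many sums.\<close>

lemma block_sumset_bound:
  fixes A S :: "real set" and Q :: "real \<Rightarrow> real set"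
  assumes fin: "finite A" "finite S" and posA: "\<And>a. a \<in> A \<Longrightarrow> 0 < a" and m: "2 \<le> m" and \<tau>: "0 < \<tau>"
    and Q: "\<And>\<mu>. \<mu> \<in> S \<Longrightarrow> Q \<mu> \<subseteq> ray A A \<mu> \<and> card (Q \<mu>) = \<tau>"
    and disj: "\<And>i j k l. {i, j, k, l} \<subseteq> S \<Longrightarrow> distinct [i, j, k, l] \<Longrightarrow>
      real (card (sum_collisions Q i j k l)) \<le> real \<tau> ^ 2 / real m ^ 2"
    and over: "\<And>i j l. {i, j, l} \<subseteq> S \<Longrightarrow> distinct [i, j, l] \<Longrightarrow>
      real (card (sum_collisions Q i j i l)) \<le> real \<tau> ^ 2 / real m"
  shows "real (card S div m) * (real m ^ 2 * real \<tau> ^ 2) \<le> 24 * real (card (A + A)) ^ 2"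
proof -
  have m0: "0 < m" using m by simp
  obtain \<C> where C: "finite \<C>" "card \<C> = card S div m" "\<And>I. I \<in> \<C> \<Longrightarrow> I \<subseteq> S \<and> card I = m"
    "\<forall>I\<in>\<C>. \<forall>J\<in>\<C>. I \<noteq> J \<longrightarrow> separated I J"
    using separated_blocks_exist[OF fin(2) m0] by auto
  let ?F = "\<lambda>I. vec_sum ` ray_pairs Q I"
  have finQ: "finite (Q \<mu>)" if "\<mu> \<in> S" for \<mu> using Q[OF that] fin(1) finite_subset by (metis finite_ray)
  have sub: "?F I \<subseteq> (A + A) \<times> (A + A)" if I: "I \<in> \<C>" for I
  proof -
    have "a \<in> A \<and> \<mu> * a \<in> A" if "\<mu> \<in> I" "a \<in> Q \<mu>" for \<mu> a
      using Q[of \<mu>] C(3)[OF I] that by (auto simp: ray_def)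
    then show ?thesis by (fastforce simp: vec_sum_def ray_pairs_def set_plus_def)
  qed
  have finAA: "finite ((A + A) \<times> (A + A))" using fin by (simp add: finite_set_plus)
  have finF: "finite (?F I)" if "I \<in> \<C>" for I using sub[OF that] finAA finite_subset by auto
  have low: "real m ^ 2 * real \<tau> ^ 2 \<le> 24 * real (card (?F I))" if I: "I \<in> \<C>" for I
  proof (rule block_vec_sums_lower)
    show "finite I" using C(3)[OF I] fin finite_subset by auto
    show "card I = m" using C(3)[OF I] by simp
    show "finite (Q \<mu>) \<and> card (Q \<mu>) = \<tau>" if "\<mu> \<in> I" for \<mu>
      using that C(3)[OF I] Q finQ by auto
    show "real (card (sum_collisions Q i j k l)) \<le> real \<tau> ^ 2 / real m ^ 2"
      if "{i, j, k, l} \<subseteq> I" "distinct [i, j, k, l]" for i j k l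
      using that C(3)[OF I] by (intro disj) auto
    show "real (card (sum_collisions Q i j i l)) \<le> real \<tau> ^ 2 / real m"
      if "{i, j, l} \<subseteq> I" "distinct [i, j, l]" for i j l
      using that C(3)[OF I] by (intro over) auto
  qed (use m \<tau> in auto)
  have dis: "?F I \<inter> ?F J = {}" if IJ: "I \<in> \<C>" "J \<in> \<C>" "I \<noteq> J" for I J
  proof (rule ccontr)
    assume "?F I \<inter> ?F J \<noteq> {}"
    then obtain i j a b k l c d where u: "(i, j, a, b) \<in> ray_pairs Q I" "(k, l, c, d) \<in> ray_pairs Q J"
      and e: "a + b = c + d" "i * a + j * b = k * c + l * d"
      by (auto simp: vec_sum_def)
    have mem: "i \<in> I" "j \<in> I" "i < j" "k \<in> J" "l \<in> J" "k < l" "a \<in> Q i" "b \<in> Q j" "c \<in> Q k" "d \<in> Q l"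
      using u by (auto simp: ray_pairs_def)
    have ps: "0 < x" if "x \<in> Q \<mu>" "\<mu> \<in> I \<union> J" for x \<mu>
      using that Q[of \<mu>] C(3)[OF IJ(1)] C(3)[OF IJ(2)] posA by (auto simp: ray_def)
    have p4: "0 < a" "0 < b" "0 < c" "0 < d" using ps mem by auto
    have "I = J"
    proof (rule separated_sectors_disjoint[OF C(4) IJ(1,2) mem(1,2) _ _ mem(4,5)])
      show "min i j < (i * a + j * b) / (a + b)" "(i * a + j * b) / (a + b) < max i j"
        using slope_of_sum_between[OF p4(1,2), of i j] mem by auto
      show "min k l < (i * a + j * b) / (a + b)" "(i * a + j * b) / (a + b) < max k l"
        unfolding e using slope_of_sum_between[OF p4(3,4), of k l] mem by auto
    qed
    then show False using IJ(3) by simp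
  qed
  have "card (\<Union>I\<in>\<C>. ?F I) = (\<Sum>I\<in>\<C>. card (?F I))"
    using C(1) finF dis by (intro card_UN_disjoint) auto
  moreover have "card (\<Union>I\<in>\<C>. ?F I) \<le> card ((A + A) \<times> (A + A))"
    using sub finAA by (intro card_mono) auto
  ultimately have "(\<Sum>I\<in>\<C>. card (?F I)) \<le> card (A + A) * card (A + A)"
    by (simp add: card_cartesian_product)
  then have "(\<Sum>I\<in>\<C>. real (card (?F I))) \<le> real (card (A + A)) ^ 2"
    by (simp add: power2_eq_square flip: of_nat_sum of_nat_mult)
  moreover have "(\<Sum>I\<in>\<C>. real m ^ 2 * real \<tau> ^ 2) \<le> (\<Sum>I\<in>\<C>. 24 * real (card (?F I)))"
    by (rule sum_mono) (rule low)
  ultimately show ?thesis using C(2) by (simp flip: sum_distrib_left)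
qed

section \<open>The sum-product estimate\<close>

text \<open>Each \<open>y\<close> in \<open>Y a\<close> factors a = (b / y) (a y / b), with second
  factor in \<open>R\<close> and first in a set of at most |R| elements. A difference d = a -
  \<beta> with \<open>t\<close> representations thus gives t \<rho> incidences c x = d + \<beta>. If
  \<rho> is comparable to |R|, the constant is comparable to |R| as well.\<close>

lemma szemeredi_trotter_const_of_products:
  fixes A R :: "real set" and b \<rho> :: real
  assumes fin: "finite A" "finite R" and pos: "\<And>y. y \<in> R \<Longrightarrow> 0 < y" "0 < b" "0 < \<rho>"
    and rep: "\<And>a. a \<in> A \<Longrightarrow> Y a \<subseteq> R \<and> \<rho> \<le> real (card (Y a)) \<and> (\<forall>y\<in>Y a. a / b * y \<in> R)"
  shows "szemeredi_trotter_const A (512 * real (card R) ^ 4 / \<rho> ^ 3)"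
  unfolding szemeredi_trotter_const_def
proof (intro allI impI, elim conjE)
  fix B :: "real set" and t :: nat
  assume finB: "finite B" and t: "1 \<le> t"
  define D where "D = {d \<in> diff ` (A \<times> B). t \<le> diff_rep A B d}"
  define C where "C = (\<lambda>y. b / y) ` R"
  have finD: "finite D" and finC: "finite C" using fin finB by (auto simp: D_def C_def)
  have finY: "finite (Y a)" if "a \<in> A" for a using rep[OF that] fin finite_subset by auto
  have rich: "real t * \<rho> \<le> real (card {(x, \<beta>, c). x \<in> R \<and> \<beta> \<in> B \<and> c \<in> C \<and> c * x = d + \<beta>})" if d: "d \<in> D" for d
  proof -
    let ?U = "{u \<in> A \<times> B. diff u = d}"
    let ?W = "{(x, \<beta>, c). x \<in> R \<and> \<beta> \<in> B \<and> c \<in> C \<and> c * x = d + \<beta>}"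
    have finU: "finite ?U" using fin finB by simp
    have "card (SIGMA u:?U. Y (fst u)) \<le> card ?W"
    proof (rule card_inj_on_le[of "\<lambda>(u, y). (fst u / b * y, snd u, b / y)"])
      show "inj_on (\<lambda>(u, y). (fst u / b * y, snd u, b / y)) (SIGMA u:?U. Y (fst u))"
      proof (rule inj_onI)
        fix v w assume vw: "v \<in> (SIGMA u:?U. Y (fst u))" "w \<in> (SIGMA u:?U. Y (fst u))"
          "(\<lambda>(u, y). (fst u / b * y, snd u, b / y)) v = (\<lambda>(u, y). (fst u / b * y, snd u, b / y)) w"
        obtain a \<beta> y where v: "v = ((a, \<beta>), y)" by (metis surj_pair)
        obtain a' \<beta>' y' where w: "w = ((a', \<beta>'), y')" by (metis surj_pair)
        have mem: "a \<in> A" "a' \<in> A" "y \<in> Y a" "y' \<in> Y a'" using vw by (auto simp: v w)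
        have ys: "0 < y" "0 < y'" using mem rep pos(1) by blast+
        have "b / y = b / y'" "\<beta> = \<beta>'" using vw(3) by (auto simp: v w)
        then have "y = y'" using ys pos(2) by (simp add: frac_eq_eq)
        moreover have "a = a'" using vw \<open>\<beta> = \<beta>'\<close> by (auto simp: v w diff_def)
        ultimately show "v = w" using \<open>\<beta> = \<beta>'\<close> by (simp add: v w)
      qed
      show "(\<lambda>(u, y). (fst u / b * y, snd u, b / y)) ` (SIGMA u:?U. Y (fst u)) \<subseteq> ?W"
      proof clarify
        fix a \<beta> y assume h: "a \<in> A" "\<beta> \<in> B" "y \<in> Y (fst (a, \<beta>))" "d = diff (a, \<beta>)"
        have y: "y \<in> R" "a / b * y \<in> R" using rep[OF h(1)] h(3) by auto
        have "b / y * (a / b * y) = a" using pos(1)[OF y(1)] pos(2) by simp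
        then show "fst (a, \<beta>) / b * y \<in> R \<and> snd (a, \<beta>) \<in> B \<and> b / y \<in> C \<and>
            b / y * (fst (a, \<beta>) / b * y) = diff (a, \<beta>) + snd (a, \<beta>)"
          using y h by (auto simp: C_def diff_def)
      qed
      show "finite ?W" by (rule finite_subset[of _ "R \<times> B \<times> C"]) (use fin finB finC in auto)
    qed
    moreover have "card (SIGMA u:?U. Y (fst u)) = (\<Sum>u\<in>?U. card (Y (fst u)))"
      using finU finY by (intro card_SigmaI) auto
    ultimately have "(\<Sum>u\<in>?U. real (card (Y (fst u)))) \<le> real (card ?W)" by (simp flip: of_nat_sum)
    moreover have "(\<Sum>u\<in>?U. \<rho>) \<le> (\<Sum>u\<in>?U. real (card (Y (fst u))))"
      using rep by (intro sum_mono) auto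
    moreover have "real t * \<rho> \<le> real (card ?U) * \<rho>"
      using d pos(3) by (intro mult_right_mono) (auto simp: D_def diff_rep_def)
    ultimately show ?thesis by simp
  qed
  have Cpos: "0 < c" if "c \<in> C" for c using that pos by (auto simp: C_def)
  have CP: "card C \<le> card R" using fin by (simp add: C_def card_image_le)
  have "real (card D) * (real t * \<rho>) ^ 3 \<le> 512 * (real (card B) * real (card C) * real (card R))\<^sup>2"
    using pos(3) by (intro rich_abscissae_bound[OF finD fin(2) finB finC Cpos CP _ rich]) auto
  also have "\<dots> \<le> 512 * (real (card B) * real (card R) * real (card R))\<^sup>2"
    using CP by (intro mult_left_mono power_mono mult_right_mono) auto
  also have "\<dots> = 512 * real (card R) ^ 4 * (real (card B))\<^sup>2" by algebra
  finally have "real (card D) * (real t * \<rho>) ^ 3 \<le> 512 * real (card R) ^ 4 * (real (card B))\<^sup>2" .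
  then show "real t ^ 3 * real (card {d \<in> diff ` (A \<times> B). t \<le> diff_rep A B d})
      \<le> 512 * real (card R) ^ 4 / \<rho> ^ 3 * (real (card B))\<^sup>2"
    using pos(3) by (simp add: D_def field_simps)
qed

text \<open>Up to constants and \<open>h\<close>, inserting 5 into 2 and using 1 gives n^57 T^11
  \<le> p^39 M^180 s^9. Removing \<open>T\<close> by 3 leaves n^79 \<le> p^50 s^9 M^180, of exponent
  79/59 > 4/3 if \<open>M\<close> were bounded; removing \<open>M\<close> by 4 leaves
  799/599.\<close>

lemma final_estimate_disjoint:
  fixes n s p h T M a \<rho> K :: real
  assumes pos: "0 < n" "0 < s" "0 < p" "0 < h" "0 < T" "0 < M" "0 < a" "0 < \<rho>" "0 < K"
    and 1: "n ^ 3 \<le> 4 * h * p * T * a" and 2: "a ^ 19 * \<rho> ^ 15 \<le> K * h ^ 9 * p ^ 20 * s ^ 9"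
    and 3: "n ^ 2 \<le> 2 * h * p * T" and 4: "M * n ^ 4 \<le> 200 * h * p * s ^ 2"
    and 5: "T ^ 2 = 24 * h ^ 7 * M ^ 12 * \<rho>"
  shows "n ^ 799 \<le> (4 ^ 19 * 24 ^ 15 * 2 ^ 11 * 200 ^ 180 * K) * h ^ 324 * p ^ 230 * s ^ 369"
proof -
  have "n ^ 57 * T ^ 11 * T ^ 19 = (n ^ 3) ^ 19 * (T ^ 2) ^ 15" by algebra
  also have "\<dots> \<le> (4 * h * p * T * a) ^ 19 * (T ^ 2) ^ 15"
    using pos by (intro mult_right_mono power_mono[OF 1]) auto
  also have "\<dots> = (4 * h * p * T) ^ 19 * (24 * h ^ 7 * M ^ 12) ^ 15 * (a ^ 19 * \<rho> ^ 15)"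
    unfolding 5 by algebra
  also have "\<dots> \<le> (4 * h * p * T) ^ 19 * (24 * h ^ 7 * M ^ 12) ^ 15 * (K * h ^ 9 * p ^ 20 * s ^ 9)"
    using pos by (intro mult_left_mono[OF 2]) auto
  also have "\<dots> = (4 ^ 19 * 24 ^ 15 * K * h ^ 133 * p ^ 39 * M ^ 180 * s ^ 9) * T ^ 19" by algebra
  finally have 6: "n ^ 57 * T ^ 11 \<le> 4 ^ 19 * 24 ^ 15 * K * h ^ 133 * p ^ 39 * M ^ 180 * s ^ 9"
    by (rule mult_right_le_imp_le) (use pos in simp)
  have "n ^ 799 = (n ^ 2) ^ 11 * (n ^ 57 * (n ^ 4) ^ 180)" by algebra
  also have "\<dots> \<le> (2 * h * p * T) ^ 11 * (n ^ 57 * (n ^ 4) ^ 180)"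
    using pos by (intro mult_right_mono power_mono[OF 3]) auto
  also have "\<dots> = (n ^ 57 * T ^ 11) * (2 ^ 11 * h ^ 11 * p ^ 11 * (n ^ 4) ^ 180)" by algebra
  also have "\<dots> \<le> (4 ^ 19 * 24 ^ 15 * K * h ^ 133 * p ^ 39 * M ^ 180 * s ^ 9) * (2 ^ 11 * h ^ 11 * p ^ 11 * (n ^ 4) ^ 180)"
    using pos by (intro mult_right_mono[OF 6]) auto
  also have "\<dots> = (4 ^ 19 * 24 ^ 15 * 2 ^ 11 * K * h ^ 144 * p ^ 50 * s ^ 9) * (M * n ^ 4) ^ 180" by algebra
  also have "\<dots> \<le> (4 ^ 19 * 24 ^ 15 * 2 ^ 11 * K * h ^ 144 * p ^ 50 * s ^ 9) * (200 * h * p * s ^ 2) ^ 180"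
    using pos by (intro mult_left_mono power_mono[OF 4]) auto
  also have "\<dots> = (4 ^ 19 * 24 ^ 15 * 2 ^ 11 * 200 ^ 180 * K) * h ^ 324 * p ^ 230 * s ^ 369" by algebra
  finally show ?thesis .
qed

text \<open>Now \<open>T\<close> is left with a positive power on the right, so an upper bound for
  \<open>T\<close> is wanted; \<rho> \<le> p supplies it through 5. This leaves n^95 \<le> p^43 s^28
  M^190, of exponent 95/71, and 855/641 once \<open>M\<close> is removed.\<close>

lemma final_estimate_overlapping:
  fixes n s p h T M a \<rho> K :: real
  assumes pos: "0 < n" "0 < s" "0 < p" "0 < h" "0 < T" "0 < M" "0 < a" "0 < \<rho>" "0 < K"
    and 1: "n ^ 3 \<le> 4 * h * p * T * a" and 2: "a ^ 19 * \<rho> ^ 15 \<le> K * h ^ 9 * p ^ 20 * s ^ 9"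
    and 3: "\<rho> \<le> p" and 4: "M * n ^ 4 \<le> 200 * h * p * s ^ 2"
    and 5: "T * n ^ 2 = 2 ^ 27 * h * s * M ^ 10 * \<rho>"
  shows "n ^ 855 \<le> (4 ^ 19 * (2 ^ 27) ^ 19 * 200 ^ 190 * K) * h ^ 237 * p ^ 233 * s ^ 408"
proof -
  have "n ^ 87 * T ^ 15 = (n ^ 3) ^ 19 * (T * n ^ 2) ^ 15" by algebra
  also have "\<dots> \<le> (4 * h * p * T * a) ^ 19 * (T * n ^ 2) ^ 15"
    using pos by (intro mult_right_mono power_mono[OF 1]) auto
  also have "\<dots> = (4 * h * p * T) ^ 19 * (2 ^ 27 * h * s * M ^ 10) ^ 15 * (a ^ 19 * \<rho> ^ 15)"
    unfolding 5 by algebra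
  also have "\<dots> \<le> (4 * h * p * T) ^ 19 * (2 ^ 27 * h * s * M ^ 10) ^ 15 * (K * h ^ 9 * p ^ 20 * s ^ 9)"
    using pos by (intro mult_left_mono[OF 2]) auto
  also have "\<dots> = (4 ^ 19 * (2 ^ 27) ^ 15 * K * h ^ 43 * p ^ 39 * T ^ 4 * M ^ 150 * s ^ 24) * T ^ 15" by algebra
  finally have 6: "n ^ 87 \<le> 4 ^ 19 * (2 ^ 27) ^ 15 * K * h ^ 43 * p ^ 39 * T ^ 4 * M ^ 150 * s ^ 24"
    by (rule mult_right_le_imp_le) (use pos in simp)
  have 7: "T * n ^ 2 \<le> 2 ^ 27 * h * s * M ^ 10 * p"
    unfolding 5 using pos by (intro mult_left_mono[OF 3]) auto
  have "n ^ 855 = n ^ 87 * (n ^ 8 * (n ^ 4) ^ 190)" by algebra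
  also have "\<dots> \<le> (4 ^ 19 * (2 ^ 27) ^ 15 * K * h ^ 43 * p ^ 39 * T ^ 4 * M ^ 150 * s ^ 24) * (n ^ 8 * (n ^ 4) ^ 190)"
    using pos by (intro mult_right_mono[OF 6]) auto
  also have "\<dots> = (4 ^ 19 * (2 ^ 27) ^ 15 * K * h ^ 43 * p ^ 39 * M ^ 150 * s ^ 24 * (n ^ 4) ^ 190) * (T * n ^ 2) ^ 4" by algebra
  also have "\<dots> \<le> (4 ^ 19 * (2 ^ 27) ^ 15 * K * h ^ 43 * p ^ 39 * M ^ 150 * s ^ 24 * (n ^ 4) ^ 190) * (2 ^ 27 * h * s * M ^ 10 * p) ^ 4"
    using pos by (intro mult_left_mono power_mono[OF 7]) auto
  also have "\<dots> = (4 ^ 19 * (2 ^ 27) ^ 19 * K * h ^ 47 * p ^ 43 * s ^ 28) * (M * n ^ 4) ^ 190" by algebra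
  also have "\<dots> \<le> (4 ^ 19 * (2 ^ 27) ^ 19 * K * h ^ 47 * p ^ 43 * s ^ 28) * (200 * h * p * s ^ 2) ^ 190"
    using pos by (intro mult_left_mono power_mono[OF 4]) auto
  also have "\<dots> = (4 ^ 19 * (2 ^ 27) ^ 19 * 200 ^ 190 * K) * h ^ 237 * p ^ 233 * s ^ 408" by algebra
  finally show ?thesis .
qed

lemma op_set_ray:
  assumes f: "mult_op f" and X: "X \<subseteq> ray A A \<mu>" and y: "y \<in> op_set f X A"
  shows "y \<in> op_set f A A" "\<mu> * y \<in> op_set f A A"
proof -
  obtain x a where xa: "x \<in> X" "a \<in> A" "y = f x a" using y by (auto simp: op_set_def)
  then have x: "x \<in> A" "\<mu> * x \<in> A" using X by (auto simp: ray_def)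
  show "y \<in> op_set f A A" using xa x by (auto simp: op_set_def)
  have "\<mu> * y = f (\<mu> * x) a" using f xa by (auto simp: mult_op_def)
  then show "\<mu> * y \<in> op_set f A A" using xa x by (auto simp: op_set_def)
qed

lemma positive_sum_product:
  fixes A :: "real set"
  assumes fin: "finite A" and A0: "A \<noteq> {}" and posA: "\<And>a. a \<in> A \<Longrightarrow> 0 < a" and f: "mult_op f"
  defines "n \<equiv> real (card A)" and "s \<equiv> real (card (A + A))" and "p \<equiv> real (card (op_set f A A))"
    and "h \<equiv> (harm (card A) :: real)" and "K \<equiv> (1728 * 512 ^ 5 :: real)"
  shows "n ^ 799 \<le> (4 ^ 19 * 24 ^ 15 * 2 ^ 11 * 200 ^ 180 * K) * h ^ 324 * p ^ 230 * s ^ 369 \<or>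
    n ^ 855 \<le> (4 ^ 19 * (2 ^ 27) ^ 19 * 200 ^ 190 * K) * h ^ 237 * p ^ 233 * s ^ 408 \<or>
    n ^ 6 \<le> 800 * h ^ 2 * p ^ 2 * s ^ 2"
proof -
  have cA: "1 \<le> card A" using fin A0 by (simp add: Suc_leI card_gt_0_iff)
  have h1: "1 \<le> h" using cA harm_mono[of 1 "card A"] by (simp add: h_def harm_expand)
  have n1: "1 \<le> n" using cA by (simp add: n_def)
  have s1: "1 \<le> s" using card_le_card_sumset[OF fin] cA by (simp add: s_def)
  have "op_set f A A \<noteq> {}" using A0 by (auto simp: op_set_def)
  then have p1: "1 \<le> p" using fin by (simp add: p_def Suc_leI card_gt_0_iff)
  let ?Y = "ratio ` (A \<times> A)"
  have rayle: "card (ray A A \<mu>) \<le> card A" for \<mu> using fin by (intro card_mono ray_subset)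
  obtain \<tau> where \<tau>: "1 \<le> \<tau>" "\<tau> \<le> card A" "(\<Sum>\<mu>\<in>?Y. real (card (ray A A \<mu>)) ^ 2)
      \<le> real 2 * harm (card A) * (real \<tau> ^ 2 * real (card {\<mu> \<in> ?Y. \<tau> \<le> card (ray A A \<mu>)}))"
    by (rule popular_level[of ?Y "\<lambda>\<mu>. card (ray A A \<mu>)" "card A" 2]) (use fin cA rayle in auto)
  define S where "S = {\<mu> \<in> ?Y. \<tau> \<le> card (ray A A \<mu>)}"
  define N where "N = real (card S)"
  define T where "T = real \<tau>"
  have finS: "finite S" using fin by (simp add: S_def)
  have T1: "1 \<le> T" and Tn: "T \<le> n" using \<tau> by (auto simp: T_def n_def)
  have energy: "real (mult_energy A A) = (\<Sum>\<mu>\<in>?Y. real (card (ray A A \<mu>)) ^ 2)"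
    using fin by (simp add: mult_energy_def card_collisions_eq_sum card_ratio_fibre[OF posA])
  have nE: "n ^ 4 \<le> p * real (mult_energy A A)"
    using mult_energy_lower[OF fin fin posA posA f] by (simp add: n_def p_def flip: power2_eq_square power_mult)
  also have "\<dots> \<le> p * (2 * h * (T ^ 2 * N))"
    using \<tau>(3) p1 unfolding energy by (intro mult_left_mono) (auto simp: h_def T_def N_def S_def)
  finally have e1: "n ^ 4 \<le> 2 * h * p * T * (N * T)" by (simp add: power2_eq_square mult_ac)
  note nE
  also have "p * real (mult_energy A A) \<le> p * (6 * h * (s * s))"
    using solymosi_energy_bound[OF fin fin posA posA le_refl] p1
    by (intro mult_left_mono) (auto simp: h_def s_def)
  finally have e2: "n ^ 4 \<le> 6 * h * p * s ^ 2" by (simp add: power2_eq_square mult_ac)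
  have "N * T = (\<Sum>\<mu>\<in>S. T)" by (simp add: N_def)
  also have "\<dots> \<le> (\<Sum>\<mu>\<in>S. real (card (ray A A \<mu>)))" by (rule sum_mono) (auto simp: S_def T_def)
  also have "\<dots> \<le> (\<Sum>\<mu>\<in>?Y. real (card (ray A A \<mu>)))" using fin by (intro sum_mono2) (auto simp: S_def)
  also have "\<dots> = n ^ 2"
    using card_eq_sum_fibres[of "A \<times> A" ratio] fin
    by (simp add: card_ratio_fibre[OF posA] card_cartesian_product n_def power2_eq_square
        flip: of_nat_mult of_nat_sum)
  finally have e3: "N * T \<le> n ^ 2" .
  have "n ^ 2 * n ^ 2 \<le> 2 * h * p * T * (N * T)" using e1 by (simp flip: power_add)
  also have "\<dots> \<le> 2 * h * p * T * n ^ 2" using e3 h1 p1 T1 by (intro mult_left_mono) auto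
  finally have e7: "n ^ 2 \<le> 2 * h * p * T" by (rule mult_right_le_imp_le) (use n1 in simp)
  have "\<forall>\<mu>\<in>S. \<exists>Q. Q \<subseteq> ray A A \<mu> \<and> card Q = \<tau>"
    using obtain_subset_with_card_n by (metis (no_types, lifting) S_def mem_Collect_eq)
  then obtain Q where Q: "\<And>\<mu>. \<mu> \<in> S \<Longrightarrow> Q \<mu> \<subseteq> ray A A \<mu> \<and> card (Q \<mu>) = \<tau>" by metis
  have QA: "Q \<mu> \<subseteq> A" if "\<mu> \<in> S" for \<mu> using Q[OF that] ray_subset by blast
  have finQ: "finite (Q \<mu>)" if "\<mu> \<in> S" for \<mu> using QA[OF that] fin finite_subset by auto
  \<comment> \<open>The slack in Solymosi's inequality. The factor 192 = 2 * 96 is tuned to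
    contradict the block bound below; by \<open>e2\<close> the value is at least 32, so rounding up
    to \<open>m\<close> is harmless and 2 \<le> m.\<close>
  define z where "z = 192 * h * p * s ^ 2 / n ^ 4"
  define m where "m = nat \<lfloor>z\<rfloor> + 1"
  define M where "M = real m"
  have n4: "0 < n ^ 4" using n1 by simp
  have z32: "32 \<le> z" using e2 n4 by (simp add: z_def pos_le_divide_eq)
  have zM: "z < M" "M \<le> z + 1" unfolding M_def m_def using z32 by linarith+
  have m2: "2 \<le> m" and M1: "1 \<le> M" using zM z32 by (auto simp: M_def)
  have "M * n ^ 4 \<le> (z + 1) * n ^ 4" using zM n4 by (intro mult_right_mono) auto
  also have "\<dots> = 192 * h * p * s ^ 2 + n ^ 4" using n4 by (simp add: z_def distrib_right)
  also have "\<dots> \<le> 200 * h * p * s ^ 2"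
  proof -
    have "0 \<le> h * p * s ^ 2" using h1 p1 by simp
    moreover have "c * h * p * s ^ 2 = c * (h * p * s ^ 2)" for c by simp
    ultimately show ?thesis using e2 by (simp only:)
  qed
  finally have e4: "M * n ^ 4 \<le> 200 * h * p * s ^ 2" .
  have M192: "192 * h * p * s ^ 2 < M * n ^ 4" using zM(1) n4 by (simp add: z_def pos_divide_less_eq)
  \<comment> \<open>The product set sizes forced by frequent coincidences: \<rho>1 from density
    \<kappa> = 1 / M^2 and its sixth power, \<rho>2 from density \<kappa> = 1 / M and its tenth
    power.\<close>
  define \<rho>1 where "\<rho>1 = T ^ 2 / (24 * h ^ 7 * M ^ 12)"
  define \<rho>2 where "\<rho>2 = T * n ^ 2 / (2 ^ 27 * h * s * M ^ 10)"
  define \<rho> where "\<rho> = min \<rho>1 \<rho>2"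
  have \<rho>0: "0 < \<rho>" using T1 h1 M1 n1 s1 by (simp add: \<rho>_def \<rho>1_def \<rho>2_def)
  \<comment> \<open>These are slopes, not products. Outside \<open>R\<close> neither kind of
    frequent coincidence can occur, so the block bound applies to \<open>S - R\<close>.\<close>
  define R where "R = {\<mu> \<in> S. \<rho> \<le> real (card (op_set f (Q \<mu>) A))}"
  have opQ: "real (card (op_set f (Q \<mu>) (Q \<mu>))) \<le> real (card (op_set f (Q \<mu>) A))" if "\<mu> \<in> S" for \<mu>
    using finQ[OF that] fin QA[OF that] by (intro of_nat_mono card_mono op_set_mono) auto
  have blocks: "real (card (S - R) div m) * (real m ^ 2 * real \<tau> ^ 2) \<le> 24 * real (card (A + A)) ^ 2"
  proof (rule block_sumset_bound[OF fin _ posA m2])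
    show "finite (S - R)" using finS by simp
    show "0 < \<tau>" using \<tau> by simp
    show "Q \<mu> \<subseteq> ray A A \<mu> \<and> card (Q \<mu>) = \<tau>" if "\<mu> \<in> S - R" for \<mu> using Q that by auto
  next
    fix i j k l assume mem: "{i, j, k, l} \<subseteq> S - R" and ne: "distinct [i, j, k, l]"
    show "real (card (sum_collisions Q i j k l)) \<le> real \<tau> ^ 2 / real m ^ 2"
    proof (rule ccontr)
      assume "\<not> ?thesis"
      then have many: "1 / M ^ 2 * real \<tau> ^ 2 \<le> real (card (sum_collisions Q i j k l))"
        by (simp add: M_def)
      have "(1 / M ^ 2) ^ 6 * real \<tau> ^ 2 \<le> 24 * h ^ 7 * real (card (op_set f (Q i) (Q i)))"
        unfolding h_def
      proof (rule disjoint_pairs_give_many_products[OF _ _ _ \<tau>(2) ne _ f many])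
        show "finite (Q \<mu>) \<and> card (Q \<mu>) = \<tau>" if "\<mu> \<in> {i, j, k, l}" for \<mu>
          using that mem Q finQ by auto
        show "0 < x" if "x \<in> Q i" for x using that QA[of i] mem posA by auto
      qed (use \<tau> M1 in auto)
      also have "\<dots> \<le> 24 * h ^ 7 * real (card (op_set f (Q i) A))"
        using opQ[of i] mem h1 by (intro mult_left_mono) auto
      finally have "\<rho>1 \<le> real (card (op_set f (Q i) A))"
        using M1 h1 by (simp add: \<rho>1_def T_def power_divide pos_divide_le_eq field_simps flip: power_mult)
      then show False using mem by (auto simp: R_def \<rho>_def)
    qed
  next
    fix i j l assume mem: "{i, j, l} \<subseteq> S - R" and ne: "distinct [i, j, l]"
    show "real (card (sum_collisions Q i j i l)) \<le> real \<tau> ^ 2 / real m"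
    proof (rule ccontr)
      assume "\<not> ?thesis"
      then have many: "1 / M * real \<tau> ^ 2 \<le> real (card (sum_collisions Q i j i l))"
        by (simp add: M_def)
      have "(1 / M) ^ 10 * real \<tau> * real (card A) ^ 2
          \<le> 2 ^ 27 * harm (card A) * real (card (A + A)) * real (card (op_set f (Q i) A))"
      proof (rule overlapping_pairs_give_many_products[OF fin posA _ _ _ ne _ f many])
        show "Q i \<subseteq> A" using QA mem by auto
        show "finite (Q \<mu>) \<and> card (Q \<mu>) = \<tau>" if "\<mu> \<in> {i, j, l}" for \<mu>
          using that mem Q finQ by auto
      qed (use \<tau> M1 in auto)
      then have "T * n ^ 2 / M ^ 10 \<le> (2 ^ 27 * h * s) * real (card (op_set f (Q i) A))"
        by (simp add: T_def n_def h_def s_def power_divide)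
      then have "\<rho>2 \<le> real (card (op_set f (Q i) A))"
        using M1 h1 s1 by (simp add: \<rho>2_def pos_divide_le_eq mult_ac)
      then show False using mem by (auto simp: R_def \<rho>_def)
    qed
  qed
  show ?thesis
  proof (cases "N < 2 * M")
    \<comment> \<open>Too few rays for two blocks. Then T \<le> n already gives n^2 \<le> 4 h p M,
      which is far stronger than needed.\<close>
    case True
    have "n ^ 2 * n ^ 2 \<le> 2 * h * p * (T * T) * N" using e1 by (simp add: mult_ac flip: power_add)
    also have "\<dots> \<le> 2 * h * p * (n * n) * (2 * M)"
      using True Tn T1 h1 p1 by (intro mult_mono) (auto simp: N_def)
    also have "\<dots> = 4 * h * p * M * n ^ 2" by (simp add: power2_eq_square)
    finally have "n ^ 2 \<le> 4 * h * p * M" by (rule mult_right_le_imp_le) (use n1 in simp)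
    then have "n ^ 2 * n ^ 4 \<le> 4 * h * p * M * n ^ 4" using n1 by (intro mult_right_mono) auto
    also have "\<dots> = 4 * h * p * (M * n ^ 4)" by simp
    also have "\<dots> \<le> 4 * h * p * (200 * h * p * s ^ 2)" using e4 h1 p1 by (intro mult_left_mono) auto
    also have "\<dots> = 800 * h ^ 2 * p ^ 2 * s ^ 2" by algebra
    also have "n ^ 2 * n ^ 4 = n ^ 6" by algebra
    finally have "n ^ 6 \<le> 800 * h ^ 2 * p ^ 2 * s ^ 2" .
    then show ?thesis by simp
  next
    case False
    then have N2M: "2 * m \<le> card S" by (simp add: N_def M_def)
    \<comment> \<open>Otherwise more than half of the slopes lie outside \<open>R\<close>, their
      blocks give M N T^2 \<le> 96 s^2, and with \<open>e1\<close> this contradicts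
      \<open>M192\<close>.\<close>
    have R2: "card S \<le> 2 * card R"
    proof (rule ccontr)
      assume neg: "\<not> ?thesis"
      have cSR: "card (S - R) = card S - card R"
        using finS by (intro card_Diff_subset) (auto simp: R_def intro: finite_subset)
      then have big: "card S \<le> 2 * card (S - R)" and mle: "m \<le> card (S - R)" using neg N2M by auto
      let ?q = "card (S - R) div m"
      have m0: "0 < m" using m2 by simp
      have q1: "1 \<le> ?q" using mle m0 by (simp add: div_greater_zero_iff Suc_le_eq)
      have "card (S - R) = ?q * m + card (S - R) mod m" by simp
      also have "\<dots> \<le> ?q * m + m" using m0 by (intro add_left_mono) (simp add: less_imp_le)
      also have "\<dots> \<le> 2 * ?q * m" using q1 by (cases ?q) auto
      finally have "card S \<le> 4 * (?q * m)" using big by simp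
      then have Nq: "N \<le> 4 * (real ?q * M)" unfolding N_def M_def
        by (metis of_nat_le_iff of_nat_mult of_nat_numeral)
      have "M * (N * T ^ 2) \<le> M * (4 * (real ?q * M) * T ^ 2)"
        using Nq M1 by (intro mult_left_mono mult_right_mono) auto
      also have "\<dots> = 4 * (real ?q * (M ^ 2 * T ^ 2))" by (simp add: power2_eq_square)
      also have "\<dots> \<le> 4 * (24 * s ^ 2)" using blocks by (intro mult_left_mono) (auto simp: M_def T_def s_def)
      finally have b1: "M * (N * T ^ 2) \<le> 96 * s ^ 2" by simp
      have "M * n ^ 4 \<le> M * (2 * h * p * T * (N * T))" using e1 M1 by (intro mult_left_mono) auto
      also have "\<dots> = 2 * h * p * (M * (N * T ^ 2))" by (simp add: power2_eq_square)
      also have "\<dots> \<le> 2 * h * p * (96 * s ^ 2)" using b1 h1 p1 by (intro mult_left_mono) auto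
      finally show False using M192 by simp
    qed
    have finR: "finite R" using finS by (simp add: R_def)
    let ?G = "\<lambda>b. {a \<in> A. a / b \<in> R}"
    have "card (SIGMA \<mu>:R. {u \<in> A \<times> A. ratio u = \<mu>}) \<le> card (SIGMA b:A. ?G b)"
    proof (rule card_inj_on_le[of snd])
      show "inj_on snd (SIGMA \<mu>:R. {u \<in> A \<times> A. ratio u = \<mu>})" by (auto simp: inj_on_def)
    qed (use fin in \<open>auto simp: ratio_def\<close>)
    moreover have "card (SIGMA \<mu>:R. {u \<in> A \<times> A. ratio u = \<mu>}) = (\<Sum>\<mu>\<in>R. card (ray A A \<mu>))"
      using finR fin by (simp add: card_SigmaI card_ratio_fibre[OF posA])
    moreover have "(\<Sum>\<mu>\<in>R. \<tau>) \<le> (\<Sum>\<mu>\<in>R. card (ray A A \<mu>))"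
      by (rule sum_mono) (auto simp: R_def S_def)
    ultimately have sumG: "card R * \<tau> \<le> (\<Sum>b\<in>A. card (?G b))" using fin by (simp add: card_SigmaI)
    \<comment> \<open>The rays with slopes in \<open>R\<close> carry at least N T / 2 points of A
      \<times> A; some abscissa \<open>b\<close> has at least the average share of them.\<close>
    have "\<exists>b\<in>A. N * T \<le> 2 * n * real (card (?G b))"
    proof (rule ccontr)
      assume "\<not> ?thesis"
      then have lt: "2 * n * real (card (?G b)) < N * T" if "b \<in> A" for b using that by auto
      have "(\<Sum>b\<in>A. 2 * n * real (card (?G b))) < (\<Sum>b\<in>A. N * T)"
        using fin A0 lt by (intro sum_strict_mono) auto
      then have "2 * n * (\<Sum>b\<in>A. real (card (?G b))) < n * (N * T)"
        by (simp add: n_def flip: sum_distrib_left)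
      then have "2 * (\<Sum>b\<in>A. real (card (?G b))) < N * T" using n1 by (simp add: mult.left_commute)
      moreover have "real (card R * \<tau>) \<le> (\<Sum>b\<in>A. real (card (?G b)))"
        using sumG of_nat_mono[OF sumG, where 'a = real] by simp
      moreover have "N * T \<le> 2 * real (card R) * T"
        using R2 T1 by (intro mult_right_mono) (auto simp: N_def)
      ultimately show False by (simp add: T_def)
    qed
    then obtain b where b: "b \<in> A" "N * T \<le> 2 * n * real (card (?G b))" by blast
    define A' where "A' = ?G b"
    define a where "a = real (card A')"
    have finA': "finite A'" and sub: "A' \<subseteq> A" using fin by (auto simp: A'_def)
    have "n * n ^ 3 = n ^ 4" by (simp add: power_numeral_reduce)
    also have "\<dots> \<le> 2 * h * p * T * (N * T)" by (rule e1)
    also have "\<dots> \<le> 2 * h * p * T * (2 * n * a)"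
      unfolding a_def A'_def using h1 p1 T1 by (intro mult_left_mono[OF b(2)]) auto
    also have "\<dots> = n * (4 * h * p * T * a)" by simp
    finally have f1: "n ^ 3 \<le> 4 * h * p * T * a" by (rule mult_left_le_imp_le) (use n1 in simp)
    have "0 < n ^ 3" using n1 by simp
    then have "0 < 4 * h * p * T * a" using f1 by linarith
    then have "a \<noteq> 0" by auto
    then have a0: "0 < a" by (simp add: a_def)
    then have A'0: "A' \<noteq> {}" by (auto simp: a_def)
    define Y where "Y x = op_set f (Q (x / b)) A" for x
    have pos\<Pi>: "0 < y" if "y \<in> op_set f A A" for y
      using that f posA by (auto simp: op_set_def mult_op_def)
    have Y: "Y x \<subseteq> op_set f A A \<and> \<rho> \<le> real (card (Y x)) \<and> (\<forall>y\<in>Y x. x / b * y \<in> op_set f A A)" if "x \<in> A'" for x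
    proof -
      have R': "x / b \<in> R" "x / b \<in> S" using that by (auto simp: A'_def R_def)
      show ?thesis using op_set_ray[OF f, of "Q (x / b)" A "x / b"] Q[OF R'(2)] R'(1)
        by (auto simp: Y_def R_def)
    qed
    have ST: "szemeredi_trotter_const A' (512 * real (card (op_set f A A)) ^ 4 / \<rho> ^ 3)"
      by (rule szemeredi_trotter_const_of_products[OF finA' _ pos\<Pi> posA[OF b(1)] \<rho>0 Y])
        (use fin in auto)
    have cA': "card A' \<le> card A" using sub fin by (rule card_mono[rotated])
    have "a ^ 19 \<le> 1728 * h ^ 9 * (512 * p ^ 4 / \<rho> ^ 3) ^ 5 * real (card (A' + A')) ^ 9"
      using sumset_lower_bound[OF finA' A'0 cA' ST] by (simp add: a_def h_def p_def)
    also have "\<dots> \<le> 1728 * h ^ 9 * (512 * p ^ 4 / \<rho> ^ 3) ^ 5 * s ^ 9"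
    proof (intro mult_left_mono power_mono)
      have "card (A' + A') \<le> card (A + A)"
        using sub fin by (intro card_mono finite_set_plus set_plus_mono2)
      then show "real (card (A' + A')) \<le> s" by (simp add: s_def)
    qed (use h1 p1 \<rho>0 in auto)
    also have "\<dots> = (K * h ^ 9 * p ^ 20 * s ^ 9) / \<rho> ^ 15"
      by (simp add: K_def power_divide power_mult_distrib flip: power_mult)
    finally have f2: "a ^ 19 * \<rho> ^ 15 \<le> K * h ^ 9 * p ^ 20 * s ^ 9"
      using \<rho>0 by (simp add: pos_le_divide_eq)
    have K0: "0 < K" by (simp add: K_def)
    have pp: "0 < n" "0 < s" "0 < p" "0 < h" "0 < T" "0 < M" using n1 s1 p1 h1 T1 M1 by auto
    show ?thesis
    proof (cases "\<rho>1 \<le> \<rho>2")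
      case True
      then have "T ^ 2 = 24 * h ^ 7 * M ^ 12 * \<rho>" using pp by (simp add: \<rho>_def \<rho>1_def)
      then show ?thesis
        using final_estimate_disjoint[OF pp a0 \<rho>0 K0 f1 f2 e7 e4] by blast
    next
      case False
      then have eq: "T * n ^ 2 = 2 ^ 27 * h * s * M ^ 10 * \<rho>" using pp by (simp add: \<rho>_def \<rho>2_def)
      obtain x where x: "x \<in> A'" using A'0 by auto
      have "real (card (Y x)) \<le> p" unfolding p_def
        using Y[OF x] fin by (intro of_nat_mono card_mono) auto
      then have "\<rho> \<le> p" using Y[OF x] by linarith
      then show ?thesis
        using final_estimate_overlapping[OF pp a0 \<rho>0 K0 f1 f2 _ e4 eq] by blast
    qed
  qed
qed

section \<open>From power inequalities to exponents, and from positive to arbitrary sets\<close>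

lemma powr_le_of_power_le:
  fixes n u h C e :: real
  assumes pos: "1 \<le> n" "1 \<le> u" "1 \<le> h" "1 \<le> C" and d: "b \<le> d" "0 < d" and e: "e \<le> real a / real d"
    and le: "n ^ a \<le> C * h ^ b * u ^ d"
  shows "n powr e \<le> C * h * u"
proof -
  \<comment> \<open>Raising \<open>C\<close> and \<open>h\<close> to the power \<open>d\<close> as
    well allows one d-th root to be taken; the logarithm then enters only linearly.\<close>
  have "C * h ^ b * u ^ d \<le> C ^ d * h ^ d * u ^ d"
    using pos d by (intro mult_right_mono mult_mono power_increasing self_le_power) auto
  then have le': "n ^ a \<le> (C * h * u) ^ d" using le by (simp add: power_mult_distrib)
  have chu: "0 < C * h * u" using pos by simp
  have "n powr e \<le> n powr (real a / real d)" using pos e by (intro powr_mono) auto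
  also have "\<dots> = (n ^ a) powr (1 / real d)" using pos by (simp add: powr_powr flip: powr_realpow)
  also have "\<dots> \<le> ((C * h * u) ^ d) powr (1 / real d)" using pos le' by (intro powr_mono2) auto
  also have "\<dots> = (C * h * u) powr (real d * (1 / real d))"
    using chu by (simp add: powr_powr flip: powr_realpow)
  also have "\<dots> = C * h * u" using d chu by simp
  finally show ?thesis .
qed

lemma positive_sum_product_powr:
  "\<exists>K\<ge>1. \<forall>A f. finite A \<and> A \<noteq> {} \<and> (\<forall>a\<in>A. 0 < a) \<and> mult_op f \<longrightarrow>
    real (card A) powr (4 / 3 + 5 / 9813)
      \<le> K * harm (card A) * real (max (card (A + A)) (card (op_set f A A)))"
proof -
  define K1 K2 K :: real where "K1 = 4 ^ 19 * 24 ^ 15 * 2 ^ 11 * 200 ^ 180 * (1728 * 512 ^ 5)"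
    and "K2 = 4 ^ 19 * (2 ^ 27) ^ 19 * 200 ^ 190 * (1728 * 512 ^ 5)" and "K = K1 + K2 + 800"
  have K1: "1 \<le> K1" and K2: "1 \<le> K2" by (simp_all add: K1_def K2_def)
  show ?thesis
  proof (intro exI[of _ K] conjI allI impI, goal_cases)
    case 1
    show "1 \<le> K" using K1 K2 by (simp add: K_def)
  next
    case (2 A f)
    then have A: "finite A" "A \<noteq> {}" "\<And>a. a \<in> A \<Longrightarrow> 0 < a" and f: "mult_op f" by auto
    define n s p h where "n = real (card A)" and "s = real (card (A + A))"
      and "p = real (card (op_set f A A))" and "h = (harm (card A) :: real)"
    define u where "u = max s p"
    have cA: "1 \<le> card A" using A by (simp add: Suc_leI card_gt_0_iff)
    have h1: "1 \<le> h" using cA harm_mono[of 1 "card A"] by (simp add: h_def harm_expand)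
    have n1: "1 \<le> n" using cA by (simp add: n_def)
    have s1: "1 \<le> s" using card_le_card_sumset[OF A(1)] cA by (simp add: s_def)
    have su: "s \<le> u" "p \<le> u" and u1: "1 \<le> u" and p0: "0 \<le> p" using s1 by (auto simp: u_def p_def)
    have mono: "p ^ i * s ^ j \<le> u ^ (i + j)" for i j
      unfolding power_add using su s1 u1 p0 by (intro mult_mono power_mono) auto
    \<comment> \<open>\<open>u\<close> dominates both cardinalities, so only the total exponent i +
      j matters: it is 599, 641 and 4 in the three cases.\<close>
    have *: "n powr (4 / 3 + 5 / 9813) \<le> K * h * u"
      if "n ^ k \<le> C * h ^ b * (p ^ i * s ^ j)" "1 \<le> C" "C \<le> K" "b \<le> i + j" "0 < i + j"
        "4 / 3 + 5 / 9813 \<le> real k / real (i + j)" for k C b i j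
    proof -
      have "C * h ^ b * (p ^ i * s ^ j) \<le> C * h ^ b * u ^ (i + j)"
        using that h1 by (intro mult_left_mono mono) auto
      with that(1) have "n ^ k \<le> C * h ^ b * u ^ (i + j)" by linarith
      then have "n powr (4 / 3 + 5 / 9813) \<le> C * h * u"
        using that n1 u1 h1 by (intro powr_le_of_power_le[of n u h C b "i + j" _ k]) auto
      also have "\<dots> \<le> K * h * u" using that h1 u1 by (intro mult_right_mono) auto
      finally show ?thesis .
    qed
    have "n ^ 799 \<le> K1 * h ^ 324 * p ^ 230 * s ^ 369 \<or> n ^ 855 \<le> K2 * h ^ 237 * p ^ 233 * s ^ 408 \<or>
        n ^ 6 \<le> 800 * h ^ 2 * p ^ 2 * s ^ 2"
      unfolding n_def s_def p_def h_def K1_def K2_def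
      by (rule positive_sum_product[OF A(1,2) _ f]) (rule A(3))
    then have "n powr (4 / 3 + 5 / 9813) \<le> K * h * u"
    proof (elim disjE)
      assume "n ^ 799 \<le> K1 * h ^ 324 * p ^ 230 * s ^ 369"
      then show ?thesis using K1 K2 by (intro *[of 799 K1 324 230 369]) (auto simp: K_def mult.assoc)
    next
      assume "n ^ 855 \<le> K2 * h ^ 237 * p ^ 233 * s ^ 408"
      then show ?thesis using K1 K2 by (intro *[of 855 K2 237 233 408]) (auto simp: K_def mult.assoc)
    next
      assume "n ^ 6 \<le> 800 * h ^ 2 * p ^ 2 * s ^ 2"
      then show ?thesis using K1 K2 by (intro *[of 6 800 2 2 2]) (auto simp: K_def mult.assoc)
    qed
    then show "real (card A) powr (4 / 3 + 5 / 9813)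
        \<le> K * harm (card A) * real (max (card (A + A)) (card (op_set f A A)))"
      by (simp add: n_def s_def p_def h_def u_def of_nat_max)
  qed
qed

lemma harm_le_ln: "1 \<le> n \<Longrightarrow> (harm n :: real) \<le> 1 + ln (real n)"
proof -
  assume "1 \<le> n"
  then obtain k where n: "n = Suc k" by (cases n) auto
  have "harm (Suc k) - ln (real (Suc k)) \<le> harm (Suc 0) - ln (real (Suc 0))"
    using decseq_harm_diff_ln by (rule decseqD) simp
  then show ?thesis by (simp add: n harm_expand)
qed

text \<open>A set of reals or its negative has at least a quarter of its elements positive; passing to this
  part shrinks the sumset, the product set and the quotient set.\<close>

lemma polylog_sum_product:
  fixes P :: "real set \<Rightarrow> real set"
  assumes f: "mult_op f"
    and P: "\<And>A. finite A \<Longrightarrow> finite (P A)"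
    and sub: "\<And>A B. B \<subseteq> A \<Longrightarrow> (\<And>b. b \<in> B \<Longrightarrow> b \<noteq> 0) \<Longrightarrow> op_set f B B \<subseteq> P A"
  shows "polylog_le (\<lambda>A. real (card A) powr (4 / 3 + 5 / 9813))
    (\<lambda>A. real (max (card (A + A)) (card (P A))))"
proof -
  obtain K where K: "1 \<le> K" "\<forall>A f. finite A \<and> A \<noteq> {} \<and> (\<forall>a\<in>A. 0 < a) \<and> mult_op f \<longrightarrow>
      real (card A) powr (4 / 3 + 5 / 9813)
        \<le> K * harm (card A) * real (max (card (A + A)) (card (op_set f A A)))"
    using positive_sum_product_powr by blast
  define e :: real where "e = 4 / 3 + 5 / 9813"
  \<comment> \<open>Absorbs the 1 in \<open>1 + ln n\<close>, since ln n \<ge> ln 2. The exponent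
    \<open>C\<close> of the logarithm can thus be 1.\<close>
  define L where "L = 1 + 1 / ln (2::real)"
  have ln2: "0 < ln (2::real)" by simp
  have "real (card A) powr e \<le> (4 powr e * K * L) * (real (max (card (A + A)) (card (P A))) * ln (real (card A)) powr 1)"
    if A: "finite A" "2 \<le> card A" for A
  proof -
    define A1 A2 where "A1 = {a \<in> A. 0 < a}" and "A2 = {a \<in> A. a < 0}"
    define n where "n = card A"
    have "A \<subseteq> insert 0 (A1 \<union> A2)" by (auto simp: A1_def A2_def)
    then have "card A \<le> card (insert 0 (A1 \<union> A2))"
      using A by (intro card_mono) (auto simp: A1_def A2_def)
    also have "\<dots> \<le> Suc (card A1 + card A2)"
      using card_Un_le[of A1 A2] card_insert_le_m1[of "Suc (card A1 + card A2)" "A1 \<union> A2" 0] by simp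
    finally have split: "n \<le> 1 + card A1 + card A2" by (simp add: n_def)
    obtain B where B: "finite B" "\<And>b. b \<in> B \<Longrightarrow> 0 < b" "real n \<le> 4 * real (card B)" "card B \<le> n"
      "card (B + B) \<le> card (A + A)" "card (op_set f B B) \<le> card (P A)"
    proof (cases "n \<le> 4 * card A1")
      case True
      show thesis
      proof (rule that[of A1])
        show "real n \<le> 4 * real (card A1)" using True by simp
        have s: "A1 \<subseteq> A" by (auto simp: A1_def)
        show "card A1 \<le> n" using s A by (simp add: n_def card_mono)
        show "card (A1 + A1) \<le> card (A + A)"
          using s A by (intro card_mono finite_set_plus set_plus_mono2)
        show "card (op_set f A1 A1) \<le> card (P A)"
          using s A P by (intro card_mono sub) (auto simp: A1_def)
      qed (use A in \<open>auto simp: A1_def\<close>)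
    next
      \<comment> \<open>If both signs had fewer than n / 4 elements, then n < 1 + n / 2, where the 1
        allows for zero; this contradicts 2 \<le> n.\<close>
      case False
      then have c2: "n \<le> 4 * card A2" using split A by (simp add: n_def)
      define B where "B = uminus ` A2"
      have s: "A2 \<subseteq> A" by (auto simp: A2_def)
      have cB: "card B = card A2" by (simp add: B_def card_image)
      show thesis
      proof (rule that[of B])
        show "finite B" using A by (simp add: B_def A2_def)
        show "0 < b" if "b \<in> B" for b using that by (auto simp: B_def A2_def)
        show "real n \<le> 4 * real (card B)" using c2 cB by simp
        show "card B \<le> n" using s A cB by (simp add: n_def card_mono)
        show "card (B + B) \<le> card (A + A)"
        proof (rule card_inj_on_le[of uminus])
          show "uminus ` (B + B) \<subseteq> A + A"
          proof clarify
            fix x assume "x \<in> B + B"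
            then obtain y z where yz: "y \<in> A2" "z \<in> A2" "x = - y + - z" by (auto simp: B_def set_plus_def)
            then have "- x = y + z" "y \<in> A" "z \<in> A" using s by auto
            then show "- x \<in> A + A" by (auto simp: set_plus_def)
          qed
        qed (use A in \<open>auto simp: finite_set_plus\<close>)
        \<comment> \<open>The two signs cancel in a product and in a quotient.\<close>
        have "op_set f B B = op_set f A2 A2"
          using f by (force simp: op_set_def B_def mult_op_def image_iff)
        moreover have "op_set f A2 A2 \<subseteq> P A" by (rule sub[OF s]) (auto simp: A2_def)
        ultimately show "card (op_set f B B) \<le> card (P A)"
          using A P by (simp add: card_mono)
      qed
    qed
    define u where "u = real (max (card (A + A)) (card (P A)))"
    have n2: "2 \<le> real n" using A by (simp add: n_def)
    have B0: "B \<noteq> {}" using B(3) n2 by auto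
    have cB: "1 \<le> card B" using B0 B(1) by (simp add: Suc_leI card_gt_0_iff)
    have "real n powr e \<le> (4 * real (card B)) powr e"
      using B(3) by (intro powr_mono2) (auto simp: e_def)
    also have "\<dots> = 4 powr e * real (card B) powr e" by (simp add: powr_mult)
    also have "\<dots> \<le> 4 powr e * (K * harm (card B) * real (max (card (B + B)) (card (op_set f B B))))"
    proof (rule mult_left_mono)
      show "real (card B) powr e \<le> K * harm (card B) * real (max (card (B + B)) (card (op_set f B B)))"
        unfolding e_def using K(2) B(1,2) B0 f by blast
    qed simp
    also have "\<dots> \<le> 4 powr e * (K * (L * ln (real n)) * u)"
    proof (intro mult_left_mono mult_mono)
      have "harm (card B) \<le> 1 + ln (real (card B))" by (rule harm_le_ln[OF cB])
      also have "\<dots> \<le> 1 + ln (real n)" using B(4) cB by simp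
      also have "1 \<le> 1 / ln 2 * ln (real n)" using n2 ln2 by (simp add: field_simps)
      finally show "harm (card B) \<le> L * ln (real n)" by (simp add: L_def algebra_simps)
      show "real (max (card (B + B)) (card (op_set f B B))) \<le> u"
        unfolding u_def using B(5,6) by (intro of_nat_mono max.mono)
    qed (use K(1) n2 ln2 in \<open>auto simp: L_def\<close>)
    finally show ?thesis using n2 by (simp add: n_def u_def mult_ac)
  qed
  moreover have "0 < 4 powr e * K * L" using K(1) ln2 by (simp add: L_def add_pos_pos)
  ultimately have "\<exists>C>0. \<exists>K>0. \<forall>A. finite A \<and> 2 \<le> card A \<longrightarrow>
      \<bar>real (card A) powr e\<bar> \<le> K * \<bar>real (max (card (A + A)) (card (P A))) * ln (real (card A)) powr C\<bar>"
    by (intro exI[of _ 1] conjI exI[of _ "4 powr e * K * L"]) (auto simp: abs_mult)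
  then show ?thesis unfolding polylog_le_def e_def .
qed

theorem theorem3:
  fixes c :: real
  assumes "c = 5 / 9813"
  shows "polylog_le (\<lambda>A. real (card A) powr (4 / 3 + c))
           (\<lambda>A. real (max (card (A + A)) (card (A * A)))) \<and>
         polylog_le (\<lambda>A. real (card A) powr (4 / 3 + c))
           (\<lambda>A. real (max (card (A + A)) (card (quotient_set A A))))"
proof -
  have quot: "quotient_set A A \<subseteq> (\<lambda>(a, b). a / b) ` (A \<times> A)" for A
    by (auto simp: quotient_set_def)
  have "polylog_le (\<lambda>A. real (card A) powr (4 / 3 + 5 / 9813)) (\<lambda>A. real (max (card (A + A)) (card (A * A))))"
    by (rule polylog_sum_product[of "(*)"])
      (auto simp: mult_op_def op_set_def finite_set_times intro: set_times_intro)
  moreover have "polylog_le (\<lambda>A. real (card A) powr (4 / 3 + 5 / 9813))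
      (\<lambda>A. real (max (card (A + A)) (card (quotient_set A A))))"
  proof (rule polylog_sum_product[of "(/)"])
    show "finite (quotient_set A A)" if "finite A" for A
      using quot[of A] that finite_subset by blast
    \<comment> \<open>That \<open>B\<close> avoids zero meets the condition on denominators in
      \<open>quotient_set\<close>.\<close>
    show "op_set (/) B B \<subseteq> quotient_set A A" if "B \<subseteq> A" "\<And>b. b \<in> B \<Longrightarrow> b \<noteq> 0" for A B
      using that by (fastforce simp: op_set_def quotient_set_def)
  qed (simp add: mult_op_def)
  ultimately show ?thesis unfolding assms by blast
qed

end
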